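(* Let $X$ be a smooth hypertoric variety with generic stability parameter $\theta$ and generic cocharacter $\sigma$, and $X'$ its 3d mirror. Under the isomorphism of parameters $$\kappa_{\rm Stab}:\ \mathsf K^\vee\times\mathsf A\times\mathbb C^*_\hbar\xrightarrow{\ \sim\ }\mathsf A'\times(\mathsf K')^\vee\times\mathbb C^*_\hbar,\qquad(z_i,a_i,\hbar)\mapsto(a_i',z_i',\hbar^{-1}),$$ we have: 1) There is a line bundle $\mathfrak M$ on $\mathrm{Ell}_{\mathsf T\times\mathsf T'\times\mathbb C^*_\hbar}(X\times X')$ such that, for all $\mathbf p\in X^{\mathbb T}$ with corresponding $\mathbf p'\in(X')^{\mathbb T'}$, $(i_{\mathbf p'}^* )^*\mathfrak M=\mathfrak M(\mathbf p)$ and $(i_{\mathbf p}^* )^*\mathfrak M=\mathfrak M'(\mathbf p')$. 2) There is a section $\mathfrak m$ of $\mathfrak M$ (the "duality interface") such that, for all such $\mathbf p$, $(i_{\mathbf p'}^* )^*\mathfrak m=\mathbf{Stab}_\sigma(\mathbf p)$ and $(i_{\mathbf p}^* )^*\mathfrak m=\mathbf{Stab}'_{\sigma'}(\mathbf p')$. 3) The duality interface has the explicit form $$\mathfrak m=\prod_{i=1}^n\vartheta(x_ix_i').$$ In particular, it comes from a section of a universal line bundle on the prequotient $\mathrm{Ell}_{\mathsf T\times\mathsf T'\times\mathbb C^*_\hbar\times\mathsf T^\vee\times(\mathsf T')^\vee}(\mathrm{pt})$, and does not depend on the choices of $\theta$ or $\sigma$.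
   Context: Hypertoric varieties. Fix an exact sequence $0\to\mathbb Z^k\xrightarrow{\iota}\mathbb Z^n\xrightarrow{\beta}\mathbb Z^d\to0$, $e_i$ the standard basis of $\mathbb Z^n$, $e_i^*$ the dual basis, $\mathsf K=(\mathbb C^* )^k$, $\mathsf T=(\mathbb C^* )^n$, $\mathsf A=\mathsf T/\mathsf K$. $\mathsf K$ acts via $\iota$ on $T^*\mathbb C^n$ with moment map $\mu(z,w)=\iota^\vee(z_1w_1,\dots,z_nw_n)$. For generic $\theta\in(\mathbb Z^k)^\vee$ with lift $\widetilde\theta\in(\mathbb Z^n)^\vee$, $X=\mu^{-1}(0)/\!/_\theta\mathsf K=\mu^{-1}(0)^s/\mathsf K$ is smooth. $\mathbb T=\mathsf T\times\mathbb C_\hbar^*$ acts on $X$, $\mathbb C^*_\hbar$ scaling cotangent directions with character $\hbar^{-1}$; equivariant parameters $a_1,\dots,a_n,\hbar$. $L_i=\mu^{-1}(0)^s\times_{\mathsf K}\mathbb C_{e_i^*}$, with class (Chern root) $x_i$. $\sigma\in\mathbb Z^d$ is a generic cocharacter of $\mathsf A$ ($X^\sigma=X^{\mathbb T}$) with lift $\widetilde\sigma\in\mathbb Z^n$. Fixed points. $H_i=\{x\in(\mathbb R^d)^\vee:\langle x,\beta(e_i)\rangle=-\langle\widetilde\theta,e_i\rangle\}$, $H_i^\pm$: $\langle x,\beta(e_i)\rangle\ge$ (resp. $\le$) $-\langle\widetilde\theta,e_i\rangle$. Fixed points are $d$-subsets $\mathbf p\subset\{1,\dots,n\}$ with $\bigcap_{i\in\mathbf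 p}H_i\neq\emptyset$ (a vertex). $\mathcal A_{\mathbf p}$ is the complement of $\mathbf p$, $\mathcal A_{\mathbf p}^\pm=\{i\notin\mathbf p:\mathbf p\in H_i^\pm\}$; integers $C_{ij}=C_{ij}(\mathbf p)$ ($i\in\mathbf p,j\notin\mathbf p$) are defined by $\beta(e_j)=-\sum_{i\in\mathbf p}C_{ij}\beta(e_i)$; $\mathbf p^\pm=\{i\in\mathbf p:\pm(\widetilde\sigma_i-\sum_{j\notin\mathbf p}C_{ij}\widetilde\sigma_j)>0\}$. Restrictions: $x_i|_{\mathbf p}=1$ ($i\in\mathcal A_{\mathbf p}^+$), $\hbar^{-1}$ ($i\in\mathcal A_{\mathbf p}^-$), $a_i\prod_{j\notin\mathbf p}a_j^{-C_{ij}}\hbar^{-\sum_{j\in\mathcal A_{\mathbf p}^-}C_{ij}}$ ($i\in\mathbf p$). Kähler parameters $z_1,\dots,z_n$ are coordinates on $\mathsf T^\vee$; $\zeta_j(\mathbf p)=z_j\prod_{i\in\mathbf p}z_i^{C_{ij}}$ for $j\notin\mathbf p$. Elliptic stable envelope. Fix $q$ with $|q|<1$; $\vartheta(x)=(x^{1/2}-x^{-1/2})\prod_{m\ge1}(1-q^mx)(1-q^mx^{-1})$. $E=\mathbb C^*/q^{\mathbb Z}$, $\mathcal E_{\mathbb T}=\mathrm{Ell}_{\mathbb T}(\mathrm{pt})=E^{n+1}$ (coordinates $a_i,\hbar$), $\mathcal E_{\mathsf T^\vee}=E^n$ (coordinates $z_i$), $\mathsf S(X)=E^k$ (elliptic Chern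 roots $s_j$), $x_i=a_i\prod_js_j^{\iota_{ij}}$. The equivariant elliptic cohomology scheme $\mathrm{Ell}_{\mathbb T}(X)\subset\mathsf S(X)\times\mathcal E_{\mathbb T}$ is the union of components $\mathsf O_{\mathbf p}\cong\mathcal E_{\mathbb T}$ ($\mathbf p\in X^{\mathbb T}$), on which $x_i=x_i|_{\mathbf p}$; $\mathsf E_{\mathbb T}(X)=\mathrm{Ell}_{\mathbb T}(X)\times\mathcal E_{\mathsf T^\vee}$. $\mathcal T(\mathbf p)$ is the pullback to $\mathsf E_{\mathbb T}(X)$ of the line bundle on $\mathsf S(X)\times\mathcal E_{\mathbb T}\times\mathcal E_{\mathsf T^\vee}$ whose sections have the $q$-quasi-periods of $$\prod_{i\in\mathbf p^+}\vartheta(\hbar x_i)\prod_{i\in\mathbf p^-}\vartheta(x_i)\prod_{j\in\mathcal A_{\mathbf p}^+}\frac{\vartheta(x_j\zeta_j(\mathbf p)\hbar^{-\sum_{i\in\mathbf p^+}C_{ij}})}{\vartheta(\zeta_j(\mathbf p)\hbar^{-\sum_{i\in\mathbf p^+}C_{ij}})}\prod_{j\in\mathcal A_{\mathbf p}^-}\frac{\vartheta(x_j\zeta_j(\mathbf p)\hbar^{-\sum_{i\in\mathbf p^+}C_{ij}})}{\vartheta(\hbar^{-1}\zeta_j(\mathbf p)\hbar^{-\sum_{i\in\mathbf p^+}C_{ij}})}.$$ $\mathrm{Stab}_\sigma(\mathbf p)$ (for the polarization $T_X^{1/2}=\sum_iL_i-\mathcal O^{\oplus k}$) is the unique (Aganagic–Okounkov)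 section of $\mathcal T(\mathbf p)$, holomorphic over $\mathcal E_{\mathbb T}$, meromorphic over $\mathcal E_{\mathsf T^\vee}$ and in $\hbar$, such that (i) it is supported on the full attracting set $\mathrm{Attr}^f_\sigma(\mathbf p)$ (the minimal closed subset containing $\mathbf p$ and closed under taking $\mathrm{Attr}_\sigma(\cdot)$, where $\mathrm{Attr}_\sigma(\mathbf q)=\{x:\lim_{t\to0}\sigma(t)x=\mathbf q\}$), and (ii) $\mathrm{Stab}_\sigma(\mathbf p)|_{\mathbf p}=\prod_{i\in\mathbf p^+}\vartheta(\hbar x_i|_{\mathbf p})\prod_{i\in\mathbf p^-}\vartheta(x_i|_{\mathbf p})$. Mirror. $X'$ is the hypertoric variety of the dual sequence $0\to(\mathbb Z^d)^\vee\xrightarrow{\beta^\vee}(\mathbb Z^n)^\vee\xrightarrow{\iota^\vee}(\mathbb Z^k)^\vee\to0$ with $\widetilde\theta'=-\widetilde\sigma$, $\widetilde\sigma'=-\widetilde\theta$; all its data are primed ($\mathsf K'=\mathsf A^\vee$, $\mathsf A'=\mathsf K^\vee$, $x'_i,a_i',z_i'$, $\mathrm{Stab}'_{\sigma'}$, …). Fixed points correspond by $\mathbf p\mapsto\mathbf p'=\{1,\dots,n\}\setminus\mathbf p$. $\kappa_{\rm Stab}$ identifies $z_i=a_i'$, $a_i=z_i'$, and the parameter $\hbar$ of $X'$ with $\hbar^{-1}$; all functions and line bundles for $X$ and $X'$ are compared through it. Normalized envelopes: $\mathbf{Stab}_\sigma(\mathbf p)=\mathrm{Stab}_\sigma(\mathbf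 p)\cdot\mathrm{Stab}'_{\sigma'}(\mathbf p')|_{\mathbf p'}$ and $\mathbf{Stab}'_{\sigma'}(\mathbf p')=\mathrm{Stab}'_{\sigma'}(\mathbf p')\cdot\mathrm{Stab}_\sigma(\mathbf p)|_{\mathbf p}$. $\mathfrak M(\mathbf p)$ and $\mathfrak M'(\mathbf p')$ are the line bundles on $\mathsf E_{\mathbb T}(X)$ and $\mathsf E_{\mathbb T'}(X')$ of which $\mathbf{Stab}_\sigma(\mathbf p)$ and $\mathbf{Stab}'_{\sigma'}(\mathbf p')$ are sections. Restrictions. The equivariant embeddings $X=X\times\{\mathbf p'\}\hookrightarrow X\times X'\hookleftarrow\{\mathbf p\}\times X'=X'$ induce, using $\mathcal E_{\mathsf T'}\cong\mathcal E_{\mathsf T^\vee}$ and $\mathcal E_{\mathsf T}\cong\mathcal E_{(\mathsf T')^\vee}$ from $\kappa_{\rm Stab}$, maps $i^*_{\mathbf p'}:\mathsf E_{\mathbb T}(X)\to\mathrm{Ell}_{\mathsf T\times\mathsf T'\times\mathbb C_\hbar^*}(X\times X')$ and $i^*_{\mathbf p}:\mathsf E_{\mathbb T'}(X')\to\mathrm{Ell}_{\mathsf T\times\mathsf T'\times\mathbb C_\hbar^*}(X\times X')$; $(i^*_{\mathbf p'})^*$ and $(i^*_{\mathbf p})^*$ denote pullback along them (i.e. setting $x_i'=x_i'|_{\mathbf p'}$, resp. $x_i=x_i|_{\mathbf p}$). *)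

theory Defs
  imports "HOL-Analysis.Analysis"
begin

section \<open>Theta function, complex tori, line bundles and sections\<close>

text \<open>
  All elliptic objects are written additively: a multiplicative coordinate \<open>x\<close> is
  \<open>exp (2 \<pi> i u)\<close> and \<open>q = exp (2 \<pi> i \<tau>)\<close> with \<open>Im \<tau> > 0\<close>, so that
  \<open>E = \<complex>\<^sup>\<times> / q\<^sup>\<int> = \<complex> / (\<int> + \<int>\<tau>)\<close>. This also fixes the branch \<open>x\<^sup>1\<^sup>/\<^sup>2 = exp (\<pi> i u)\<close>.
\<close>

definition theta :: "complex \<Rightarrow> complex \<Rightarrow> complex" where
  "theta \<tau> u =
     (exp (\<i> * of_real pi * u) - exp (- (\<i> * of_real pi * u))) *
     prodinf (\<lambda>m. (1 - exp (2 * of_real pi * \<i> * \<tau>) ^ Suc m * exp (2 * of_real pi * \<i> * u)) *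
                  (1 - exp (2 * of_real pi * \<i> * \<tau>) ^ Suc m * exp (- (2 * of_real pi * \<i> * u))))"

definition lat :: "complex \<Rightarrow> complex set" where
  "lat \<tau> = {of_int a + of_int b * \<tau> | a b. True}"

text \<open>
  The multiplier of \<open>\<vartheta>\<close>: for \<open>v = a + b\<tau>\<close> with integers \<open>a, b\<close>, iterating
  \<open>\<vartheta>(u + 1) = - \<vartheta>(u)\<close> and \<open>\<vartheta>(u + \<tau>) = - q\<^sup>-\<^sup>1\<^sup>/\<^sup>2 x\<^sup>-\<^sup>1 \<vartheta>(u)\<close> gives
  \<open>\<vartheta>(u + v) = (-1)\<^sup>a\<^sup>+\<^sup>b exp (- \<pi> i b\<^sup>2 \<tau> - 2 \<pi> i b u) \<vartheta>(u)\<close>.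
\<close>

definition theta_mult :: "complex \<Rightarrow> complex \<Rightarrow> complex \<Rightarrow> complex" where
  "theta_mult \<tau> v u =
     (let b = Im v / Im \<tau>; a = Re v - b * Re \<tau>
      in exp (\<i> * of_real pi *
              (of_real a + of_real b - of_real (b ^ 2) * \<tau> - 2 * of_real b * u)))"

text \<open>
  For a finite set \<open>I\<close> of coordinates, \<open>cspace I\<close> is \<open>\<complex>\<^sup>I\<close> (vectors vanishing outside \<open>I\<close>), the
  universal cover of the torus \<open>E\<^sup>I\<close>. Subsets of \<open>E\<^sup>I\<close> are given by their (lattice-invariant)
  preimages in \<open>\<complex>\<^sup>I\<close>.
\<close>

definition cspace :: "'c set \<Rightarrow> ('c \<Rightarrow> complex) set" where
  "cspace I = {P. \<forall>c. c \<notin> I \<longrightarrow> P c = 0}"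

definition lat_vec :: "complex \<Rightarrow> 'c set \<Rightarrow> ('c \<Rightarrow> complex) set" where
  "lat_vec \<tau> I = {L \<in> cspace I. \<forall>c\<in>I. L c \<in> lat \<tau>}"

definition vadd :: "('c \<Rightarrow> complex) \<Rightarrow> ('c \<Rightarrow> complex) \<Rightarrow> 'c \<Rightarrow> complex" where
  "vadd P L = (\<lambda>c. P c + L c)"

definition restrict_coords :: "'c set \<Rightarrow> ('c \<Rightarrow> complex) \<Rightarrow> 'c \<Rightarrow> complex" where
  "restrict_coords J P = (\<lambda>c. if c \<in> J then P c else 0)"

text \<open>Holomorphic functions of several variables: continuous and holomorphic in each variable.\<close>

definition holo_open :: "'c set \<Rightarrow> ('c \<Rightarrow> complex) set \<Rightarrow> (('c \<Rightarrow> complex) \<Rightarrow> complex) \<Rightarrow> bool" where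
  "holo_open I W f \<longleftrightarrow>
     openin (top_of_set (cspace I)) W \<and> continuous_on W f \<and>
     (\<forall>P\<in>W. \<forall>c\<in>I. (\<lambda>u. f (P(c := u))) field_differentiable (at (P c)))"

text \<open>Holomorphic functions on a (reduced) analytic subset: local restrictions of ambient ones.\<close>

definition holo_sub :: "'c set \<Rightarrow> ('c \<Rightarrow> complex) set \<Rightarrow> (('c \<Rightarrow> complex) \<Rightarrow> complex) \<Rightarrow> bool" where
  "holo_sub I Y f \<longleftrightarrow>
     (\<forall>P\<in>Y. \<exists>W F. P \<in> W \<and> holo_open I W F \<and> (\<forall>Q\<in>W \<inter> Y. f Q = F Q))"

text \<open>
  A line bundle on (the image in \<open>E\<^sup>I\<close> of) \<open>Y\<close> is given by its quasi-periods, i.e. by a holomorphic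
  factor of automorphy \<open>e\<close>: its sections are the \<open>f\<close> on \<open>Y\<close> with \<open>f (P + L) = e L P * f P\<close> for all
  lattice vectors \<open>L\<close>. Pullback along a map of tori is substitution in \<open>e\<close> and \<open>f\<close>, and equality
  of bundles is meant literally, as equality of quasi-periods; it implies isomorphism and is what
  is needed to compare sections.
\<close>

definition line_bundle ::
  "complex \<Rightarrow> 'c set \<Rightarrow> ('c \<Rightarrow> complex) set \<Rightarrow> (('c \<Rightarrow> complex) \<Rightarrow> ('c \<Rightarrow> complex) \<Rightarrow> complex) \<Rightarrow> bool"
where
  "line_bundle \<tau> I Y e \<longleftrightarrow>
     (\<forall>L\<in>lat_vec \<tau> I. holo_sub I Y (e L) \<and> (\<forall>P\<in>Y. e L P \<noteq> 0)) \<and>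
     (\<forall>L\<in>lat_vec \<tau> I. \<forall>M\<in>lat_vec \<tau> I. \<forall>P\<in>Y. e (vadd L M) P = e L (vadd P M) * e M P)"

definition holo_section ::
  "complex \<Rightarrow> 'c set \<Rightarrow> ('c \<Rightarrow> complex) set \<Rightarrow> (('c \<Rightarrow> complex) \<Rightarrow> ('c \<Rightarrow> complex) \<Rightarrow> complex) \<Rightarrow>
   (('c \<Rightarrow> complex) \<Rightarrow> complex) \<Rightarrow> bool"
where
  "holo_section \<tau> I Y e f \<longleftrightarrow>
     holo_sub I Y f \<and> (\<forall>L\<in>lat_vec \<tau> I. \<forall>P\<in>Y. f (vadd P L) = e L P * f P)"

text \<open>
  \<open>denominator J g\<close>: \<open>g\<close> is a nonzero entire function of the variables in \<open>J\<close> only. A property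
  holds generically in \<open>J\<close> if it holds wherever some such \<open>g\<close> does not vanish.
\<close>

definition denominator :: "'c set \<Rightarrow> (('c \<Rightarrow> complex) \<Rightarrow> complex) \<Rightarrow> bool" where
  "denominator J g \<longleftrightarrow> holo_open J (cspace J) g \<and> (\<exists>P\<in>cspace J. g P \<noteq> 0)"

definition generically :: "'c set \<Rightarrow> (('c \<Rightarrow> complex) \<Rightarrow> bool) \<Rightarrow> bool" where
  "generically J Q \<longleftrightarrow> (\<exists>g. denominator J g \<and> (\<forall>P. g (restrict_coords J P) \<noteq> 0 \<longrightarrow> Q P))"

text \<open>
  Sections meromorphic in the variables \<open>J\<close> and holomorphic in the others. The values of the
  representing function \<open>f\<close> on the polar locus \<open>g = 0\<close> carry no information, so two such sections
  are equal iff they agree generically.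
\<close>

definition mero_section ::
  "complex \<Rightarrow> 'c set \<Rightarrow> ('c \<Rightarrow> complex) set \<Rightarrow> 'c set \<Rightarrow>
   (('c \<Rightarrow> complex) \<Rightarrow> ('c \<Rightarrow> complex) \<Rightarrow> complex) \<Rightarrow> (('c \<Rightarrow> complex) \<Rightarrow> complex) \<Rightarrow> bool"
where
  "mero_section \<tau> I Y J e f \<longleftrightarrow>
     (\<exists>g F. denominator J g \<and> holo_sub I Y F \<and>
        (\<forall>P\<in>Y. g (restrict_coords J P) \<noteq> 0 \<longrightarrow> F P = g (restrict_coords J P) * f P) \<and>
        (\<forall>L\<in>lat_vec \<tau> I. \<forall>P\<in>Y.
           g (restrict_coords J P) \<noteq> 0 \<longrightarrow> g (restrict_coords J (vadd P L)) \<noteq> 0 \<longrightarrow>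
           f (vadd P L) = e L P * f P))"


section \<open>Hypertoric data and the mirror\<close>

text \<open>
  \<open>iota i j\<close> (\<open>i < n\<close>, \<open>j < k\<close>) and \<open>beta r i\<close> (\<open>r < d\<close>, \<open>i < n\<close>) are matrix entries; indices run
  from 0. \<open>lift_theta\<close> and \<open>lift_sigma\<close> are the lifts to \<open>(\<int>\<^sup>n)\<^sup>\<or>\<close> and \<open>\<int>\<^sup>n\<close>.
\<close>

record hypertoric =
  dimK :: nat
  dimT :: nat
  dimA :: nat
  iota :: "nat \<Rightarrow> nat \<Rightarrow> int"
  beta :: "nat \<Rightarrow> nat \<Rightarrow> int"
  lift_theta :: "nat \<Rightarrow> int"
  lift_sigma :: "nat \<Rightarrow> int"

definition exact_seq :: "nat \<Rightarrow> nat \<Rightarrow> nat \<Rightarrow> (nat \<Rightarrow> nat \<Rightarrow> int) \<Rightarrow> (nat \<Rightarrow> nat \<Rightarrow> int) \<Rightarrow> bool" where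
  "exact_seq k n d \<iota> \<beta> \<longleftrightarrow>
     (\<forall>v. (\<forall>i<n. (\<Sum>j<k. \<iota> i j * v j) = 0) \<longrightarrow> (\<forall>j<k. v j = 0)) \<and>
     (\<forall>u. (\<forall>r<d. (\<Sum>i<n. \<beta> r i * u i) = 0) \<longleftrightarrow> (\<exists>v. \<forall>i<n. u i = (\<Sum>j<k. \<iota> i j * v j))) \<and>
     (\<forall>w. \<exists>u. \<forall>r<d. w r = (\<Sum>i<n. \<beta> r i * u i))"

definition mirror :: "hypertoric \<Rightarrow> hypertoric" where
  "mirror D = \<lparr>dimK = dimA D, dimT = dimT D, dimA = dimK D,
     iota = (\<lambda>i r. beta D r i), beta = (\<lambda>j i. iota D i j),
     lift_theta = (\<lambda>i. - lift_sigma D i), lift_sigma = (\<lambda>i. - lift_theta D i)\<rparr>"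


section \<open>The hypertoric variety\<close>

type_synonym phase = "(nat \<Rightarrow> complex) \<times> (nat \<Rightarrow> complex)"

definition torus :: "nat \<Rightarrow> (nat \<Rightarrow> complex) set" where
  "torus m = {s. (\<forall>j<m. s j \<noteq> 0) \<and> (\<forall>j\<ge>m. s j = 1)}"

definition char_K :: "hypertoric \<Rightarrow> nat \<Rightarrow> (nat \<Rightarrow> complex) \<Rightarrow> complex" where
  "char_K D i s = (\<Prod>j<dimK D. s j powi iota D i j)"

definition gauge_act :: "hypertoric \<Rightarrow> (nat \<Rightarrow> complex) \<Rightarrow> phase \<Rightarrow> phase" where
  "gauge_act D s v =
     ((\<lambda>i. char_K D i s * fst v i), (\<lambda>i. inverse (char_K D i s) * snd v i))"

definition torus_act :: "(nat \<Rightarrow> complex) \<Rightarrow> complex \<Rightarrow> phase \<Rightarrow> phase" where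
  "torus_act a h v = ((\<lambda>i. a i * fst v i), (\<lambda>i. inverse h * inverse (a i) * snd v i))"

definition sigma_act :: "hypertoric \<Rightarrow> complex \<Rightarrow> phase \<Rightarrow> phase" where
  "sigma_act D t v = torus_act (\<lambda>i. t powi lift_sigma D i) 1 v"

definition moment_zero :: "hypertoric \<Rightarrow> phase set" where
  "moment_zero D =
     {v. (\<forall>i\<ge>dimT D. fst v i = 0 \<and> snd v i = 0) \<and>
         (\<forall>j<dimK D. (\<Sum>i<dimT D. of_int (iota D i j) * (fst v i * snd v i)) = 0)}"

inductive poly_fun :: "nat \<Rightarrow> (phase \<Rightarrow> complex) \<Rightarrow> bool" for n where
  "poly_fun n (\<lambda>v. c)"
| "i < n \<Longrightarrow> poly_fun n (\<lambda>v. fst v i)"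
| "i < n \<Longrightarrow> poly_fun n (\<lambda>v. snd v i)"
| "poly_fun n f \<Longrightarrow> poly_fun n g \<Longrightarrow> poly_fun n (\<lambda>v. f v + g v)"
| "poly_fun n f \<Longrightarrow> poly_fun n g \<Longrightarrow> poly_fun n (\<lambda>v. f v * g v)"

definition theta_char :: "hypertoric \<Rightarrow> (nat \<Rightarrow> complex) \<Rightarrow> complex" where
  "theta_char D s =
     (\<Prod>j<dimK D. s j powi (\<Sum>i<dimT D. iota D i j * lift_theta D i))"

text \<open>
  Semistability for the linearization by \<open>\<theta>\<close>. The sign convention is the one under which the torus
  fixed point of a vertex in the interior of \<open>H\<^sub>i\<^sup>+\<close> has \<open>z\<^sub>i \<noteq> 0\<close>.
\<close>

definition semistable :: "hypertoric \<Rightarrow> phase set" where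
  "semistable D =
     {v \<in> moment_zero D. \<exists>m\<ge>1. \<exists>f. poly_fun (dimT D) f \<and>
        (\<forall>s\<in>torus (dimK D). \<forall>u\<in>moment_zero D. f (gauge_act D s u) = theta_char D s ^ m * f u) \<and>
        f v \<noteq> 0}"

definition orbit :: "hypertoric \<Rightarrow> phase \<Rightarrow> phase set" where
  "orbit D v = (\<lambda>s. gauge_act D s v) ` torus (dimK D)"

definition stabilizer :: "hypertoric \<Rightarrow> phase \<Rightarrow> (nat \<Rightarrow> complex) set" where
  "stabilizer D v = {s \<in> torus (dimK D). gauge_act D s v = v}"

definition stable :: "hypertoric \<Rightarrow> phase set" where
  "stable D = {v \<in> semistable D. finite (stabilizer D v) \<and>
                 closedin (top_of_set (semistable D)) (orbit D v)}"

definition generic_theta :: "hypertoric \<Rightarrow> bool" where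
  "generic_theta D \<longleftrightarrow> semistable D = stable D"

text \<open>
  For generic \<open>\<theta>\<close> the quotient is smooth iff the quotient map is a principal \<open>K\<close>-bundle, i.e. iff
  the action on the stable locus is free: it has at worst symplectic quotient singularities, and
  these are smooth only for trivial stabilizers.
\<close>

definition smooth_hypertoric :: "hypertoric \<Rightarrow> bool" where
  "smooth_hypertoric D \<longleftrightarrow> (\<forall>v\<in>stable D. stabilizer D v = {\<lambda>_. 1})"

text \<open>
  The points of \<open>X\<close> are the \<open>K\<close>-orbits in the semistable (= stable, for generic \<open>\<theta>\<close>) locus;
  \<open>X\<close> carries the quotient of the classical topology.
\<close>

definition points :: "hypertoric \<Rightarrow> phase set set" where
  "points D = orbit D ` semistable D"

definition hyper_top :: "hypertoric \<Rightarrow> phase set topology" where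
  "hyper_top D = topology (\<lambda>U. U \<subseteq> points D \<and>
     openin (top_of_set (semistable D)) {v \<in> semistable D. orbit D v \<in> U})"

lemma openin_hyper_top:
  "openin (hyper_top D) U \<longleftrightarrow> U \<subseteq> points D \<and>
     openin (top_of_set (semistable D)) {v \<in> semistable D. orbit D v \<in> U}"
proof -
  let ?pre = "\<lambda>U. {v \<in> semistable D. orbit D v \<in> U}"
  have "istopology (\<lambda>U. U \<subseteq> points D \<and> openin (top_of_set (semistable D)) (?pre U))"
    unfolding istopology_def
  proof (intro conjI allI impI)
    fix S T
    assume "S \<subseteq> points D \<and> openin (top_of_set (semistable D)) (?pre S)"
      and "T \<subseteq> points D \<and> openin (top_of_set (semistable D)) (?pre T)"
    moreover have "?pre (S \<inter> T) = ?pre S \<inter> ?pre T" by auto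
    ultimately show "S \<inter> T \<subseteq> points D" "openin (top_of_set (semistable D)) (?pre (S \<inter> T))"
      by (auto intro: openin_Int)
  next
    fix \<K>
    assume *: "\<forall>K\<in>\<K>. K \<subseteq> points D \<and> openin (top_of_set (semistable D)) (?pre K)"
    have "?pre (\<Union>\<K>) = \<Union>(?pre ` \<K>)" by auto
    moreover have "openin (top_of_set (semistable D)) (\<Union>(?pre ` \<K>))"
      using * by (intro openin_Union) blast
    ultimately show "openin (top_of_set (semistable D)) (?pre (\<Union>\<K>))" by simp
    show "\<Union>\<K> \<subseteq> points D" using * by blast
  qed
  then show ?thesis
    unfolding hyper_top_def by (simp add: topology_inverse')
qed

definition fixed_points :: "hypertoric \<Rightarrow> phase set set" where
  "fixed_points D = {x \<in> points D. \<forall>a\<in>torus (dimT D). \<forall>h. h \<noteq> 0 \<longrightarrow> torus_act a h ` x = x}"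

definition generic_sigma :: "hypertoric \<Rightarrow> bool" where
  "generic_sigma D \<longleftrightarrow>
     {x \<in> points D. \<forall>t. t \<noteq> 0 \<longrightarrow> sigma_act D t ` x = x} = fixed_points D"

definition Attr :: "hypertoric \<Rightarrow> phase set \<Rightarrow> phase set set" where
  "Attr D x = {y \<in> points D. limitin (hyper_top D) (\<lambda>t. sigma_act D t ` y) x (at 0)}"

definition full_Attr :: "hypertoric \<Rightarrow> phase set \<Rightarrow> phase set set" where
  "full_Attr D x =
     \<Inter>{Y. closedin (hyper_top D) Y \<and> x \<in> Y \<and> (\<forall>y\<in>fixed_points D. y \<in> Y \<longrightarrow> Attr D y \<subseteq> Y)}"


section \<open>Combinatorics of the fixed points\<close>

definition dual_space :: "hypertoric \<Rightarrow> (nat \<Rightarrow> real) set" where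
  "dual_space D = {x. \<forall>r\<ge>dimA D. x r = 0}"

definition pair_beta :: "hypertoric \<Rightarrow> (nat \<Rightarrow> real) \<Rightarrow> nat \<Rightarrow> real" where
  "pair_beta D x i = (\<Sum>r<dimA D. x r * of_int (beta D r i))"

definition hplane :: "hypertoric \<Rightarrow> nat \<Rightarrow> (nat \<Rightarrow> real) set" where
  "hplane D i = {x \<in> dual_space D. pair_beta D x i = - of_int (lift_theta D i)}"

definition hplus :: "hypertoric \<Rightarrow> nat \<Rightarrow> (nat \<Rightarrow> real) set" where
  "hplus D i = {x \<in> dual_space D. pair_beta D x i \<ge> - of_int (lift_theta D i)}"

definition hminus :: "hypertoric \<Rightarrow> nat \<Rightarrow> (nat \<Rightarrow> real) set" where
  "hminus D i = {x \<in> dual_space D. pair_beta D x i \<le> - of_int (lift_theta D i)}"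

definition flat :: "hypertoric \<Rightarrow> nat set \<Rightarrow> (nat \<Rightarrow> real) set" where
  "flat D p = {x \<in> dual_space D. \<forall>i\<in>p. x \<in> hplane D i}"

definition fixed_sets :: "hypertoric \<Rightarrow> nat set set" where
  "fixed_sets D = {p. p \<subseteq> {..<dimT D} \<and> card p = dimA D \<and> flat D p \<noteq> {}}"

definition compl_set :: "hypertoric \<Rightarrow> nat set \<Rightarrow> nat set" where
  "compl_set D p = {..<dimT D} - p"

text \<open>For a vertex, \<open>flat D p\<close> is a single point.\<close>

definition A_plus :: "hypertoric \<Rightarrow> nat set \<Rightarrow> nat set" where
  "A_plus D p = {i \<in> compl_set D p. flat D p \<subseteq> hplus D i}"

definition A_minus :: "hypertoric \<Rightarrow> nat set \<Rightarrow> nat set" where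
  "A_minus D p = {i \<in> compl_set D p. flat D p \<subseteq> hminus D i}"

definition coef :: "hypertoric \<Rightarrow> nat set \<Rightarrow> nat \<Rightarrow> nat \<Rightarrow> int" where
  "coef D p i j =
     (THE c. (\<forall>l. l \<notin> p \<longrightarrow> c l = 0) \<and>
             (\<forall>r<dimA D. beta D r j = - (\<Sum>l\<in>p. c l * beta D r l))) i"

definition p_plus :: "hypertoric \<Rightarrow> nat set \<Rightarrow> nat set" where
  "p_plus D p =
     {i \<in> p. lift_sigma D i - (\<Sum>j\<in>compl_set D p. coef D p i j * lift_sigma D j) > 0}"

definition p_minus :: "hypertoric \<Rightarrow> nat set \<Rightarrow> nat set" where
  "p_minus D p =
     {i \<in> p. lift_sigma D i - (\<Sum>j\<in>compl_set D p. coef D p i j * lift_sigma D j) < 0}"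

text \<open>The fixed point of \<open>X\<close> labelled by the vertex \<open>p\<close>, as a \<open>K\<close>-orbit.\<close>

definition vertex_point :: "hypertoric \<Rightarrow> nat set \<Rightarrow> phase set" where
  "vertex_point D p =
     {v \<in> semistable D. \<forall>i<dimT D. (fst v i \<noteq> 0 \<longleftrightarrow> i \<in> A_plus D p) \<and>
                                   (snd v i \<noteq> 0 \<longleftrightarrow> i \<in> A_minus D p)}"


section \<open>Elliptic cohomology of a hypertoric variety\<close>

text \<open>
  Logarithmic coordinates on \<open>S(X) \<times> E\<^sub>T \<times> E\<^sub>T\<^sub>\<or>\<close>: Chern roots \<open>s\<^sub>j\<close>, equivariant parameters
  \<open>a\<^sub>i\<close> and \<open>\<hbar>\<close>, Kaehler parameters \<open>z\<^sub>i\<close>.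
\<close>

datatype coord = Gauge nat | Equiv nat | Hbar | Kahler nat

definition coords :: "hypertoric \<Rightarrow> coord set" where
  "coords D = Gauge ` {..<dimK D} \<union> Equiv ` {..<dimT D} \<union> {Hbar} \<union> Kahler ` {..<dimT D}"

definition kahler_coords :: "hypertoric \<Rightarrow> coord set" where
  "kahler_coords D = {Hbar} \<union> Kahler ` {..<dimT D}"

definition param_coords :: "hypertoric \<Rightarrow> coord set" where
  "param_coords D = Equiv ` {..<dimT D} \<union> {Hbar} \<union> Kahler ` {..<dimT D}"

definition xroot :: "hypertoric \<Rightarrow> nat \<Rightarrow> (coord \<Rightarrow> complex) \<Rightarrow> complex" where
  "xroot D i P = P (Equiv i) + (\<Sum>j<dimK D. of_int (iota D i j) * P (Gauge j))"

definition xres :: "hypertoric \<Rightarrow> nat set \<Rightarrow> nat \<Rightarrow> (coord \<Rightarrow> complex) \<Rightarrow> complex" where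
  "xres D p i P =
     (if i \<in> p then P (Equiv i) - (\<Sum>j\<in>compl_set D p. of_int (coef D p i j) * P (Equiv j))
                    - of_int (\<Sum>j\<in>A_minus D p. coef D p i j) * P Hbar
      else if i \<in> A_plus D p then 0
      else - P Hbar)"

definition zeta :: "hypertoric \<Rightarrow> nat set \<Rightarrow> nat \<Rightarrow> (coord \<Rightarrow> complex) \<Rightarrow> complex" where
  "zeta D p j P = P (Kahler j) + (\<Sum>i\<in>p. of_int (coef D p i j) * P (Kahler i))"

definition zeta_shift :: "hypertoric \<Rightarrow> nat set \<Rightarrow> nat \<Rightarrow> (coord \<Rightarrow> complex) \<Rightarrow> complex" where
  "zeta_shift D p j P = zeta D p j P - of_int (\<Sum>i\<in>p_plus D p. coef D p i j) * P Hbar"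

text \<open>
  Preimage of \<open>O\<^sub>p \<times> E\<^sub>T\<^sub>\<or>\<close>; \<open>Ell\<close> is the extended scheme, i.e. the elliptic cohomology scheme
  times \<open>E\<^sub>T\<^sub>\<or>\<close>.
\<close>

definition Ell_comp :: "complex \<Rightarrow> hypertoric \<Rightarrow> nat set \<Rightarrow> (coord \<Rightarrow> complex) set" where
  "Ell_comp \<tau> D p =
     {P \<in> cspace (coords D). \<forall>i<dimT D. xroot D i P - xres D p i P \<in> lat \<tau>}"

definition Ell :: "complex \<Rightarrow> hypertoric \<Rightarrow> (coord \<Rightarrow> complex) set" where
  "Ell \<tau> D = (\<Union>p\<in>fixed_sets D. Ell_comp \<tau> D p)"

text \<open>
  The elliptic cohomology of the torus orbit through \<open>[v]\<close>, embedded in the same space. The orbit has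
  the equivariant elliptic cohomology of a point for its stabilizer, and that stabilizer is
  identified, by projection from the gauge times flavour torus, with the stabilizer of \<open>v\<close> itself,
  cut out by \<open>x\<^sub>i = 1\<close> where \<open>z\<^sub>i \<noteq> 0\<close> and \<open>\<hbar> x\<^sub>i = 1\<close> where \<open>w\<^sub>i \<noteq> 0\<close>. For an invariant open set
  \<open>U\<close>, the image of its elliptic cohomology scheme in \<open>Ell\<close> is the union of these over its orbits.
\<close>

definition Ell_orbit :: "complex \<Rightarrow> hypertoric \<Rightarrow> phase \<Rightarrow> (coord \<Rightarrow> complex) set" where
  "Ell_orbit \<tau> D v =
     {P \<in> cspace (coords D). \<forall>i<dimT D.
        (fst v i \<noteq> 0 \<longrightarrow> xroot D i P \<in> lat \<tau>) \<and>
        (snd v i \<noteq> 0 \<longrightarrow> P Hbar + xroot D i P \<in> lat \<tau>)}"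

text \<open>
  The lift to universal covers of the isomorphism of \<open>E\<^sub>T \<times> E\<^sub>T\<^sub>\<or>\<close> with \<open>O\<^sub>p \<times> E\<^sub>T\<^sub>\<or>\<close>: keep the
  parameters and solve \<open>x\<^sub>i = x\<^sub>i|\<^sub>p\<close> for the Chern roots. Restriction to \<open>p\<close> is composition with it.
\<close>

definition lift_point :: "hypertoric \<Rightarrow> nat set \<Rightarrow> (coord \<Rightarrow> complex) \<Rightarrow> coord \<Rightarrow> complex" where
  "lift_point D p P = (THE Q. Q \<in> cspace (coords D) \<and> Q Hbar = P Hbar \<and>
     (\<forall>i<dimT D. Q (Equiv i) = P (Equiv i) \<and> Q (Kahler i) = P (Kahler i) \<and>
                 xroot D i Q = xres D p i P))"


section \<open>Elliptic stable envelopes\<close>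

text \<open>
  The product defining \<open>T(p)\<close>, with an arbitrary function \<open>G\<close> of linear forms in place of \<open>\<vartheta>\<close>;
  inserting the multipliers of \<open>\<vartheta>\<close> gives the quasi-periods of the product of theta functions.
\<close>

definition T_prod ::
  "hypertoric \<Rightarrow> nat set \<Rightarrow> (((coord \<Rightarrow> complex) \<Rightarrow> complex) \<Rightarrow> complex) \<Rightarrow> complex"
where
  "T_prod D p G =
     (\<Prod>i\<in>p_plus D p. G (\<lambda>P. P Hbar + xroot D i P)) *
     (\<Prod>i\<in>p_minus D p. G (\<lambda>P. xroot D i P)) *
     (\<Prod>j\<in>A_plus D p. G (\<lambda>P. xroot D j P + zeta_shift D p j P) /
                        G (\<lambda>P. zeta_shift D p j P)) *
     (\<Prod>j\<in>A_minus D p. G (\<lambda>P. xroot D j P + zeta_shift D p j P) /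
                         G (\<lambda>P. - P Hbar + zeta_shift D p j P))"

definition T_bundle ::
  "complex \<Rightarrow> hypertoric \<Rightarrow> nat set \<Rightarrow> (coord \<Rightarrow> complex) \<Rightarrow> (coord \<Rightarrow> complex) \<Rightarrow> complex"
where
  "T_bundle \<tau> D p L P = T_prod D p (\<lambda>l. theta_mult \<tau> (l L) (l P))"

definition stable_envelope ::
  "complex \<Rightarrow> hypertoric \<Rightarrow> nat set \<Rightarrow> ((coord \<Rightarrow> complex) \<Rightarrow> complex) \<Rightarrow> bool"
where
  "stable_envelope \<tau> D p f \<longleftrightarrow>
     mero_section \<tau> (coords D) (Ell \<tau> D) (kahler_coords D) (T_bundle \<tau> D p) f \<and>
     generically (kahler_coords D) (\<lambda>P. \<forall>v\<in>semistable D.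
       orbit D v \<notin> full_Attr D (vertex_point D p) \<longrightarrow> P \<in> Ell_orbit \<tau> D v \<longrightarrow> f P = 0) \<and>
     generically (kahler_coords D) (\<lambda>P. f (lift_point D p P) =
       (\<Prod>i\<in>p_plus D p. theta \<tau> (P Hbar + xres D p i P)) *
       (\<Prod>i\<in>p_minus D p. theta \<tau> (xres D p i P)))"


section \<open>Comparison with the mirror\<close>

text \<open>
  The identification of parameters: \<open>z\<^sub>i = a\<^sub>i'\<close>, \<open>a\<^sub>i = z\<^sub>i'\<close>, \<open>\<hbar>' = \<hbar>\<^sup>-\<^sup>1\<close>. It is an involution, so
  it serves in both directions; Chern roots are forgotten.
\<close>

fun kappa :: "(coord \<Rightarrow> complex) \<Rightarrow> coord \<Rightarrow> complex" where
  "kappa P (Gauge j) = 0"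
| "kappa P (Equiv i) = P (Kahler i)"
| "kappa P (Kahler i) = P (Equiv i)"
| "kappa P Hbar = - P Hbar"

text \<open>
  The restriction to \<open>p'\<close> of something living on the mirror, as a function of the parameters of \<open>X\<close>,
  is composition with \<open>mirror_lift D p\<close>.
\<close>

definition mirror_lift :: "hypertoric \<Rightarrow> nat set \<Rightarrow> (coord \<Rightarrow> complex) \<Rightarrow> coord \<Rightarrow> complex" where
  "mirror_lift D p P = lift_point (mirror D) (compl_set D p) (kappa P)"

definition bold_stab ::
  "hypertoric \<Rightarrow> nat set \<Rightarrow> ((coord \<Rightarrow> complex) \<Rightarrow> complex) \<Rightarrow> ((coord \<Rightarrow> complex) \<Rightarrow> complex) \<Rightarrow>
   (coord \<Rightarrow> complex) \<Rightarrow> complex"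
where
  "bold_stab D p S S' P = S P * S' (mirror_lift D p P)"

definition M_bundle ::
  "complex \<Rightarrow> hypertoric \<Rightarrow> nat set \<Rightarrow> (coord \<Rightarrow> complex) \<Rightarrow> (coord \<Rightarrow> complex) \<Rightarrow> complex"
where
  "M_bundle \<tau> D p L P =
     T_bundle \<tau> D p L P *
     T_bundle \<tau> (mirror D) (compl_set D p) (mirror_lift D p L) (mirror_lift D p P)"

text \<open>Coordinates on \<open>S(X) \<times> S(X') \<times> E\<close>, for the torus \<open>T \<times> T' \<times> \<complex>\<^sup>\<times>\<close>; \<open>PHbar\<close> is the \<open>\<hbar>\<close> of \<open>X\<close>.\<close>

datatype pcoord = PGauge nat | PGauge' nat | PEquiv nat | PEquiv' nat | PHbar

definition pcoords :: "hypertoric \<Rightarrow> pcoord set" where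
  "pcoords D = PGauge ` {..<dimK D} \<union> PGauge' ` {..<dimA D} \<union>
     PEquiv ` {..<dimT D} \<union> PEquiv' ` {..<dimT D} \<union> {PHbar}"

fun proj_X :: "(pcoord \<Rightarrow> complex) \<Rightarrow> coord \<Rightarrow> complex" where
  "proj_X P (Gauge j) = P (PGauge j)"
| "proj_X P (Equiv i) = P (PEquiv i)"
| "proj_X P (Kahler i) = P (PEquiv' i)"
| "proj_X P Hbar = P PHbar"

fun proj_X' :: "(pcoord \<Rightarrow> complex) \<Rightarrow> coord \<Rightarrow> complex" where
  "proj_X' P (Gauge j) = P (PGauge' j)"
| "proj_X' P (Equiv i) = P (PEquiv' i)"
| "proj_X' P (Kahler i) = P (PEquiv i)"
| "proj_X' P Hbar = - P PHbar"

text \<open>The fixed points of \<open>X \<times> X'\<close> are all pairs; each contributes one component.\<close>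

definition Ell_prod :: "complex \<Rightarrow> hypertoric \<Rightarrow> (pcoord \<Rightarrow> complex) set" where
  "Ell_prod \<tau> D =
     (\<Union>p\<in>fixed_sets D. \<Union>r\<in>fixed_sets (mirror D).
        {P \<in> cspace (pcoords D).
           (\<forall>i<dimT D. xroot D i (proj_X P) - xres D p i (proj_X P) \<in> lat \<tau>) \<and>
           (\<forall>i<dimT D. xroot (mirror D) i (proj_X' P) - xres (mirror D) r i (proj_X' P) \<in> lat \<tau>)})"

text \<open>The maps induced by \<open>X \<times> {p'}\<close> and by \<open>{p} \<times> X'\<close>.\<close>

fun embed_X :: "hypertoric \<Rightarrow> nat set \<Rightarrow> (coord \<Rightarrow> complex) \<Rightarrow> pcoord \<Rightarrow> complex" where
  "embed_X D p P (PGauge j) = P (Gauge j)"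
| "embed_X D p P (PGauge' r) = mirror_lift D p P (Gauge r)"
| "embed_X D p P (PEquiv i) = P (Equiv i)"
| "embed_X D p P (PEquiv' i) = P (Kahler i)"
| "embed_X D p P PHbar = P Hbar"

fun embed_X' :: "hypertoric \<Rightarrow> nat set \<Rightarrow> (coord \<Rightarrow> complex) \<Rightarrow> pcoord \<Rightarrow> complex" where
  "embed_X' D p P (PGauge j) = lift_point D p (kappa P) (Gauge j)"
| "embed_X' D p P (PGauge' r) = P (Gauge r)"
| "embed_X' D p P (PEquiv i) = P (Kahler i)"
| "embed_X' D p P (PEquiv' i) = P (Equiv i)"
| "embed_X' D p P PHbar = - P Hbar"

text \<open>
  The prequotient, with one elliptic coordinate for each factor of
  \<open>T \<times> T' \<times> \<complex>\<^sup>\<times> \<times> T\<^sup>\<or> \<times> (T')\<^sup>\<or>\<close>. Since \<open>K \<subseteq> T = (T')\<^sup>\<or>\<close> via \<open>\<iota>\<close> and \<open>K' \<subseteq> T' = T\<^sup>\<or>\<close> via the transpose of \<open>\<beta>\<close>,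
  the last two factors receive the Chern roots of \<open>X'\<close> and of \<open>X\<close>.
\<close>

datatype qcoord = QT nat | QT' nat | QHbar | QTdual nat | QT'dual nat

definition qcoords :: "nat \<Rightarrow> qcoord set" where
  "qcoords n = QT ` {..<n} \<union> QT' ` {..<n} \<union> {QHbar} \<union> QTdual ` {..<n} \<union> QT'dual ` {..<n}"

fun to_preq :: "hypertoric \<Rightarrow> (pcoord \<Rightarrow> complex) \<Rightarrow> qcoord \<Rightarrow> complex" where
  "to_preq D P (QT i) = P (PEquiv i)"
| "to_preq D P (QT' i) = P (PEquiv' i)"
| "to_preq D P QHbar = P PHbar"
| "to_preq D P (QTdual i) =
     (if i < dimT D then \<Sum>r<dimA D. of_int (beta D r i) * P (PGauge' r) else 0)"
| "to_preq D P (QT'dual i) =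
     (if i < dimT D then \<Sum>j<dimK D. of_int (iota D i j) * P (PGauge j) else 0)"

end

theory Submission
  imports Defs "HOL-Complex_Analysis.Complex_Analysis"
begin

text \<open>
  Both bundles are given by the multipliers of \<open>\<Prod>\<^sub>i \<vartheta>(x\<^sub>i x\<^sub>i')\<close>, and the restriction of this product to \<open>p'\<close> is
  \<open>\<Prod>\<^sub>i \<vartheta>(x\<^sub>i x\<^sub>i'|\<^sub>p\<^sub>')\<close>. Under mirror symmetry the roots \<open>x\<^sub>i'|\<^sub>p\<^sub>'\<close> are \<open>\<hbar>\<close>, \<open>1\<close> or the shifted Kaehler parameter of \<open>i\<close>,
  according as \<open>i \<in> p\<^sup>+\<close>, \<open>i \<in> p\<^sup>-\<close> or \<open>i \<notin> p\<close>, so the product is the one defining \<open>T(p)\<close> times its denominator, and that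
  denominator is the diagonal restriction of the mirror envelope. It remains to see that a stable envelope
  is generically equal to the product defining \<open>T(p)\<close>.

  This is proved on the components \<open>O\<^sub>r\<close> by induction on the value of \<open>\<sigma>\<close> at \<open>r\<close>. For \<open>r \<noteq> p\<close> pick \<open>i \<in> r - p\<close>. In the
  variable \<open>a\<^sub>i\<close> alone, the difference of the two sections is a theta function of degree one. It vanishes on the
  edge at \<open>r\<close> in direction \<open>i\<close> along which \<open>\<sigma>\<close> decreases: if the edge ends in a vertex, by induction; if it is
  unbounded, because an invariant monomial of negative \<open>\<sigma>\<close>-weight separates it from the full attracting set.
  For generic Kaehler parameters a nonzero theta function of degree one cannot vanish there.
\<close>

section \<open>Theta functions\<close>

text \<open>The variable \<open>a_i\<close> with \<open>i \<in> r - p\<close> is chosen for two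
  reasons. On \<open>O_r\<close> it is free, because \<open>i \<in> r\<close> leaves the conditions
  at \<open>j \<notin> r\<close> untouched. And since \<open>i \<notin> p\<close>, it enters the
  quasi-periods of \<open>T(p)\<close> through a single theta factor, whence degree one. The zero of
  that factor and the edge differ by the shifted Kaehler parameter of \<open>i\<close>, up to one
  \<open>Hbar\<close>; genericity keeps these differences off the lattice. Every vertex other than
  \<open>p\<close> is treated alike, inside or outside the attracting set. The geometric hypotheses
  concern \<open>X\<close> alone, yet the argument must also run on \<open>X'\<close>. They are
  therefore first reduced to combinatorics (\<open>regular\<close>): each vertex is an integral
  basis, no further hyperplane passes through it, and no weight of \<open>\<sigma>\<close> vanishes
  there. This package is symmetric under transposing the sequence, so it passes to
  \<open>X'\<close>. Integrality comes from smoothness: a fractional solution of the linear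
  equations would exponentiate to a nontrivial stabilizer. The envelopes are arbitrary functions
  with the defining properties, compared with the product away from a Kaehler polar locus.\<close>

definition qprod :: "complex \<Rightarrow> complex \<Rightarrow> complex" where
  "qprod q x = prodinf (\<lambda>m. 1 - q ^ Suc m * x)"

lemma convergent_qprod:
  fixes q x :: complex
  assumes "norm q < 1"
  shows "convergent_prod (\<lambda>m. 1 - q ^ Suc m * x)"
proof (intro abs_convergent_prod_imp_convergent_prod summable_imp_abs_convergent_prod)
  have "summable (\<lambda>m. norm q ^ m * (norm q * norm x))"
    using assms by (intro summable_mult2 summable_geometric) auto
  then show "summable (\<lambda>m. norm (1 - q ^ Suc m * x - 1))"
    by (simp add: norm_mult norm_power mult_ac)
qed

lemma qprod_shift:
  fixes q x :: complex
  assumes "norm q < 1"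
  shows "qprod q x = (1 - q * x) * qprod q (q * x)"
proof -
  have "(\<lambda>m. 1 - q ^ Suc m * x) has_prod
          ((\<Prod>k<1. 1 - q ^ Suc k * x) * (\<Prod>k. 1 - q ^ Suc (k + 1) * x))"
    by (intro has_prod_ignore_initial_segment'[of _ 1] convergent_qprod assms)
  then show ?thesis
    unfolding qprod_def by (simp add: has_prod_iff mult_ac)
qed

lemma qprod_nonzero:
  fixes q x :: complex
  assumes "norm q < 1" and "\<And>m. q ^ Suc m * x \<noteq> 1"
  shows "qprod q x \<noteq> 0"
  unfolding qprod_def using assms by (intro prodinf_nonzero convergent_qprod) auto

text \<open>On every disc a geometric majorant makes the partial products converge uniformly, and a
  uniform limit of holomorphic functions is holomorphic.\<close>

lemma holomorphic_qprod:
  fixes q :: complex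
  assumes q: "norm q < 1"
  shows "qprod q holomorphic_on UNIV"
proof -
  have "qprod q holomorphic_on ball 0 R" if R: "R > 0" for R :: real
  proof -
    let ?P = "\<lambda>N z. \<Prod>n<N. 1 - q ^ Suc n * z"
    have "uniformly_convergent_on (cball 0 R) ?P"
    proof (rule uniformly_convergent_on_prod')
      show "uniformly_convergent_on (cball 0 R) (\<lambda>N x. \<Sum>n<N. norm (1 - q ^ Suc n * x - 1))"
      proof (rule Weierstrass_m_test')
        fix n and x :: complex assume "x \<in> cball 0 R"
        then have "norm (q ^ Suc n) * norm x \<le> norm (q ^ Suc n) * R"
          by (intro mult_left_mono) auto
        then show "norm (norm (1 - q ^ Suc n * x - 1)) \<le> norm q ^ n * (norm q * R)"
          by (simp add: norm_mult norm_power mult_ac)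
      next
        show "summable (\<lambda>n. norm q ^ n * (norm q * R))"
          using q by (intro summable_mult2 summable_geometric) auto
      qed
    qed (intro continuous_intros | simp)+
    then obtain g where g: "uniform_limit (cball 0 R) ?P g sequentially"
      by (auto simp: uniformly_convergent_on_def)
    have eq: "g z = qprod q z" if "z \<in> cball 0 R" for z
    proof -
      \<comment> \<open>The shift by one reconciles products over \<open>n < N\<close> with the
        products over \<open>n \<le> N\<close> whose limit is \<open>prodinf\<close>.\<close>
      have "(\<lambda>n. ?P (Suc n) z) \<longlonglongrightarrow> g z"
        by (rule LIMSEQ_Suc[OF tendsto_uniform_limitI[OF g that]])
      moreover have "(\<lambda>n. ?P (Suc n) z) \<longlonglongrightarrow> qprod q z"
        using convergent_prod_LIMSEQ[OF convergent_qprod[OF q]]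
        unfolding lessThan_Suc_atMost qprod_def by simp
      ultimately show ?thesis using LIMSEQ_unique by blast
    qed
    have "g holomorphic_on ball 0 R"
      by (rule holomorphic_uniform_limit[OF _ g])
         (auto intro!: always_eventually continuous_intros holomorphic_intros)
    then show ?thesis
      by (rule holomorphic_transform) (use eq in auto)
  qed
  note * = this
  show ?thesis
    unfolding holomorphic_on_def
  proof
    fix z :: complex
    have "qprod q field_differentiable at z"
      using *[of "norm z + 1"] holomorphic_on_imp_differentiable_at[of "qprod q" "ball 0 (norm z + 1)" z]
      by (simp add: add_nonneg_pos)
    then show "qprod q field_differentiable at z within UNIV" by simp
  qed
qed

definition nome :: "complex \<Rightarrow> complex" where
  "nome \<tau> = exp (2 * of_real pi * \<i> * \<tau>)"

lemma norm_nome: "Im \<tau> > 0 \<Longrightarrow> norm (nome \<tau>) < 1"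
  by (simp add: nome_def)

lemma theta_qprod:
  assumes "Im \<tau> > 0"
  shows "theta \<tau> u = (exp (\<i> * of_real pi * u) - exp (- (\<i> * of_real pi * u))) *
    (qprod (nome \<tau>) (exp (2 * of_real pi * \<i> * u)) * qprod (nome \<tau>) (exp (- (2 * of_real pi * \<i> * u))))"
  by (simp only: theta_def qprod_def prodinf_mult convergent_qprod norm_nome[OF assms]
      flip: nome_def)

lemma theta_entire:
  assumes "Im \<tau> > 0"
  shows "theta \<tau> holomorphic_on UNIV"
proof -
  have h: "qprod (nome \<tau>) holomorphic_on S" for S
    using holomorphic_qprod[OF norm_nome[OF assms]] holomorphic_on_subset by blast
  have "(\<lambda>u. (exp (\<i> * of_real pi * u) - exp (- (\<i> * of_real pi * u))) *
    ((qprod (nome \<tau>) \<circ> (\<lambda>u. exp (2 * of_real pi * \<i> * u))) u *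
     (qprod (nome \<tau>) \<circ> (\<lambda>u. exp (- (2 * of_real pi * \<i> * u)))) u)) holomorphic_on UNIV"
    by (intro holomorphic_intros holomorphic_on_compose h)
  then show ?thesis
    by (simp add: theta_qprod[OF assms, abs_def] o_def)
qed

lemma theta_plus_1:
  assumes "Im \<tau> > 0"
  shows "theta \<tau> (u + 1) = - theta \<tau> u"
proof -
  have 1: "exp (\<i> * of_real pi * (u + 1)) = - exp (\<i> * of_real pi * u)"
    by (simp add: algebra_simps exp_add)
  have 2: "exp (- (\<i> * of_real pi * (u + 1))) = - exp (- (\<i> * of_real pi * u))"
    unfolding exp_minus 1 by simp
  have 3: "exp (2 * of_real pi * \<i> * (u + 1)) = exp (2 * of_real pi * \<i> * u)"
    using exp_two_pi_i by (simp add: ring_distribs exp_add)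
  have 4: "exp (- (2 * of_real pi * \<i> * (u + 1))) = exp (- (2 * of_real pi * \<i> * u))"
    unfolding exp_minus 3 by simp
  show ?thesis
    unfolding theta_qprod[OF assms] 1 2 3 4 by (simp add: algebra_simps)
qed

text \<open>Under the shift the product in \<open>x\<close> loses its first factor and the product
  in \<open>1/x\<close> gains one. The leading factor restores the lost one (\<open>pre\<close>),
  and the gained one rebuilds the leading factor (\<open>pre2\<close>).\<close>

lemma theta_plus_tau:
  assumes "Im \<tau> > 0"
  shows "theta \<tau> (u + \<tau>) = - exp (- (\<i> * of_real pi * \<tau>) - 2 * of_real pi * \<i> * u) * theta \<tau> u"
proof -
  define y where "y = exp (\<i> * of_real pi * u)"
  define s where "s = exp (\<i> * of_real pi * \<tau>)"
  define q where "q = nome \<tau>"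
  have q: "norm q < 1" unfolding q_def using assms by (rule norm_nome)
  have nz: "y \<noteq> 0" "s \<noteq> 0" "q \<noteq> 0" by (auto simp: y_def s_def q_def nome_def)
  have qs: "q = s\<^sup>2"
    unfolding q_def s_def nome_def power2_eq_square exp_add[symmetric]
    by (rule arg_cong[of _ _ exp]) (simp add: algebra_simps)
  have e1: "exp (2 * of_real pi * \<i> * u) = y\<^sup>2"
    unfolding y_def power2_eq_square exp_add[symmetric]
    by (rule arg_cong[of _ _ exp]) (simp add: algebra_simps)
  have e2: "exp (- (2 * of_real pi * \<i> * u)) = inverse (y\<^sup>2)" unfolding exp_minus e1 ..
  have e3: "exp (2 * of_real pi * \<i> * (u + \<tau>)) = q * y\<^sup>2"
    by (simp add: ring_distribs exp_add e1 q_def nome_def)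
  have e4: "exp (- (2 * of_real pi * \<i> * (u + \<tau>))) = inverse (q * y\<^sup>2)" unfolding exp_minus e3 ..
  have e5: "exp (\<i> * of_real pi * (u + \<tau>)) = s * y"
    by (simp add: ring_distribs exp_add y_def s_def)
  have e6: "exp (- (\<i> * of_real pi * (u + \<tau>))) = inverse (s * y)" unfolding exp_minus e5 ..
  have e7: "exp (- (\<i> * of_real pi * u)) = inverse y" by (simp add: exp_minus y_def)
  have e8: "exp (- (\<i> * of_real pi * \<tau>) - 2 * of_real pi * \<i> * u) = inverse (s * y\<^sup>2)"
    by (simp add: exp_diff exp_minus e1 s_def divide_inverse)
  have A: "qprod q (y\<^sup>2) = (1 - q * y\<^sup>2) * qprod q (q * y\<^sup>2)"
    by (rule qprod_shift[OF q])
  have B: "qprod q (inverse (q * y\<^sup>2)) = (1 - inverse (y\<^sup>2)) * qprod q (inverse (y\<^sup>2))"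
  proof -
    have "q * inverse (q * y\<^sup>2) = inverse (y\<^sup>2)" using nz by (simp add: field_simps)
    then show ?thesis using qprod_shift[OF q, of "inverse (q * y\<^sup>2)"] by (simp only:)
  qed
  have pre: "s * y - inverse (s * y) = - inverse (s * y) * (1 - q * y\<^sup>2)"
    using nz by (simp add: qs field_simps power2_eq_square)
  have pre2: "inverse (s * y) * (1 - inverse (y\<^sup>2)) = inverse (s * y\<^sup>2) * (y - inverse y)"
    using nz by (simp add: field_simps power2_eq_square)
  have "theta \<tau> (u + \<tau>) = (s * y - inverse (s * y)) * (qprod q (q * y\<^sup>2) * qprod q (inverse (q * y\<^sup>2)))"
    unfolding theta_qprod[OF assms] e3 e4 e5 e6 q_def[symmetric] ..
  also have "\<dots> = - (inverse (s * y) * (1 - inverse (y\<^sup>2))) *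
      (((1 - q * y\<^sup>2) * qprod q (q * y\<^sup>2)) * qprod q (inverse (y\<^sup>2)))"
    unfolding pre B by (simp only: mult_ac minus_mult_left[symmetric] minus_mult_right[symmetric])
  also have "\<dots> = - inverse (s * y\<^sup>2) * ((y - inverse y) * (qprod q (y\<^sup>2) * qprod q (inverse (y\<^sup>2))))"
    unfolding pre2 A[symmetric] by (simp only: mult_ac minus_mult_left[symmetric] minus_mult_right[symmetric])
  also have "\<dots> = - exp (- (\<i> * of_real pi * \<tau>) - 2 * of_real pi * \<i> * u) * theta \<tau> u"
    unfolding theta_qprod[OF assms] e1 e2 e7 e8 q_def[symmetric] y_def[symmetric] ..
  finally show ?thesis .
qed

section \<open>The lattice and the quasi-periods of \<open>theta\<close>\<close>

lemma lat_0 [simp]: "0 \<in> lat \<tau>"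
  by (auto simp: lat_def intro!: exI[of _ 0])

lemma lat_add: "x \<in> lat \<tau> \<Longrightarrow> y \<in> lat \<tau> \<Longrightarrow> x + y \<in> lat \<tau>"
proof (unfold lat_def, clarify)
  fix a b c d :: int
  show "\<exists>e f. of_int a + of_int b * \<tau> + (of_int c + of_int d * \<tau>) = of_int e + of_int f * \<tau> \<and> True"
    by (rule exI[of _ "a + c"], rule exI[of _ "b + d"]) (simp add: algebra_simps)
qed

lemma lat_int_mult: "x \<in> lat \<tau> \<Longrightarrow> of_int m * x \<in> lat \<tau>"
proof (unfold lat_def, clarify)
  fix a b :: int
  show "\<exists>e f. of_int m * (of_int a + of_int b * \<tau>) = of_int e + of_int f * \<tau> \<and> True"
    by (rule exI[of _ "m * a"], rule exI[of _ "m * b"]) (simp add: algebra_simps)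
qed

lemma lat_minus: "x \<in> lat \<tau> \<Longrightarrow> - x \<in> lat \<tau>"
  using lat_int_mult[of x \<tau> "-1"] by simp

lemma lat_sum: "(\<And>i. i \<in> A \<Longrightarrow> f i \<in> lat \<tau>) \<Longrightarrow> sum f A \<in> lat \<tau>"
  by (induction A rule: infinite_finite_induct) (auto intro: lat_add)

lemma lat_1 [simp]: "1 \<in> lat \<tau>"
  unfolding lat_def mem_Collect_eq by (rule exI[of _ 1], rule exI[of _ 0]) simp

lemma lat_tau [simp]: "\<tau> \<in> lat \<tau>"
  unfolding lat_def mem_Collect_eq by (rule exI[of _ 0], rule exI[of _ 1]) simp

lemma theta_mult_lattice:
  assumes "Im \<tau> > 0"
  shows "theta_mult \<tau> (of_real a + of_real b * \<tau>) u =
    exp (\<i> * of_real pi * (of_real a + of_real b - of_real (b\<^sup>2) * \<tau> - 2 * of_real b * u))"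
proof -
  have "Im (of_real a + of_real b * \<tau>) / Im \<tau> = b" using assms by simp
  moreover have "Re (of_real a + of_real b * \<tau>) - b * Re \<tau> = a" by simp
  ultimately show ?thesis unfolding theta_mult_def Let_def by simp
qed

lemma theta_mult_nonzero: "theta_mult \<tau> v u \<noteq> 0"
  by (simp add: theta_mult_def Let_def)

lemma theta_mult_0 [simp]: "theta_mult \<tau> 0 u = 1"
  by (simp add: theta_mult_def)

text \<open>The cocycle identity. For \<open>v = a + b \<tau>\<close> and
  \<open>w = c + d \<tau>\<close> the exponents on the two sides differ by
  \<open>2 \<pi> i b c\<close>, which \<open>exp\<close> kills because \<open>b\<close> and
  \<open>c\<close> are integers.\<close>

lemma theta_mult_add:
  assumes "Im \<tau> > 0" and "v \<in> lat \<tau>" "w \<in> lat \<tau>"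
  shows "theta_mult \<tau> (v + w) u = theta_mult \<tau> v (u + w) * theta_mult \<tau> w u"
proof -
  obtain a b where v: "v = of_int a + of_int b * \<tau>" using assms by (auto simp: lat_def)
  obtain c d where w: "w = of_int c + of_int d * \<tau>" using assms by (auto simp: lat_def)
  have m: "theta_mult \<tau> (of_int a + of_int b * \<tau>) u =
    exp (\<i> * of_real pi * (of_int a + of_int b - of_int (b\<^sup>2) * \<tau> - 2 * of_int b * u))" for a b u
    using theta_mult_lattice[OF assms(1), of "of_int a" "of_int b" u] by simp
  have vw: "v + w = of_int (a + c) + of_int (b + d) * \<tau>" by (simp add: v w algebra_simps)
  have "theta_mult \<tau> v (u + w) * theta_mult \<tau> w u =
     exp (\<i> * of_real pi * (of_int (a + c) + of_int (b + d) - of_int ((b + d)\<^sup>2) * \<tau> - 2 * of_int (b + d) * u)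
       - 2 * of_real pi * \<i> * of_int (b * c))"
    unfolding v w m exp_add[symmetric]
    by (rule arg_cong[of _ _ exp]) (simp add: algebra_simps power2_eq_square)
  also have "\<dots> = theta_mult \<tau> (v + w) u"
    unfolding exp_diff vw m using exp_integer_2pi[of "of_int (b * c)"] by (simp add: mult_ac)
  finally show ?thesis ..
qed

text \<open>By the cocycle identity the periods satisfying the formula form a group
  \<open>G\<close>, so the two generators \<open>1\<close> and \<open>\<tau>\<close>
  suffice.\<close>

lemma theta_add_lat:
  assumes \<tau>: "Im \<tau> > 0" and "v \<in> lat \<tau>"
  shows "theta \<tau> (u + v) = theta_mult \<tau> v u * theta \<tau> u"
proof -
  define G where "G = {v \<in> lat \<tau>. \<forall>u. theta \<tau> (u + v) = theta_mult \<tau> v u * theta \<tau> u}"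
  have add: "v + w \<in> G" if "v \<in> G" "w \<in> G" for v w
  proof -
    have "theta \<tau> (u + (v + w)) = theta_mult \<tau> (v + w) u * theta \<tau> u" for u
    proof -
      have "theta \<tau> (u + (v + w)) = theta \<tau> ((u + w) + v)" by (simp add: add_ac)
      also have "\<dots> = theta_mult \<tau> v (u + w) * (theta_mult \<tau> w u * theta \<tau> u)"
        using that by (simp add: G_def)
      finally show ?thesis using that theta_mult_add[OF \<tau>, of v w u] by (simp add: G_def)
    qed
    then show ?thesis using that by (auto simp: G_def intro: lat_add)
  qed
  have neg: "- v \<in> G" if "v \<in> G" for v
  proof -
    have "theta \<tau> (u + - v) = theta_mult \<tau> (- v) u * theta \<tau> u" for u
    proof -
      have "theta \<tau> u = theta_mult \<tau> v (u - v) * theta \<tau> (u - v)"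
        using that by (auto simp: G_def dest!: spec[of _ "u - v"])
      moreover have "theta_mult \<tau> (- v) u * theta_mult \<tau> v (u - v) = 1"
        using theta_mult_add[OF \<tau>, of "- v" v "u - v"] that lat_minus[of v \<tau>] by (simp add: G_def)
      ultimately show ?thesis by (simp flip: mult.assoc)
    qed
    then show ?thesis using that by (auto simp: G_def intro: lat_minus)
  qed
  have 0: "0 \<in> G" by (simp add: G_def)
  have 1: "1 \<in> G"
    using theta_mult_lattice[OF \<tau>, of 1 0] by (simp add: G_def theta_plus_1[OF \<tau>])
  have t: "\<tau> \<in> G"
  proof -
    have "theta_mult \<tau> \<tau> u = - exp (- (\<i> * of_real pi * \<tau>) - 2 * of_real pi * \<i> * u)" for u
    proof -
      have "theta_mult \<tau> \<tau> u = exp (\<i> * of_real pi * 1 + (- (\<i> * of_real pi * \<tau>) - 2 * of_real pi * \<i> * u))"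
        using theta_mult_lattice[OF \<tau>, of 0 1 u] by (simp add: algebra_simps)
      then show ?thesis unfolding exp_add by simp
    qed
    then show ?thesis by (simp add: G_def theta_plus_tau[OF \<tau>])
  qed
  have int: "of_int a * v \<in> G" if "v \<in> G" for a v
  proof (induction a rule: int_induct[of _ 0])
    case base show ?case using 0 by simp
  next
    case (step1 i) then show ?case using add[OF step1(2) that] by (simp add: algebra_simps)
  next
    case (step2 i) then show ?case using add[OF step2(2) neg[OF that]] by (simp add: algebra_simps)
  qed
  obtain a b where "v = of_int a * 1 + of_int b * \<tau>" using assms(2) by (auto simp: lat_def)
  then have "v \<in> G" using add[OF int[OF 1] int[OF t]] by simp
  then show ?thesis by (simp add: G_def)
qed

section \<open>Zeros of \<open>theta\<close> and their simplicity\<close>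

lemma theta_zero [simp]: "theta \<tau> 0 = 0"
  by (simp add: theta_def)

lemma theta_lat:
  assumes "Im \<tau> > 0" "v \<in> lat \<tau>"
  shows "theta \<tau> v = 0"
  using theta_add_lat[OF assms, of 0] by simp

text \<open>Locates all zeros of \<open>theta\<close>: \<open>m \<ge> 1\<close> serves the factors
  of \<open>qprod\<close>, and \<open>m = 0\<close> the leading difference of exponentials.\<close>

lemma nome_power_exp_eq_1:
  assumes "nome \<tau> ^ m * exp (2 * of_real pi * \<i> * u) = 1"
  shows "u \<in> lat \<tau>"
proof -
  have "exp (2 * of_real pi * \<i> * (of_nat m * \<tau> + u)) = 1"
    using assms by (simp add: nome_def ring_distribs exp_add exp_of_nat_mult[symmetric] mult_ac)
  then obtain n where n: "Re (2 * of_real pi * \<i> * (of_nat m * \<tau> + u)) = 0"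
      "Im (2 * of_real pi * \<i> * (of_nat m * \<tau> + u)) = of_int (2 * n) * pi"
    by (auto simp: exp_eq_1)
  have "of_nat m * \<tau> + u = of_int n"
    using n by (auto simp: complex_eq_iff)
  then have "u = of_int n + of_int (- int m) * \<tau>" by (simp add: algebra_simps)
  then show ?thesis unfolding lat_def by blast
qed

lemma theta_eq_0_iff:
  assumes \<tau>: "Im \<tau> > 0"
  shows "theta \<tau> u = 0 \<longleftrightarrow> u \<in> lat \<tau>"
proof
  assume "theta \<tau> u = 0"
  then consider "exp (\<i> * of_real pi * u) = exp (- (\<i> * of_real pi * u))"
    | "qprod (nome \<tau>) (exp (2 * of_real pi * \<i> * u)) = 0"
    | "qprod (nome \<tau>) (exp (2 * of_real pi * \<i> * (- u))) = 0"
    by (auto simp: theta_qprod[OF \<tau>])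
  then show "u \<in> lat \<tau>"
  proof cases
    case 1
    have "exp (2 * of_real pi * \<i> * u) = exp (\<i> * of_real pi * u) * exp (\<i> * of_real pi * u)"
      unfolding exp_add[symmetric] by (rule arg_cong[of _ _ exp]) (simp add: algebra_simps)
    also have "\<dots> = exp (\<i> * of_real pi * u) * exp (- (\<i> * of_real pi * u))"
      using 1 by simp
    also have "\<dots> = 1" by (simp flip: exp_add)
    finally show ?thesis using nome_power_exp_eq_1[of \<tau> 0 u] by simp
  next
    case 2
    then show ?thesis using qprod_nonzero[OF norm_nome[OF \<tau>]] nome_power_exp_eq_1 by blast
  next
    case 3
    then have "- u \<in> lat \<tau>" using qprod_nonzero[OF norm_nome[OF \<tau>]] nome_power_exp_eq_1 by blast
    then show ?thesis using lat_minus by fastforce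
  qed
qed (rule theta_lat[OF \<tau>])

lemma deriv_theta_0:
  assumes \<tau>: "Im \<tau> > 0"
  shows "\<exists>c. c \<noteq> 0 \<and> (theta \<tau> has_field_derivative c) (at 0)"
proof -
  define Q where "Q = (\<lambda>u. qprod (nome \<tau>) (exp (2 * of_real pi * \<i> * u)) *
    qprod (nome \<tau>) (exp (- (2 * of_real pi * \<i> * u))))"
  have h: "qprod (nome \<tau>) holomorphic_on S" for S
    using holomorphic_qprod[OF norm_nome[OF \<tau>]] holomorphic_on_subset by blast
  have "(\<lambda>u. (qprod (nome \<tau>) \<circ> (\<lambda>u. exp (2 * of_real pi * \<i> * u))) u *
     (qprod (nome \<tau>) \<circ> (\<lambda>u. exp (- (2 * of_real pi * \<i> * u)))) u) holomorphic_on UNIV"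
    by (intro holomorphic_intros holomorphic_on_compose h)
  then have "Q holomorphic_on UNIV" by (simp add: Q_def o_def)
  then obtain Q' where Q': "(Q has_field_derivative Q') (at 0)"
    by (metis UNIV_I field_differentiable_def holomorphic_onD)
  have "nome \<tau> ^ Suc m \<noteq> 1" for m
    using norm_nome[OF \<tau>] by (metis norm_one norm_power power_Suc_less_one zero_less_norm_iff
        less_irrefl nome_def exp_not_eq_zero norm_ge_zero)
  then have "Q 0 \<noteq> 0"
    unfolding Q_def using qprod_nonzero[OF norm_nome[OF \<tau>], of 1] by simp
  have "((\<lambda>u. (exp (\<i> * of_real pi * u) - exp (- (\<i> * of_real pi * u))) * Q u)
     has_field_derivative (2 * \<i> * of_real pi * Q 0)) (at 0)"
    by (rule derivative_eq_intros Q' refl | simp add: algebra_simps)+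
  then have "(theta \<tau> has_field_derivative (2 * \<i> * of_real pi * Q 0)) (at 0)"
    by (simp add: theta_qprod[OF \<tau>, abs_def] Q_def)
  then show ?thesis using \<open>Q 0 \<noteq> 0\<close> by (intro exI[of _ "2 * \<i> * of_real pi * Q 0"]) auto
qed

text \<open>The nowhere vanishing multiplier carries the simple zero at \<open>0\<close> to every
  lattice point. Simplicity is what later permits division by \<open>theta\<close>.\<close>

lemma deriv_theta_lat:
  assumes \<tau>: "Im \<tau> > 0" and v: "v \<in> lat \<tau>"
  shows "\<exists>c. c \<noteq> 0 \<and> (theta \<tau> has_field_derivative c) (at v)"
proof -
  obtain c where c: "c \<noteq> 0" "(theta \<tau> has_field_derivative c) (at 0)"
    using deriv_theta_0[OF \<tau>] by blast
  have eq: "theta \<tau> = (\<lambda>u. theta_mult \<tau> v (u - v) * theta \<tau> (u - v))"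
    using theta_add_lat[OF \<tau> v] by (metis (no_types, opaque_lifting) diff_add_cancel)
  obtain m where m: "((\<lambda>u. theta_mult \<tau> v (u - v)) has_field_derivative m) (at v)"
  proof -
    have "(\<lambda>u. theta_mult \<tau> v (u - v)) holomorphic_on UNIV"
      unfolding theta_mult_def Let_def by (intro holomorphic_intros)
    then show ?thesis using that by (metis UNIV_I field_differentiable_def holomorphic_onD)
  qed
  have t: "((\<lambda>u. theta \<tau> (u - v)) has_field_derivative c) (at v)"
    using c(2) DERIV_shift[of "theta \<tau>" c v "- v"] by simp
  have "((\<lambda>u. theta_mult \<tau> v (u - v) * theta \<tau> (u - v)) has_field_derivative theta_mult \<tau> v 0 * c) (at v)"
    using DERIV_mult[OF m t] by (simp add: mult_ac)
  then show ?thesis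
    using c(1) theta_mult_nonzero[of \<tau> v 0]
    by (intro exI[of _ "theta_mult \<tau> v 0 * c"]) (subst eq, auto)
qed

section \<open>Liouville's theorem for quasi-periodic entire functions\<close>

lemma bounded_if_lattice_periodic:
  fixes f :: "complex \<Rightarrow> complex"
  assumes \<tau>: "Im \<tau> > 0" and cont: "continuous_on UNIV f"
    and 1: "\<And>u. norm (f (u + 1)) = norm (f u)" and t: "\<And>u. norm (f (u + \<tau>)) = norm (f u)"
  shows "bounded (range f)"
proof -
  have int: "norm (f (u + of_int a * v)) = norm (f u)"
    if v: "\<And>u. norm (f (u + v)) = norm (f u)" for a u v
  proof (induction a rule: int_induct[of _ 0])
    case base show ?case by simp
  next
    case (step1 i) then show ?case using v[of "u + of_int i * v"] by (simp add: algebra_simps)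
  next
    case (step2 i) then show ?case using v[of "u + of_int (i - 1) * v"] by (simp add: algebra_simps)
  qed
  define K where "K = (\<lambda>(s, t). of_real s + of_real t * \<tau>) ` (cbox (0, 0) (1, 1 :: real))"
  have "compact K" unfolding K_def
    by (intro compact_continuous_image) (auto intro!: continuous_intros simp: case_prod_unfold)
  then have "compact (f ` K)" using cont continuous_on_subset by (blast intro: compact_continuous_image)
  then obtain B where B: "\<And>u. u \<in> K \<Longrightarrow> norm (f u) \<le> B"
    using compact_imp_bounded by (metis bounded_iff imageI)
  have "norm (f u) \<le> B" for u
  proof -
    define b where "b = Im u / Im \<tau>"
    define a where "a = Re u - b * Re \<tau>"
    have u: "u = of_real a + of_real b * \<tau>" using \<tau> by (auto simp: complex_eq_iff a_def b_def)
    \<comment> \<open>\<open>K\<close> is the closed fundamental parallelogram; taking fractional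
      parts of the real coordinates \<open>a\<close>, \<open>b\<close> moves \<open>u\<close> into
      it without changing the norm of \<open>f\<close>.\<close>
    have "of_real (frac a) + of_real (frac b) * \<tau> \<in> K"
      unfolding K_def by (rule image_eqI[of _ _ "(frac a, frac b)"]) (auto simp: less_imp_le frac_lt_1)
    moreover have "u = (of_real (frac a) + of_real (frac b) * \<tau>) + of_int \<lfloor>a\<rfloor> * 1 + of_int \<lfloor>b\<rfloor> * \<tau>"
      by (simp add: u frac_def algebra_simps)
    ultimately show ?thesis using int[OF 1] int[OF t] B by metis
  qed
  then show ?thesis by (auto simp: bounded_iff)
qed

text \<open>Write \<open>w = a + b \<tau>\<close> with real \<open>a\<close>, \<open>b\<close>.
  Twisting \<open>h\<close> by \<open>exp (2 \<pi> i b u)\<close> makes both multipliers unimodular,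
  so the twist \<open>H\<close> is bounded and hence constant. A nonzero constant forces both
  multipliers to be \<open>1\<close>, that is, \<open>a\<close> and \<open>b\<close> to be
  integers.\<close>

lemma entire_quasi_periodic_eq_0:
  assumes \<tau>: "Im \<tau> > 0" and hol: "h holomorphic_on UNIV"
    and 1: "\<And>u. h (u + 1) = h u"
    and t: "\<And>u. h (u + \<tau>) = exp (- (2 * of_real pi * \<i> * w)) * h u"
    and w: "w \<notin> lat \<tau>"
  shows "h u = 0"
proof (rule ccontr)
  assume nz: "h u \<noteq> 0"
  define b where "b = Im w / Im \<tau>"
  define a where "a = Re w - b * Re \<tau>"
  have w_ab: "w = of_real a + of_real b * \<tau>" using \<tau> by (auto simp: complex_eq_iff a_def b_def)
  define H where "H = (\<lambda>u. exp (2 * of_real pi * \<i> * of_real b * u) * h u)"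
  have H1: "H (u + 1) = exp (2 * of_real pi * \<i> * of_real b) * H u" for u
    by (simp add: H_def 1 ring_distribs exp_add)
  have Ht: "H (u + \<tau>) = exp (- (2 * of_real pi * \<i> * of_real a)) * H u" for u
  proof -
    have "2 * of_real pi * \<i> * of_real b * (u + \<tau>) + - (2 * of_real pi * \<i> * w) =
        - (2 * of_real pi * \<i> * of_real a) + 2 * of_real pi * \<i> * of_real b * u"
      by (simp add: w_ab algebra_simps)
    then have "exp (2 * of_real pi * \<i> * of_real b * (u + \<tau>)) * exp (- (2 * of_real pi * \<i> * w)) =
        exp (- (2 * of_real pi * \<i> * of_real a)) * exp (2 * of_real pi * \<i> * of_real b * u)"
      unfolding exp_add[symmetric] by (rule arg_cong)
    then show ?thesis by (simp add: H_def t flip: mult.assoc)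
  qed
  have "H holomorphic_on UNIV" unfolding H_def by (intro holomorphic_intros hol)
  moreover have "bounded (range H)"
    using \<open>H holomorphic_on UNIV\<close>
    by (intro bounded_if_lattice_periodic[OF \<tau>]) 
       (auto simp: H1 Ht norm_mult intro: holomorphic_on_imp_continuous_on)
  ultimately obtain K where K: "\<And>u. H u = K"
    using Liouville_theorem by (metis constant_on_def UNIV_I)
  have "K \<noteq> 0" using nz K[of u] by (auto simp: H_def)
  then have "exp (2 * of_real pi * \<i> * of_real b) = 1" "exp (- (2 * of_real pi * \<i> * of_real a)) = 1"
    using H1[of 0] Ht[of 0] by (auto simp: K)
  moreover have "exp (2 * of_real pi * \<i> * of_real x) = 1 \<Longrightarrow> x \<in> \<int>" for x
    by (auto simp: exp_eq_1)
  ultimately have "b \<in> \<int>" "- a \<in> \<int>"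
    by (simp, metis mult_minus_right of_real_minus)
  then obtain m n where "b = of_int m" "a = of_int n" by (metis Ints_cases Ints_minus minus_minus)
  then have "w \<in> lat \<tau>" by (auto simp: w_ab lat_def)
  then show False using w by simp
qed

section \<open>Entire functions of several variables and integral linear forms\<close>

lemma continuous_on_fun_coord [continuous_intros]:
  "continuous_on S (\<lambda>P :: 'c \<Rightarrow> 'b :: topological_space. P c)"
  by (rule continuous_on_subset[OF continuous_on_product_coordinates]) simp

abbreviation entire_on :: "'c set \<Rightarrow> (('c \<Rightarrow> complex) \<Rightarrow> complex) \<Rightarrow> bool" where
  "entire_on I f \<equiv> holo_open I (cspace I) f"

lemma holo_open_const: "entire_on I (\<lambda>P. a)"
  by (simp add: holo_open_def)

lemma holo_open_coord: "entire_on I (\<lambda>P. P c)"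
proof -
  have "(\<lambda>u. (P(d := u)) c) field_differentiable at (P d)" for P :: "'a \<Rightarrow> complex" and d
    by (cases "c = d") auto
  then show ?thesis by (auto simp: holo_open_def intro!: continuous_intros)
qed

lemma holo_open_add: "entire_on I f \<Longrightarrow> entire_on I g \<Longrightarrow> entire_on I (\<lambda>P. f P + g P)"
  by (auto simp: holo_open_def intro!: continuous_intros field_differentiable_add)

lemma holo_open_mult: "entire_on I f \<Longrightarrow> entire_on I g \<Longrightarrow> entire_on I (\<lambda>P. f P * g P)"
  by (auto simp: holo_open_def intro!: continuous_intros field_differentiable_mult)

lemma holo_open_sum: "(\<And>i. i \<in> A \<Longrightarrow> entire_on I (f i)) \<Longrightarrow> entire_on I (\<lambda>P. \<Sum>i\<in>A. f i P)"
  by (induction A rule: infinite_finite_induct) (auto intro: holo_open_const holo_open_add)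

lemma holo_open_prod: "(\<And>i. i \<in> A \<Longrightarrow> entire_on I (f i)) \<Longrightarrow> entire_on I (\<lambda>P. \<Prod>i\<in>A. f i P)"
  by (induction A rule: infinite_finite_induct) (auto intro: holo_open_const holo_open_mult)

lemma holo_open_compose:
  assumes "entire_on I f" and h: "h holomorphic_on UNIV"
  shows "entire_on I (\<lambda>P. h (f P))"
  unfolding holo_open_def
proof (intro conjI ballI)
  show "openin (top_of_set (cspace I)) (cspace I)" by simp
  show "continuous_on (cspace I) (\<lambda>P. h (f P))"
    using assms(1) holomorphic_on_imp_continuous_on[OF h]
    by (intro continuous_on_compose2[of UNIV h "cspace I" f]) (auto simp: holo_open_def)
  fix P c assume "P \<in> cspace I" "c \<in> I"
  then have "(\<lambda>u. f (P(c := u))) field_differentiable at (P c)"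
    using assms(1) by (auto simp: holo_open_def)
  moreover have "h field_differentiable at (f (P(c := P c)))"
    using h by (auto simp: holomorphic_on_def)
  ultimately show "(\<lambda>u. h (f (P(c := u)))) field_differentiable at (P c)"
    using field_differentiable_compose[of "\<lambda>u. f (P(c := u))" "P c" h] by (simp add: o_def)
qed

lemma cspace_upd: "P \<in> cspace I \<Longrightarrow> c \<in> I \<Longrightarrow> P(c := u) \<in> cspace I"
  by (auto simp: cspace_def)

lemma holo_open_slice:
  assumes "entire_on I f" "P \<in> cspace I" "c \<in> I"
  shows "(\<lambda>u. f (P(c := u))) holomorphic_on UNIV"
proof -
  have "(\<lambda>u. f (P(c := u))) field_differentiable at w" for w
  proof -
    have "(\<lambda>u. f ((P(c := w))(c := u))) field_differentiable at ((P(c := w)) c)"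
      using assms(1) cspace_upd[OF assms(2,3)] assms(3) unfolding holo_open_def by blast
    then show ?thesis by simp
  qed
  then show ?thesis by (auto simp: holomorphic_on_def)
qed

lemma holo_sub_if_entire:
  assumes "entire_on I f" "Y \<subseteq> cspace I"
  shows "holo_sub I Y f"
  unfolding holo_sub_def using assms by blast

text \<open>Integral coefficients make a form send lattice vectors into \<open>lat \<tau>\<close>,
  so that \<open>theta\<close> of it has quasi-periods. The identity is required for all
  \<open>P\<close>, not just on \<open>cspace I\<close>, so a form ignores every coordinate outside
  \<open>I\<close> (\<open>int_form_restrict\<close>).\<close>

definition int_form :: "'c set \<Rightarrow> (('c \<Rightarrow> complex) \<Rightarrow> complex) \<Rightarrow> bool" where
  "int_form I l \<longleftrightarrow> finite I \<and> (\<exists>k. \<forall>P. l P = (\<Sum>c\<in>I. of_int (k c) * P c))"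

lemma int_form_coord:
  assumes "finite I" "c \<in> I"
  shows "int_form I (\<lambda>P. P c)"
proof -
  have "P c = (\<Sum>d\<in>I. of_int (if d = c then 1 else 0) * P d)" for P :: "'a \<Rightarrow> complex"
  proof -
    have "(\<Sum>d\<in>I. of_int (if d = c then 1 else 0) * P d) = (\<Sum>d\<in>I. if d = c then P d else 0)"
      by (intro sum.cong) auto
    then show ?thesis using assms by simp
  qed
  then show ?thesis
    unfolding int_form_def using assms(1) by (intro conjI exI[of _ "\<lambda>d. if d = c then 1 else 0"]) auto
qed

lemma int_form_add:
  assumes "int_form I l" "int_form I m"
  shows "int_form I (\<lambda>P. l P + m P)"
proof -
  obtain k k' where "\<And>P. l P = (\<Sum>c\<in>I. of_int (k c) * P c)" "\<And>P. m P = (\<Sum>c\<in>I. of_int (k' c) * P c)"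
    using assms by (auto simp: int_form_def)
  then show ?thesis
    using assms(1) unfolding int_form_def
    by (intro conjI exI[of _ "\<lambda>c. k c + k' c"]) (auto simp: ring_distribs sum.distrib)
qed

lemma int_form_scale:
  assumes "int_form I l"
  shows "int_form I (\<lambda>P. of_int a * l P)"
proof -
  obtain k where "\<And>P. l P = (\<Sum>c\<in>I. of_int (k c) * P c)"
    using assms by (auto simp: int_form_def)
  then show ?thesis
    using assms unfolding int_form_def
    by (intro conjI exI[of _ "\<lambda>c. a * k c"]) (auto simp: sum_distrib_left mult_ac)
qed

lemma int_form_minus: "int_form I l \<Longrightarrow> int_form I (\<lambda>P. - l P)"
  using int_form_scale[of I l "-1"] by simp

lemma int_form_diff: "int_form I l \<Longrightarrow> int_form I m \<Longrightarrow> int_form I (\<lambda>P. l P - m P)"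
  using int_form_add[of I l "\<lambda>P. - m P"] int_form_minus[of I m] by simp

lemma int_form_0: "finite I \<Longrightarrow> int_form I (\<lambda>P. 0)"
  unfolding int_form_def by (intro conjI exI[of _ "\<lambda>_. 0"]) auto

lemma int_form_sum:
  assumes "finite I"
  shows "(\<And>i. i \<in> A \<Longrightarrow> int_form I (l i)) \<Longrightarrow> int_form I (\<lambda>P. \<Sum>i\<in>A. l i P)"
  by (induction A rule: infinite_finite_induct) (auto intro: int_form_0 int_form_add assms)

lemma int_form_mono:
  assumes "int_form I l" "I \<subseteq> J" "finite J"
  shows "int_form J l"
proof -
  obtain k where "\<And>P. l P = (\<Sum>c\<in>I. of_int (k c) * P c)" using assms(1) by (auto simp: int_form_def)
  then have "l = (\<lambda>P. \<Sum>c\<in>I. of_int (k c) * P c)" by auto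
  then show ?thesis
    using assms by (auto intro!: int_form_sum int_form_scale int_form_coord)
qed

lemma int_form_vadd: "int_form I l \<Longrightarrow> l (vadd P Q) = l P + l Q"
  by (auto simp: int_form_def vadd_def ring_distribs sum.distrib)

lemma int_form_lat: "int_form I l \<Longrightarrow> L \<in> lat_vec \<tau> I \<Longrightarrow> l L \<in> lat \<tau>"
  by (auto simp: int_form_def lat_vec_def intro!: lat_sum lat_int_mult)

lemma int_form_restrict: "int_form I l \<Longrightarrow> l (restrict_coords I P) = l P"
  by (auto simp: int_form_def restrict_coords_def)

lemma int_form_entire: "int_form I l \<Longrightarrow> entire_on J l"
proof -
  assume "int_form I l"
  then obtain k where "\<And>P. l P = (\<Sum>c\<in>I. of_int (k c) * P c)" by (auto simp: int_form_def)
  then have "l = (\<lambda>P. \<Sum>c\<in>I. of_int (k c) * P c)" by auto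
  then show ?thesis by (auto intro!: holo_open_sum holo_open_mult holo_open_const holo_open_coord)
qed

lemma entire_theta_form: "Im \<tau> > 0 \<Longrightarrow> int_form I l \<Longrightarrow> entire_on J (\<lambda>P. theta \<tau> (l P))"
  by (rule holo_open_compose[OF int_form_entire theta_entire])

lemma entire_theta_mult_form: "int_form I l \<Longrightarrow> entire_on J (\<lambda>P. theta_mult \<tau> v (l P))"
  unfolding theta_mult_def Let_def
  by (rule holo_open_compose[OF int_form_entire]) (assumption | intro holomorphic_intros)+

lemma theta_prod_line_bundle:
  assumes \<tau>: "Im \<tau> > 0" and l: "\<And>i. i \<in> A \<Longrightarrow> int_form I (l i)" and Y: "Y \<subseteq> cspace I"
  shows "line_bundle \<tau> I Y (\<lambda>L P. \<Prod>i\<in>A. theta_mult \<tau> (l i L) (l i P))"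
  unfolding line_bundle_def
proof (intro conjI ballI)
  fix L assume L: "L \<in> lat_vec \<tau> I"
  show "holo_sub I Y (\<lambda>P. \<Prod>i\<in>A. theta_mult \<tau> (l i L) (l i P))"
    by (intro holo_sub_if_entire[OF _ Y] holo_open_prod entire_theta_mult_form[OF l])
  show "(\<Prod>i\<in>A. theta_mult \<tau> (l i L) (l i P)) \<noteq> 0" for P
    by (cases "finite A") (auto simp: theta_mult_nonzero)
  fix M P assume "M \<in> lat_vec \<tau> I"
  then have "theta_mult \<tau> (l i (vadd L M)) (l i P) =
      theta_mult \<tau> (l i L) (l i (vadd P M)) * theta_mult \<tau> (l i M) (l i P)" if "i \<in> A" for i
    unfolding int_form_vadd[OF l[OF that]]
    using L int_form_lat[OF l[OF that]] by (intro theta_mult_add[OF \<tau>]) auto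
  then show "(\<Prod>i\<in>A. theta_mult \<tau> (l i (vadd L M)) (l i P)) =
      (\<Prod>i\<in>A. theta_mult \<tau> (l i L) (l i (vadd P M))) * (\<Prod>i\<in>A. theta_mult \<tau> (l i M) (l i P))"
    unfolding prod.distrib[symmetric] by (intro prod.cong) auto
qed

lemma theta_prod_holo_section:
  assumes \<tau>: "Im \<tau> > 0" and l: "\<And>i. i \<in> A \<Longrightarrow> int_form I (l i)" and Y: "Y \<subseteq> cspace I"
  shows "holo_section \<tau> I Y (\<lambda>L P. \<Prod>i\<in>A. theta_mult \<tau> (l i L) (l i P)) (\<lambda>P. \<Prod>i\<in>A. theta \<tau> (l i P))"
  unfolding holo_section_def
proof (intro conjI ballI)
  show "holo_sub I Y (\<lambda>P. \<Prod>i\<in>A. theta \<tau> (l i P))"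
    by (intro holo_sub_if_entire[OF _ Y] holo_open_prod entire_theta_form[OF \<tau> l])
  fix L P assume "L \<in> lat_vec \<tau> I"
  then have "theta \<tau> (l i (vadd P L)) = theta_mult \<tau> (l i L) (l i P) * theta \<tau> (l i P)" if "i \<in> A" for i
    unfolding int_form_vadd[OF l[OF that]]
    using int_form_lat[OF l[OF that]] by (intro theta_add_lat[OF \<tau>]) auto
  then show "(\<Prod>i\<in>A. theta \<tau> (l i (vadd P L))) =
      (\<Prod>i\<in>A. theta_mult \<tau> (l i L) (l i P)) * (\<Prod>i\<in>A. theta \<tau> (l i P))"
    unfolding prod.distrib[symmetric] by (intro prod.cong) auto
qed

section \<open>Denominators and generic properties\<close>

lemma entire_mult_nonzero:
  fixes f g :: "complex \<Rightarrow> complex"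
  assumes f: "f holomorphic_on UNIV" and g: "g holomorphic_on UNIV" and "f a \<noteq> 0" "g b \<noteq> 0"
  shows "\<exists>u. f u \<noteq> 0 \<and> g u \<noteq> 0"
proof (rule ccontr)
  assume "\<not> ?thesis"
  \<comment> \<open>\<open>f\<close> would vanish on the nonempty open set where \<open>g\<close>
    does not, hence everywhere by the identity theorem.\<close>
  then have *: "f u = 0" if "g u \<noteq> 0" for u using that by blast
  have "continuous_on UNIV g" using g by (rule holomorphic_on_imp_continuous_on)
  then have "open {u. g u \<noteq> 0}" by (intro open_Collect_neq) auto
  moreover have "f a = 0"
    by (rule analytic_continuation[of f UNIV "{u. g u \<noteq> 0}" b a])
       (use f assms(4) * calculation in \<open>auto intro: islimpt_subset simp: islimpt_UNIV interior_limit_point interior_open\<close>)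
  ultimately show False using assms(3) by blast
qed

text \<open>Entire functions of several variables have no zero divisors. The induction runs over the
  coordinates in which \<open>P\<close> and \<open>Q\<close> may differ: the one-variable case moves
  both points to a common value of one coordinate while keeping \<open>f P\<close> and
  \<open>g Q\<close> nonzero.\<close>

lemma entire_on_mult_nonzero:
  assumes "finite C" "C \<subseteq> J" "entire_on J f" "entire_on J g"
    and "P \<in> cspace J" "Q \<in> cspace J" "f P \<noteq> 0" "g Q \<noteq> 0" "\<And>c. c \<notin> C \<Longrightarrow> P c = Q c"
  shows "\<exists>R\<in>cspace J. f R \<noteq> 0 \<and> g R \<noteq> 0"
  using assms
proof (induction C arbitrary: P Q rule: finite_induct)
  case empty
  then have "P = Q" by auto
  then show ?case using empty by blast
next
  case (insert c C)
  have c: "c \<in> J" using insert by auto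
  have "\<exists>u. f (P(c := u)) \<noteq> 0 \<and> g (Q(c := u)) \<noteq> 0"
    by (rule entire_mult_nonzero[of _ _ "P c" "Q c"])
       (use insert.prems c in \<open>auto intro: holo_open_slice\<close>)
  then obtain u where u: "f (P(c := u)) \<noteq> 0" "g (Q(c := u)) \<noteq> 0" by blast
  show ?case
    by (rule insert.IH[of "P(c := u)" "Q(c := u)"])
       (use insert.prems u cspace_upd[OF _ c] in \<open>simp_all del: fun_upd_apply\<close>, simp)
qed

lemma denominator_mult:
  assumes "finite J" "denominator J f" "denominator J g"
  shows "denominator J (\<lambda>P. f P * g P)"
proof -
  obtain P Q where "P \<in> cspace J" "f P \<noteq> 0" "Q \<in> cspace J" "g Q \<noteq> 0"
    using assms by (auto simp: denominator_def)
  then have "\<exists>R\<in>cspace J. f R \<noteq> 0 \<and> g R \<noteq> 0"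
    using assms by (intro entire_on_mult_nonzero[of J J f g P Q]) (auto simp: denominator_def cspace_def)
  then show ?thesis using assms by (auto simp: denominator_def intro: holo_open_mult)
qed

lemma denominator_1: "denominator J (\<lambda>P. 1)"
  unfolding denominator_def
  by (intro conjI holo_open_const bexI[of _ "\<lambda>_. 0"]) (simp_all add: cspace_def)

lemma denominator_prod:
  assumes "finite J"
  shows "(\<And>i. i \<in> A \<Longrightarrow> denominator J (g i)) \<Longrightarrow> denominator J (\<lambda>P. \<Prod>i\<in>A. g i P)"
  by (induction A rule: infinite_finite_induct) (auto intro: denominator_1 denominator_mult assms)

lemma denominator_theta:
  assumes "Im \<tau> > 0" "int_form J l" "P \<in> cspace J" "l P \<notin> lat \<tau>"
  shows "denominator J (\<lambda>P. theta \<tau> (l P))"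
  unfolding denominator_def
  using assms by (auto intro!: entire_theta_form simp: theta_eq_0_iff)

lemma generically_denominator:
  "denominator J g \<Longrightarrow> generically J (\<lambda>P. g (restrict_coords J P) \<noteq> 0)"
  by (auto simp: generically_def)

lemma generically_conj:
  assumes "finite J" "generically J Q" "generically J R"
  shows "generically J (\<lambda>P. Q P \<and> R P)"
proof -
  obtain f g where f: "denominator J f" "\<forall>P. f (restrict_coords J P) \<noteq> 0 \<longrightarrow> Q P"
    and g: "denominator J g" "\<forall>P. g (restrict_coords J P) \<noteq> 0 \<longrightarrow> R P"
    using assms by (auto simp: generically_def)
  then show ?thesis
    unfolding generically_def using denominator_mult[OF assms(1) f(1) g(1)]
    by (intro exI[of _ "\<lambda>P. f P * g P"]) auto
qed

lemma generically_mono: "generically J Q \<Longrightarrow> (\<And>P. Q P \<Longrightarrow> R P) \<Longrightarrow> generically J R"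
  unfolding generically_def by blast

text \<open>Renaming coordinates by an injective \<open>\<pi>\<close> and rescaling them by nonzero
  \<open>s\<close> keeps a denominator nonzero and entire. It is applied to the inclusion of the
  Kaehler coordinates into all parameters, and to \<open>kappa\<close>, where the Kaehler
  coordinates of the mirror become the \<open>a_i\<close> and \<open>Hbar\<close> changes
  sign.\<close>

lemma generically_pullback:
  fixes \<phi> :: "('e \<Rightarrow> complex) \<Rightarrow> 'c \<Rightarrow> complex" and s :: "'c \<Rightarrow> complex"
  assumes gen: "generically J Q" and Q': "\<And>P. Q (\<phi> P) \<Longrightarrow> Q' P"
    and \<phi>: "\<And>P c. c \<in> J \<Longrightarrow> \<phi> P c = s c * P (\<pi> c)" and s: "\<And>c. c \<in> J \<Longrightarrow> s c \<noteq> 0"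
    and inj: "inj_on \<pi> J" and \<pi>: "\<pi> ` J \<subseteq> K"
  shows "generically K Q'"
proof -
  obtain g where g: "denominator J g" "\<forall>P. g (restrict_coords J P) \<noteq> 0 \<longrightarrow> Q P"
    using gen by (auto simp: generically_def)
  define r where "r = (\<lambda>P. restrict_coords J (\<phi> P))"
  have r: "r P = (\<lambda>c. if c \<in> J then s c * P (\<pi> c) else 0)" for P
    by (auto simp: r_def restrict_coords_def \<phi>)
  have r_cspace: "r P \<in> cspace J" for P by (auto simp: r cspace_def)
  have "denominator K (\<lambda>P. g (r P))"
    unfolding denominator_def holo_open_def
  proof (intro conjI ballI)
    show "openin (top_of_set (cspace K)) (cspace K)" by simp
    have "continuous_on (cspace K) r"
    proof (rule continuous_on_coordinatewise_then_product)
      fix c show "continuous_on (cspace K) (\<lambda>P. r P c)"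
        by (cases "c \<in> J") (auto simp: r intro!: continuous_intros)
    qed
    then show "continuous_on (cspace K) (\<lambda>P. g (r P))"
      using g(1) r_cspace unfolding denominator_def holo_open_def
      by (intro continuous_on_compose2[of "cspace J" g "cspace K" r]) auto
  next
    fix P d assume P: "P \<in> cspace K" and d: "d \<in> K"
    show "(\<lambda>u. g (r (P(d := u)))) field_differentiable at (P d)"
    proof (cases "d \<in> \<pi> ` J")
      case True
      then obtain c where c: "c \<in> J" "d = \<pi> c" by blast
      have eq: "r (P(d := u)) = (r P)(c := s c * u)" for u
        using c inj by (auto simp: r fun_eq_iff inj_on_def)
      have "(\<lambda>u. g ((r P)(c := u))) holomorphic_on UNIV"
        using g(1) r_cspace c(1) by (auto simp: denominator_def intro: holo_open_slice)
      then have "(\<lambda>u. g ((r P)(c := u))) \<circ> (\<lambda>u. s c * u) holomorphic_on UNIV"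
        by (intro holomorphic_on_compose_gen[of _ UNIV _ UNIV] holomorphic_intros) auto
      then show ?thesis unfolding eq by (auto simp: o_def holomorphic_on_def)
    next
      case False
      then have "r (P(d := u)) = r P" for u by (auto simp: r fun_eq_iff)
      then show ?thesis by simp
    qed
  next
    obtain P where P: "P \<in> cspace J" "g P \<noteq> 0" using g(1) by (auto simp: denominator_def)
    \<comment> \<open>\<open>R\<close> is a preimage under \<open>r\<close> of a point
      \<open>P\<close> with \<open>g P \<noteq> 0\<close>, so the pulled back denominator is not
      identically zero.\<close>
    define R where "R = (\<lambda>d. if d \<in> \<pi> ` J then P (the_inv_into J \<pi> d) / s (the_inv_into J \<pi> d) else 0)"
    have "r R = P"
      using s P(1) by (auto simp: r R_def fun_eq_iff the_inv_into_f_f[OF inj] cspace_def)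
    moreover have "R \<in> cspace K" using \<pi> by (auto simp: R_def cspace_def)
    ultimately show "\<exists>P\<in>cspace K. g (r P) \<noteq> 0" using P by metis
  qed
  moreover have "Q' P" if "g (r (restrict_coords K P)) \<noteq> 0" for P
  proof -
    have "r (restrict_coords K P) = r P" using \<pi> by (auto simp: r restrict_coords_def fun_eq_iff)
    then have "g (restrict_coords J (\<phi> P)) \<noteq> 0" using that unfolding r_def by simp
    then show ?thesis using g(2) Q' by blast
  qed
  ultimately show ?thesis unfolding generically_def by blast
qed

text \<open>Away from the zeros of \<open>\<phi>\<close> the quotient is plainly holomorphic. At a
  zero \<open>u0\<close>, common to \<open>h\<close> and simple for \<open>\<phi>\<close>, it is the
  ratio of the difference quotients of \<open>h\<close> and \<open>\<phi>\<close> at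
  \<open>u0\<close>, which are holomorphic with nonzero denominator nearby.\<close>

lemma holomorphic_quotient:
  assumes h: "h holomorphic_on UNIV" and \<phi>: "\<phi> holomorphic_on UNIV"
    and zero: "\<And>u. \<phi> u = 0 \<Longrightarrow> h u = 0 \<and> deriv \<phi> u \<noteq> 0"
  obtains Q where "Q holomorphic_on UNIV" "\<And>u. h u = Q u * \<phi> u"
proof
  define Q where "Q = (\<lambda>u. if \<phi> u = 0 then deriv h u / deriv \<phi> u else h u / \<phi> u)"
  show "h u = Q u * \<phi> u" for u using zero[of u] by (auto simp: Q_def)
  have open_ne: "open {u. f u \<noteq> 0}" if "f holomorphic_on UNIV" for f :: "complex \<Rightarrow> complex"
    using holomorphic_on_imp_continuous_on[OF that] by (intro open_Collect_neq) auto
  have "Q field_differentiable at u0" for u0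
  proof (cases "\<phi> u0 = 0")
    case False
    have "(\<lambda>u. h u / \<phi> u) holomorphic_on {u. \<phi> u \<noteq> 0}"
      using h \<phi> by (intro holomorphic_intros) (auto intro: holomorphic_on_subset)
    then have "Q holomorphic_on {u. \<phi> u \<noteq> 0}"
      by (rule holomorphic_transform) (auto simp: Q_def)
    then show ?thesis using False open_ne[OF \<phi>] holomorphic_on_imp_differentiable_at by blast
  next
    case True
    define P where "P f u = (if u = u0 then deriv f u0 else (f u - f u0) / (u - u0))" for f and u :: complex
    have P: "P f holomorphic_on UNIV" if "f holomorphic_on UNIV" for f
      using pole_lemma_open[OF that open_UNIV, of u0] by (simp add: P_def[abs_def])
    let ?S = "{u. P \<phi> u \<noteq> 0}"
    have "(\<lambda>u. P h u / P \<phi> u) holomorphic_on ?S"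
      using P[OF h] P[OF \<phi>] by (intro holomorphic_intros) (auto intro: holomorphic_on_subset)
    then have "Q holomorphic_on ?S"
      by (rule holomorphic_transform) (use True zero[OF True] in \<open>auto simp: P_def Q_def\<close>)
    moreover have "u0 \<in> ?S" using zero[OF True] by (simp add: P_def)
    ultimately show ?thesis using open_ne[OF P[OF \<phi>]] holomorphic_on_imp_differentiable_at by blast
  qed
  then show "Q holomorphic_on UNIV" by (auto simp: holomorphic_on_def)
qed

text \<open>
  A theta function of degree one in \<open>u\<close> is determined by the position of its zero, so one whose
  zero is prescribed elsewhere vanishes.
\<close>

lemma theta_degree_one_eq_0:
  assumes \<tau>: "Im \<tau> > 0" and hol: "h holomorphic_on UNIV"
    and 1: "\<And>u. h (u + 1) = - h u"
    and t: "\<And>u. h (u + \<tau>) = theta_mult \<tau> \<tau> (u + c) * h u"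
    and zero: "\<And>u. u + e \<in> lat \<tau> \<Longrightarrow> h u = 0"
    and ce: "c - e \<notin> lat \<tau>"
  shows "h u = 0"
proof -
  define \<phi> where "\<phi> = (\<lambda>u. theta \<tau> (u + e))"
  have \<phi>0: "\<phi> u = 0 \<longleftrightarrow> u + e \<in> lat \<tau>" for u by (simp add: \<phi>_def theta_eq_0_iff[OF \<tau>])
  have \<phi>hol: "\<phi> holomorphic_on UNIV"
  proof -
    have "theta \<tau> \<circ> (\<lambda>u. u + e) holomorphic_on UNIV"
      by (intro holomorphic_on_compose_gen[OF _ theta_entire[OF \<tau>]] holomorphic_intros) auto
    then show ?thesis by (simp add: \<phi>_def o_def)
  qed
  have "deriv \<phi> u \<noteq> 0" if u: "\<phi> u = 0" for u
  proof -
    obtain c' where "c' \<noteq> 0" "(theta \<tau> has_field_derivative c') (at (u + e))"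
      using deriv_theta_lat[OF \<tau>] u \<phi>0 by blast
    then show ?thesis
      using DERIV_imp_deriv[of \<phi> c' u] DERIV_shift[of "theta \<tau>" c' u e] by (simp add: \<phi>_def)
  qed
  then obtain Q where Qhol: "Q holomorphic_on UNIV" and hQ: "\<And>u. h u = Q u * \<phi> u"
    using holomorphic_quotient[OF hol \<phi>hol] zero \<phi>0 by metis
  \<comment> \<open>At \<open>u = c - e - e\<close> the argument of \<open>theta\<close> in
    \<open>\<phi>\<close> is \<open>c - e\<close>, which is off the lattice.\<close>
  have nz: "\<exists>u. \<phi> u \<noteq> 0"
    using ce lat_1 \<phi>0[of "c - e - e"] by (auto intro!: exI[of _ "c - e - e"])
  have dense: "f = g" if eq: "\<And>u. \<phi> u \<noteq> 0 \<Longrightarrow> f u = g u"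
    and f: "f holomorphic_on UNIV" and g: "g holomorphic_on UNIV" for f g
  proof (rule ext, rule ccontr)
    fix u assume "f u \<noteq> g u"
    moreover obtain w where "\<phi> w \<noteq> 0" using nz by blast
    ultimately have "\<exists>u'. (\<lambda>u. f u - g u) u' \<noteq> 0 \<and> \<phi> u' \<noteq> 0"
      by (intro entire_mult_nonzero[of _ _ u w] holomorphic_on_diff f g \<phi>hol) auto
    then show False using eq by auto
  qed
  have shift: "(\<lambda>u. Q (u + v)) holomorphic_on UNIV" for v
  proof -
    have "Q \<circ> (\<lambda>u. u + v) holomorphic_on UNIV"
      by (intro holomorphic_on_compose_gen[OF _ Qhol] holomorphic_intros) auto
    then show ?thesis by (simp add: o_def)
  qed
  have \<phi>1: "\<phi> (u + 1) = - \<phi> u" for u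
    using theta_plus_1[OF \<tau>, of "u + e"] by (simp add: \<phi>_def add_ac)
  have \<phi>t: "\<phi> (u + \<tau>) = theta_mult \<tau> \<tau> (u + e) * \<phi> u" for u
    using theta_add_lat[OF \<tau> lat_tau, of "u + e"] by (simp add: \<phi>_def add_ac)
  \<comment> \<open>The multipliers of \<open>h\<close> and \<open>\<phi>\<close> differ by a
    constant, so \<open>Q = h / \<phi>\<close> has constant multipliers, with
    \<open>w = c - e\<close> in \<open>entire_quasi_periodic_eq_0\<close>.\<close>
  have mult_tau: "theta_mult \<tau> \<tau> (u + c) = exp (- (2 * of_real pi * \<i> * (c - e))) * theta_mult \<tau> \<tau> (u + e)" for u
  proof -
    have "\<i> * of_real pi * (1 - \<tau> - 2 * (u + c)) =
        - (2 * of_real pi * \<i> * (c - e)) + \<i> * of_real pi * (1 - \<tau> - 2 * (u + e))"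
      by (simp add: algebra_simps)
    then show ?thesis
      using theta_mult_lattice[OF \<tau>, of 0 1] by (simp flip: exp_add)
  qed
  have "(\<lambda>u. Q (u + 1)) = Q"
  proof (rule dense)
    fix u assume u: "\<phi> u \<noteq> 0"
    have "Q (u + 1) * \<phi> u = Q u * \<phi> u"
      using hQ[of "u + 1"] 1[of u] hQ[of u] unfolding \<phi>1 by auto
    then show "Q (u + 1) = Q u" using u by simp
  qed (rule shift Qhol)+
  moreover have "(\<lambda>u. Q (u + \<tau>)) = (\<lambda>u. exp (- (2 * of_real pi * \<i> * (c - e))) * Q u)"
  proof (rule dense)
    fix u assume u: "\<phi> u \<noteq> 0"
    have "Q (u + \<tau>) * (theta_mult \<tau> \<tau> (u + e) * \<phi> u) =
        (exp (- (2 * of_real pi * \<i> * (c - e))) * Q u) * (theta_mult \<tau> \<tau> (u + e) * \<phi> u)"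
      using hQ[of "u + \<tau>"] t[of u] hQ[of u] unfolding \<phi>t mult_tau by (auto simp: mult_ac)
    then show "Q (u + \<tau>) = exp (- (2 * of_real pi * \<i> * (c - e))) * Q u"
      using u theta_mult_nonzero by simp
  qed (intro shift holomorphic_intros Qhol)+
  ultimately have "Q u = 0" for u
    by (intro entire_quasi_periodic_eq_0[OF \<tau> Qhol _ _ ce]) (auto simp: fun_eq_iff)
  then show ?thesis by (simp add: hQ)
qed

section \<open>Combinatorics of the vertices\<close>

lemma cspace_outside: "P \<in> cspace I \<Longrightarrow> c \<notin> I \<Longrightarrow> P c = 0"
  by (simp add: cspace_def)

lemma finite_compl_set [simp]: "finite (compl_set D p)"
  by (simp add: compl_set_def)

lemma compl_compl_set: "p \<subseteq> {..<dimT D} \<Longrightarrow> compl_set D (compl_set D p) = p"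
  by (auto simp: compl_set_def)

lemma mirror_sel [simp]:
  "dimK (mirror D) = dimA D" "dimT (mirror D) = dimT D" "dimA (mirror D) = dimK D"
  "iota (mirror D) i r = beta D r i" "beta (mirror D) j i = iota D i j"
  "lift_theta (mirror D) i = - lift_sigma D i" "lift_sigma (mirror D) i = - lift_theta D i"
  "compl_set (mirror D) p = compl_set D p"
  by (simp_all add: mirror_def compl_set_def)

lemma mirror_mirror [simp]: "mirror (mirror D) = D"
  by (simp add: mirror_def)

lemma fixed_setsD:
  assumes "p \<in> fixed_sets D"
  shows "p \<subseteq> {..<dimT D}" "finite p" "card p = dimA D" "flat D p \<noteq> {}"
  using assms by (auto simp: fixed_sets_def intro: finite_subset)

lemma sum_split_compl:
  assumes "p \<subseteq> {..<dimT D}"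
  shows "(\<Sum>l<dimT D. f l) = (\<Sum>l\<in>p. f l) + (\<Sum>l\<in>compl_set D p. f l)"
  using assms sum.subset_diff[of p "{..<dimT D}" f] by (simp add: compl_set_def add.commute)

text \<open>\<open>S\<close> is an integral section of \<open>beta\<close> and \<open>T\<close> an
  integral retraction onto the image of \<open>iota\<close>. Unlike \<open>exact_seq\<close>, this
  form of exactness is visibly self-dual: transposing everything gives a splitting for the
  mirror.\<close>

definition splitting :: "hypertoric \<Rightarrow> (nat \<Rightarrow> nat \<Rightarrow> int) \<Rightarrow> (nat \<Rightarrow> nat \<Rightarrow> int) \<Rightarrow> bool" where
  "splitting D S T \<longleftrightarrow>
     (\<forall>l<dimT D. \<forall>i<dimT D. (\<Sum>j<dimK D. iota D l j * T j i) + (\<Sum>r<dimA D. S l r * beta D r i) =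
        (if l = i then 1 else 0)) \<and>
     (\<forall>r<dimA D. \<forall>r'<dimA D. (\<Sum>i<dimT D. beta D r i * S i r') = (if r = r' then 1 else 0)) \<and>
     (\<forall>j<dimK D. \<forall>j'<dimK D. (\<Sum>i<dimT D. T j i * iota D i j') = (if j = j' then 1 else 0)) \<and>
     (\<forall>r<dimA D. \<forall>j<dimK D. (\<Sum>i<dimT D. beta D r i * iota D i j) = 0)"

lemma sum_delta_mult [simp]:
  fixes f :: "nat \<Rightarrow> 'a :: semiring_1"
  assumes "finite A"
  shows "(\<Sum>i\<in>A. (if a = i then 1 else 0) * f i) = (if a \<in> A then f a else 0)"
    "(\<Sum>i\<in>A. (if i = a then 1 else 0) * f i) = (if a \<in> A then f a else 0)"
    "(\<Sum>i\<in>A. f i * (if a = i then 1 else 0)) = (if a \<in> A then f a else 0)"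
    "(\<Sum>i\<in>A. f i * (if i = a then 1 else 0)) = (if a \<in> A then f a else 0)"
  using assms by (simp_all add: if_distrib if_distribR cong: if_cong)

lemma sum_sum_assoc:
  fixes f g :: "nat \<Rightarrow> 'a :: comm_semiring_0"
  shows "(\<Sum>i\<in>A. f i * (\<Sum>j\<in>B. h i j * g j)) = (\<Sum>j\<in>B. (\<Sum>i\<in>A. f i * h i j) * g j)"
  by (simp add: sum_distrib_left sum_distrib_right sum.swap[of _ A B] mult.assoc)

text \<open>Surjectivity of \<open>beta\<close> gives \<open>S\<close>. Then
  \<open>1 - S beta\<close> lands in the kernel of \<open>beta\<close>, which is the image of
  \<open>iota\<close>, and this gives \<open>T\<close>. Finally
  \<open>iota (T iota - 1) = 0\<close>, and injectivity of \<open>iota\<close> yields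
  \<open>T iota = 1\<close>.\<close>

lemma exact_splitting:
  assumes ex: "exact_seq (dimK D) (dimT D) (dimA D) (iota D) (beta D)"
  shows "\<exists>S T. splitting D S T"
proof -
  define k n d \<iota> \<beta> where "k = dimK D" and "n = dimT D" and "d = dimA D" and "\<iota> = iota D" and "\<beta> = beta D"
  have ex': "exact_seq k n d \<iota> \<beta>" using ex by (simp add: k_def n_def d_def \<iota>_def \<beta>_def)
  note ex' = conjunct1[OF ex'[unfolded exact_seq_def]] conjunct2[OF ex'[unfolded exact_seq_def]]
  note inj = mp[OF spec[OF ex'(1)]] and ker = spec[OF conjunct1[OF ex'(2)]]
    and surj = spec[OF conjunct2[OF ex'(2)]]
  have "\<forall>r'. \<exists>u. \<forall>r<d. (if r = r' then 1 else 0) = (\<Sum>i<n. \<beta> r i * u i)"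
    by (intro allI surj)
  then obtain S' where S': "\<forall>r'. \<forall>r<d. (if r = r' then 1 else 0) = (\<Sum>i<n. \<beta> r i * S' r' i)"
    unfolding choice_iff ..
  define S where "S = (\<lambda>i r. S' r i)"
  have BS: "(\<Sum>i<n. \<beta> r i * S i r') = (if r = r' then 1 else 0)" if "r < d" for r r'
    using S' that by (simp add: S_def)
  have BI: "(\<Sum>i<n. \<beta> r i * \<iota> i j) = 0" if "r < d" "j < k" for r j
  proof -
    have "\<exists>v. \<forall>i<n. \<iota> i j = (\<Sum>j'<k. \<iota> i j' * v j')"
      using that by (intro exI[of _ "\<lambda>j'. if j' = j then 1 else 0"]) auto
    then show ?thesis using ker[of "\<lambda>i. \<iota> i j"] that by blast
  qed
  have "\<exists>v. \<forall>l<n. (if l = i then 1 else 0) - (\<Sum>r<d. S l r * \<beta> r i) = (\<Sum>j<k. \<iota> l j * v j)" if i: "i < n" for i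
  proof -
    have "(\<Sum>l<n. \<beta> r l * ((if l = i then 1 else 0) - (\<Sum>r'<d. S l r' * \<beta> r' i))) = 0" if r: "r < d" for r
    proof -
      have "(\<Sum>l<n. \<beta> r l * (\<Sum>r'<d. S l r' * \<beta> r' i)) = (\<Sum>r'<d. (\<Sum>l<n. \<beta> r l * S l r') * \<beta> r' i)"
        by (rule sum_sum_assoc)
      also have "\<dots> = \<beta> r i" using r by (simp add: BS)
      finally show ?thesis using i by (simp add: right_diff_distrib sum_subtractf)
    qed
    then show ?thesis using ker[of "\<lambda>l. (if l = i then 1 else 0) - (\<Sum>r<d. S l r * \<beta> r i)"] by blast
  qed
  then have "\<forall>i. \<exists>v. i < n \<longrightarrow> (\<forall>l<n. (if l = i then 1 else 0) - (\<Sum>r<d. S l r * \<beta> r i) = (\<Sum>j<k. \<iota> l j * v j))"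
    by blast
  then obtain T' where T': "\<forall>i. i < n \<longrightarrow> (\<forall>l<n.
      (if l = i then 1 else 0) - (\<Sum>r<d. S l r * \<beta> r i) = (\<Sum>j<k. \<iota> l j * T' i j))"
    unfolding choice_iff ..
  define T where "T = (\<lambda>j i. T' i j)"
  have IT: "(\<Sum>j<k. \<iota> l j * T j i) = (if l = i then 1 else 0) - (\<Sum>r<d. S l r * \<beta> r i)" if "l < n" "i < n" for l i
    using T' that by (simp add: T_def)
  have TI: "(\<Sum>i<n. T j i * \<iota> i j') = (if j = j' then 1 else 0)" if j: "j < k" "j' < k" for j j'
  proof -
    have "(\<Sum>j<k. \<iota> l j * ((\<Sum>i<n. T j i * \<iota> i j') - (if j = j' then 1 else 0))) = 0" if l: "l < n" for l
    proof -
      have "(\<Sum>j<k. \<iota> l j * (\<Sum>i<n. T j i * \<iota> i j')) = (\<Sum>i<n. (\<Sum>j<k. \<iota> l j * T j i) * \<iota> i j')"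
        by (rule sum_sum_assoc)
      also have "\<dots> = (\<Sum>i<n. (if l = i then 1 else 0) * \<iota> i j') - (\<Sum>i<n. (\<Sum>r<d. S l r * \<beta> r i) * \<iota> i j')"
        using l by (simp add: IT left_diff_distrib sum_subtractf)
      also have "(\<Sum>i<n. (\<Sum>r<d. S l r * \<beta> r i) * \<iota> i j') = (\<Sum>r<d. S l r * (\<Sum>i<n. \<beta> r i * \<iota> i j'))"
        by (rule sum_sum_assoc[symmetric])
      also have "\<dots> = 0" using j by (simp add: BI)
      finally show ?thesis using l j by (simp add: right_diff_distrib sum_subtractf)
    qed
    then show ?thesis using inj[of "\<lambda>j. (\<Sum>i<n. T j i * \<iota> i j') - (if j = j' then 1 else 0)"] j by force
  qed
  have "splitting D S T"
    unfolding splitting_def k_def[symmetric] n_def[symmetric] d_def[symmetric] \<iota>_def[symmetric] \<beta>_def[symmetric]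
    using IT BS TI BI by simp
  then show ?thesis by blast
qed

lemma splittingD:
  assumes "splitting D S T"
  shows "l < dimT D \<Longrightarrow> i < dimT D \<Longrightarrow>
      (\<Sum>j<dimK D. iota D l j * T j i) + (\<Sum>r<dimA D. S l r * beta D r i) = (if l = i then 1 else 0)"
    and "r < dimA D \<Longrightarrow> r' < dimA D \<Longrightarrow> (\<Sum>i<dimT D. beta D r i * S i r') = (if r = r' then 1 else 0)"
    and "j < dimK D \<Longrightarrow> j' < dimK D \<Longrightarrow> (\<Sum>i<dimT D. T j i * iota D i j') = (if j = j' then 1 else 0)"
    and "r < dimA D \<Longrightarrow> j < dimK D \<Longrightarrow> (\<Sum>i<dimT D. beta D r i * iota D i j) = 0"
  using assms unfolding splitting_def by blast+

lemma splitting_mirror: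
  assumes "splitting D S T"
  shows "splitting (mirror D) (\<lambda>i j. T j i) (\<lambda>r i. S i r)"
  unfolding splitting_def mirror_sel
proof (intro conjI allI impI)
  fix l i assume "l < dimT D" "i < dimT D"
  then show "(\<Sum>j<dimA D. beta D j l * S i j) + (\<Sum>r<dimK D. T r l * iota D i r) = (if l = i then 1 else 0)"
    using splittingD(1)[OF assms, of i l] by (simp add: mult.commute add.commute)
next
  fix r r' assume "r < dimK D" "r' < dimK D"
  then show "(\<Sum>i<dimT D. iota D i r * T r' i) = (if r = r' then 1 else 0)"
    using splittingD(3)[OF assms, of r' r] by (simp add: mult.commute)
next
  fix r r' assume "r < dimA D" "r' < dimA D"
  then show "(\<Sum>i<dimT D. S i r * beta D r' i) = (if r = r' then 1 else 0)"
    using splittingD(2)[OF assms, of r' r] by (simp add: mult.commute)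
next
  fix r j assume "r < dimK D" "j < dimA D"
  then show "(\<Sum>i<dimT D. iota D i r * beta D j i) = 0"
    using splittingD(4)[OF assms, of j r] by (simp add: mult.commute)
qed

text \<open>The trace of \<open>\<iota>T + S\<beta> = 1\<close>.\<close>

lemma splitting_dim:
  assumes "splitting D S T"
  shows "dimT D = dimK D + dimA D"
proof -
  have "int (dimT D) = (\<Sum>l<dimT D. (\<Sum>j<dimK D. iota D l j * T j l) + (\<Sum>r<dimA D. S l r * beta D r l))"
    using assms by (simp add: splitting_def)
  also have "\<dots> = (\<Sum>j<dimK D. \<Sum>l<dimT D. T j l * iota D l j) + (\<Sum>r<dimA D. \<Sum>l<dimT D. beta D r l * S l r)"
    by (simp add: sum.distrib sum.swap[of _ _ "{..<dimT D}"] mult.commute)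
  also have "\<dots> = int (dimK D) + int (dimA D)"
    using assms by (simp add: splitting_def)
  finally show ?thesis by linarith
qed

lemma card_compl_set:
  assumes "splitting D S T" "p \<subseteq> {..<dimT D}" "card p = dimA D"
  shows "card (compl_set D p) = dimK D"
  using assms splitting_dim[OF assms(1)] by (simp add: compl_set_def card_Diff_subset finite_subset)

text \<open>
  For an integral basis \<open>p\<close>, the rows of \<open>b\<close> are the dual basis of \<open>(\<beta>(e\<^sub>i))\<close>, \<open>i \<in> p\<close>, and those of \<open>e\<close>
  the dual basis of the rows of \<open>\<iota>\<close> outside \<open>p\<close>.
\<close>

definition dual_data :: "hypertoric \<Rightarrow> nat set \<Rightarrow> (nat \<Rightarrow> nat \<Rightarrow> int) \<Rightarrow> (nat \<Rightarrow> nat \<Rightarrow> int) \<Rightarrow>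
    (nat \<Rightarrow> nat \<Rightarrow> int) \<Rightarrow> bool" where
  "dual_data D p C b e \<longleftrightarrow>
     (\<forall>i\<in>p. \<forall>l<dimT D. (\<Sum>r<dimA D. b i r * beta D r l) = (if l \<in> p then if l = i then 1 else 0 else - C i l)) \<and>
     (\<forall>j\<in>compl_set D p. \<forall>l<dimT D. (\<Sum>a<dimK D. e j a * iota D l a) = (if l \<in> p then C l j else if l = j then 1 else 0)) \<and>
     (\<forall>j\<in>compl_set D p. \<forall>r<dimA D. beta D r j = - (\<Sum>i\<in>p. C i j * beta D r i)) \<and>
     (\<forall>i\<in>p. \<forall>a<dimK D. iota D i a = (\<Sum>j\<in>compl_set D p. C i j * iota D j a))"

lemma dual_dataD:
  assumes "dual_data D p C b e"
  shows "i \<in> p \<Longrightarrow> l < dimT D \<Longrightarrow>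
      (\<Sum>r<dimA D. b i r * beta D r l) = (if l \<in> p then if l = i then 1 else 0 else - C i l)"
    and "j \<in> compl_set D p \<Longrightarrow> l < dimT D \<Longrightarrow>
      (\<Sum>a<dimK D. e j a * iota D l a) = (if l \<in> p then C l j else if l = j then 1 else 0)"
    and "j \<in> compl_set D p \<Longrightarrow> r < dimA D \<Longrightarrow> beta D r j = - (\<Sum>i\<in>p. C i j * beta D r i)"
    and "i \<in> p \<Longrightarrow> a < dimK D \<Longrightarrow> iota D i a = (\<Sum>j\<in>compl_set D p. C i j * iota D j a)"
  using assms unfolding dual_data_def by blast+

lemma dual_data_mirror:
  assumes dd: "dual_data D p C b e" and p: "p \<subseteq> {..<dimT D}"
  shows "dual_data (mirror D) (compl_set D p) (\<lambda>j i. - C i j) e b"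
  unfolding dual_data_def mirror_sel compl_compl_set[OF p]
proof (intro conjI ballI allI impI)
  fix j l assume j: "j \<in> compl_set D p" and l: "l < dimT D"
  show "(\<Sum>r<dimK D. e j r * iota D l r) =
      (if l \<in> compl_set D p then if l = j then 1 else 0 else - (- C l j))"
    using dual_dataD(2)[OF dd j l] j l by (auto simp: compl_set_def)
next
  fix j l assume j: "j \<in> p" and l: "l < dimT D"
  show "(\<Sum>a<dimA D. b j a * beta D a l) =
      (if l \<in> compl_set D p then - C j l else if l = j then 1 else 0)"
    using dual_dataD(1)[OF dd j l] j l by (auto simp: compl_set_def)
next
  fix j r assume "j \<in> p" "r < dimK D"
  then show "iota D j r = - (\<Sum>i\<in>compl_set D p. - C j i * iota D i r)"
    using dual_dataD(4)[OF dd] by (simp add: sum_negf)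
next
  fix i a assume "i \<in> compl_set D p" "a < dimA D"
  then show "beta D a i = (\<Sum>j\<in>p. - C j i * beta D a j)"
    using dual_dataD(3)[OF dd] by (simp add: sum_negf)
qed

lemma dual_data_cong:
  assumes "dual_data D p C b e" "\<And>i j. i \<in> p \<Longrightarrow> j \<in> compl_set D p \<Longrightarrow> C i j = C' i j"
  shows "dual_data D p C' b e"
  using assms unfolding dual_data_def compl_set_def by auto

text \<open>Pairing the defining relation with the dual basis \<open>b\<close> reads off each
  coefficient, so the description inside \<open>coef\<close> has exactly one solution.\<close>

lemma coef_eq:
  assumes dd: "dual_data D p C b e" and p: "p \<subseteq> {..<dimT D}" and i: "i \<in> p" and j: "j \<in> compl_set D p"
  shows "coef D p i j = C i j"
proof -
  have fin: "finite p" using p finite_subset by blast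
  have "(THE c. (\<forall>l. l \<notin> p \<longrightarrow> c l = 0) \<and> (\<forall>r<dimA D. beta D r j = - (\<Sum>l\<in>p. c l * beta D r l))) =
      (\<lambda>l. if l \<in> p then C l j else 0)"
  proof (rule the_equality)
    show "(\<forall>l. l \<notin> p \<longrightarrow> (if l \<in> p then C l j else 0) = 0) \<and>
        (\<forall>r<dimA D. beta D r j = - (\<Sum>l\<in>p. (if l \<in> p then C l j else 0) * beta D r l))"
      using dual_dataD(3)[OF dd j] by simp
  next
    fix c :: "nat \<Rightarrow> int"
    assume c: "(\<forall>l. l \<notin> p \<longrightarrow> c l = 0) \<and> (\<forall>r<dimA D. beta D r j = - (\<Sum>l\<in>p. c l * beta D r l))"
    have "c l = C l j" if l: "l \<in> p" for l
    proof -
      have "- C l j = (\<Sum>r<dimA D. b l r * beta D r j)"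
        using dual_dataD(1)[OF dd l, of j] j by (simp add: compl_set_def)
      also have "\<dots> = - (\<Sum>r<dimA D. b l r * (\<Sum>i\<in>p. beta D r i * c i))"
        using c by (simp add: sum_negf mult.commute)
      also have "\<dots> = - (\<Sum>i\<in>p. (\<Sum>r<dimA D. b l r * beta D r i) * c i)"
        by (simp add: sum_sum_assoc)
      also have "\<dots> = - (\<Sum>i\<in>p. (if i = l then 1 else 0) * c i)"
        using dual_dataD(1)[OF dd l] p by (intro arg_cong[of _ _ uminus] sum.cong) auto
      finally show ?thesis using l fin by simp
    qed
    then show "c = (\<lambda>l. if l \<in> p then C l j else 0)" using c by auto
  qed
  then show ?thesis using i by (simp add: coef_def)
qed

text \<open>The value at the vertex \<open>p\<close> of the affine function that cuts out the
  hyperplane of \<open>j\<close>. Its sign decides between \<open>A_plus\<close> and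
  \<open>A_minus\<close>.\<close>

definition theta_wt :: "hypertoric \<Rightarrow> nat set \<Rightarrow> nat \<Rightarrow> int" where
  "theta_wt D p j = lift_theta D j + (\<Sum>i\<in>p. coef D p i j * lift_theta D i)"

text \<open>The \<open>\<sigma>\<close>-weight of \<open>x_i\<close> restricted to \<open>p\<close>.
  Its sign decides between \<open>p_plus\<close> and \<open>p_minus\<close>, and up to sign it is
  the mirror of \<open>theta_wt\<close>.\<close>

definition sigma_wt :: "hypertoric \<Rightarrow> nat set \<Rightarrow> nat \<Rightarrow> int" where
  "sigma_wt D p i = lift_sigma D i - (\<Sum>j\<in>compl_set D p. coef D p i j * lift_sigma D j)"

text \<open>The combinatorial content of the genericity and smoothness assumptions; it is self-mirror.\<close>

definition regular :: "hypertoric \<Rightarrow> bool" where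
  "regular D \<longleftrightarrow> (\<exists>S T. splitting D S T) \<and>
     (\<forall>p\<in>fixed_sets D. (\<exists>b e. dual_data D p (coef D p) b e) \<and>
        (\<forall>j\<in>compl_set D p. theta_wt D p j \<noteq> 0) \<and> (\<forall>i\<in>p. sigma_wt D p i \<noteq> 0)) \<and>
     (\<forall>r\<in>fixed_sets (mirror D). compl_set D r \<in> fixed_sets D)"

lemma mirror_wt:
  assumes dd: "dual_data D p (coef D p) b e" and p: "p \<subseteq> {..<dimT D}"
  shows "i \<in> p \<Longrightarrow> j \<in> compl_set D p \<Longrightarrow> coef (mirror D) (compl_set D p) j i = - coef D p i j"
    and "i \<in> p \<Longrightarrow> theta_wt (mirror D) (compl_set D p) i = - sigma_wt D p i"
    and "j \<in> compl_set D p \<Longrightarrow> sigma_wt (mirror D) (compl_set D p) j = - theta_wt D p j"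
proof -
  show *: "coef (mirror D) (compl_set D p) j i = - coef D p i j" if "i \<in> p" "j \<in> compl_set D p" for i j
    by (rule coef_eq[OF dual_data_mirror[OF dd p]])
       (use that p in \<open>auto simp: compl_compl_set compl_set_def\<close>)
  show "i \<in> p \<Longrightarrow> theta_wt (mirror D) (compl_set D p) i = - sigma_wt D p i"
    by (simp add: theta_wt_def sigma_wt_def *)
  show "j \<in> compl_set D p \<Longrightarrow> sigma_wt (mirror D) (compl_set D p) j = - theta_wt D p j"
    by (simp add: theta_wt_def sigma_wt_def compl_compl_set[OF p] * sum_negf)
qed

lemma pair_beta_flat:
  assumes dd: "dual_data D p C b e" and p: "p \<subseteq> {..<dimT D}" and x: "x \<in> flat D p" and j: "j \<in> compl_set D p"
  shows "pair_beta D x j = of_int (\<Sum>i\<in>p. C i j * lift_theta D i)"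
proof -
  have "pair_beta D x j = - (\<Sum>r<dimA D. x r * (\<Sum>i\<in>p. of_int (beta D r i) * of_int (C i j)))"
    unfolding pair_beta_def
    using dual_dataD(3)[OF dd j] by (simp add: sum_negf mult.commute)
  also have "\<dots> = - (\<Sum>i\<in>p. pair_beta D x i * of_int (C i j))"
    by (simp add: sum_sum_assoc pair_beta_def)
  also have "\<dots> = - (\<Sum>i\<in>p. - of_int (lift_theta D i) * of_int (C i j))"
    using x by (simp add: flat_def hplane_def)
  finally show ?thesis by (simp add: sum_negf mult.commute)
qed

text \<open>The dual basis gives the vertex in closed form. This is how complements of vertices are
  recognized as vertices of the mirror.\<close>

lemma flat_nonempty:
  assumes dd: "dual_data D p C b e" and p: "p \<subseteq> {..<dimT D}"
  shows "flat D p \<noteq> {}"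
proof -
  have fin: "finite p" using p finite_subset by blast
  define x :: "nat \<Rightarrow> real" where "x = (\<lambda>r. if r < dimA D then - of_int (\<Sum>i\<in>p. lift_theta D i * b i r) else 0)"
  have "pair_beta D x l = - of_int (lift_theta D l)" if l: "l \<in> p" for l
  proof -
    have "pair_beta D x l = of_int (- (\<Sum>r<dimA D. (\<Sum>i\<in>p. lift_theta D i * b i r) * beta D r l))"
      by (simp add: pair_beta_def x_def sum_negf)
    also have "(\<Sum>r<dimA D. (\<Sum>i\<in>p. lift_theta D i * b i r) * beta D r l) =
        (\<Sum>i\<in>p. lift_theta D i * (\<Sum>r<dimA D. b i r * beta D r l))"
      by (rule sum_sum_assoc[symmetric])
    also have "\<dots> = (\<Sum>i\<in>p. lift_theta D i * (if i = l then 1 else 0))"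
      using dual_dataD(1)[OF dd] l p by (intro sum.cong) auto
    finally show ?thesis using l fin by simp
  qed
  then have "x \<in> flat D p" by (auto simp: flat_def hplane_def dual_space_def x_def)
  then show ?thesis by blast
qed

lemma A_plus_minus_eq:
  assumes dd: "dual_data D p (coef D p) b e" and p: "p \<in> fixed_sets D"
  shows "A_plus D p = {j \<in> compl_set D p. theta_wt D p j \<ge> 0}"
    and "A_minus D p = {j \<in> compl_set D p. theta_wt D p j \<le> 0}"
proof -
  obtain x where x: "x \<in> flat D p" using fixed_setsD(4)[OF p] by blast
  have eq: "pair_beta D y j + of_int (lift_theta D j) = of_int (theta_wt D p j)"
    if "y \<in> flat D p" "j \<in> compl_set D p" for y j
    using pair_beta_flat[OF dd fixed_setsD(1)[OF p] that] by (simp add: theta_wt_def)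
  have "flat D p \<subseteq> hplus D j \<longleftrightarrow> theta_wt D p j \<ge> 0" if j: "j \<in> compl_set D p" for j
  proof -
    have "y \<in> hplus D j \<longleftrightarrow> theta_wt D p j \<ge> 0" if "y \<in> flat D p" for y
      using eq[OF that j] that by (auto simp: hplus_def flat_def)
    then show ?thesis using x by blast
  qed
  then show "A_plus D p = {j \<in> compl_set D p. theta_wt D p j \<ge> 0}" by (auto simp: A_plus_def)
  have "flat D p \<subseteq> hminus D j \<longleftrightarrow> theta_wt D p j \<le> 0" if j: "j \<in> compl_set D p" for j
  proof -
    have "y \<in> hminus D j \<longleftrightarrow> theta_wt D p j \<le> 0" if "y \<in> flat D p" for y
      using eq[OF that j] that by (auto simp: hminus_def flat_def)
    then show ?thesis using x by blast
  qed
  then show "A_minus D p = {j \<in> compl_set D p. theta_wt D p j \<le> 0}" by (auto simp: A_minus_def)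
qed

text \<open>The mirror vertex is again an instance, with \<open>S\<close> and \<open>T\<close>
  transposed and exchanged and \<open>b\<close> and \<open>e\<close> exchanged
  (\<open>mirror_vertex\<close>), so every fact proved here holds on the mirror as well.\<close>

locale regular_vertex =
  fixes D :: hypertoric and p :: "nat set" and S T b e :: "nat \<Rightarrow> nat \<Rightarrow> int"
  assumes reg: "regular D" and fixed: "p \<in> fixed_sets D"
    and split: "splitting D S T" and dual: "dual_data D p (coef D p) b e"
begin

lemmas sub = fixed_setsD(1)[OF fixed] and fin [simp] = fixed_setsD(2)[OF fixed]
lemmas dualD = dual_dataD[OF dual]

lemma theta_wt_nz: "j \<in> compl_set D p \<Longrightarrow> theta_wt D p j \<noteq> 0"
  and sigma_wt_nz: "i \<in> p \<Longrightarrow> sigma_wt D p i \<noteq> 0"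
  using reg fixed by (auto simp: regular_def)

lemma A_plus_eq: "A_plus D p = {j \<in> compl_set D p. theta_wt D p j > 0}"
  and A_minus_eq: "A_minus D p = {j \<in> compl_set D p. theta_wt D p j < 0}"
  unfolding A_plus_minus_eq[OF dual fixed] using theta_wt_nz by force+

lemma p_plus_eq: "p_plus D p = {i \<in> p. sigma_wt D p i > 0}"
  and p_minus_eq: "p_minus D p = {i \<in> p. sigma_wt D p i < 0}"
  by (auto simp: p_plus_def p_minus_def sigma_wt_def)

lemma A_decomp: "compl_set D p = A_plus D p \<union> A_minus D p" "A_plus D p \<inter> A_minus D p = {}"
  using theta_wt_nz by (force simp: A_plus_eq A_minus_eq)+

lemma p_decomp: "p = p_plus D p \<union> p_minus D p" "p_plus D p \<inter> p_minus D p = {}"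
  using sigma_wt_nz by (force simp: p_plus_eq p_minus_eq)+

lemma finite_parts [simp]: "finite (A_plus D p)" "finite (A_minus D p)" "finite (p_plus D p)" "finite (p_minus D p)"
  by (auto simp: A_plus_def A_minus_def p_plus_def p_minus_def)

lemma mirror_fixed: "compl_set D p \<in> fixed_sets (mirror D)"
  using flat_nonempty[OF dual_data_mirror[OF dual sub]] card_compl_set[OF split sub] fixed_setsD(3)[OF fixed]
  by (auto simp: fixed_sets_def compl_set_def)

lemma mirror_dual: "dual_data (mirror D) (compl_set D p) (coef (mirror D) (compl_set D p)) e b"
  by (rule dual_data_cong[OF dual_data_mirror[OF dual sub]])
     (auto simp: mirror_wt[OF dual sub] compl_compl_set[OF sub])

end

lemma regular_vertexE:
  assumes "regular D" "p \<in> fixed_sets D"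
  obtains S T b e where "regular_vertex D p S T b e"
proof -
  obtain S T where "splitting D S T" using assms(1) unfolding regular_def by blast
  moreover obtain b e where "dual_data D p (coef D p) b e" using assms unfolding regular_def by blast
  ultimately show ?thesis using that assms by (simp add: regular_vertex_def)
qed

lemma regular_mirror:
  assumes reg: "regular D"
  shows "regular (mirror D)"
  unfolding regular_def
proof (intro conjI ballI)
  obtain S T where "splitting D S T" using reg by (auto simp: regular_def)
  then show "\<exists>S T. splitting (mirror D) S T" using splitting_mirror by blast
next
  fix r assume r: "r \<in> fixed_sets (mirror D)"
  define p where "p = compl_set D r"
  have p: "p \<in> fixed_sets D" using reg r by (auto simp: regular_def p_def)
  have rp: "r = compl_set D p" using fixed_setsD(1)[OF r] by (simp add: p_def compl_compl_set)
  obtain S T b e where "regular_vertex D p S T b e" using regular_vertexE[OF reg p] .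
  then interpret regular_vertex D p S T b e .
  show "\<exists>b e. dual_data (mirror D) r (coef (mirror D) r) b e" using mirror_dual by (auto simp: rp)
  fix j
  show "theta_wt (mirror D) r j \<noteq> 0" if "j \<in> compl_set (mirror D) r"
    using that mirror_wt(2)[OF dual sub] sigma_wt_nz by (auto simp: rp compl_compl_set[OF sub])
  show "sigma_wt (mirror D) r j \<noteq> 0" if "j \<in> r"
    using that mirror_wt(3)[OF dual sub] theta_wt_nz by (auto simp: rp)
next
  fix r assume r: "r \<in> fixed_sets (mirror (mirror D))"
  then have "r \<in> fixed_sets D" by simp
  from regular_vertexE[OF reg this] obtain S T b e where "regular_vertex D r S T b e" .
  then interpret regular_vertex D r S T b e .
  show "compl_set (mirror D) r \<in> fixed_sets (mirror D)" using mirror_fixed by simp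
qed

context regular_vertex
begin

lemma mirror_vertex: "regular_vertex (mirror D) (compl_set D p) (\<lambda>i j. T j i) (\<lambda>r i. S i r) e b"
  by unfold_locales (use regular_mirror[OF reg] mirror_fixed splitting_mirror[OF split] mirror_dual in auto)

lemma mirror_parts:
  "A_plus (mirror D) (compl_set D p) = p_minus D p" "A_minus (mirror D) (compl_set D p) = p_plus D p"
  "p_plus (mirror D) (compl_set D p) = A_minus D p" "p_minus (mirror D) (compl_set D p) = A_plus D p"
proof -
  interpret m: regular_vertex "mirror D" "compl_set D p" "\<lambda>i j. T j i" "\<lambda>r i. S i r" e b
    by (rule mirror_vertex)
  note wt = mirror_wt[OF dual sub]
  show "A_plus (mirror D) (compl_set D p) = p_minus D p" "A_minus (mirror D) (compl_set D p) = p_plus D p"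
    unfolding m.A_plus_eq m.A_minus_eq p_plus_eq p_minus_eq mirror_sel compl_compl_set[OF sub]
    by (auto simp: wt)
  show "p_plus (mirror D) (compl_set D p) = A_minus D p" "p_minus (mirror D) (compl_set D p) = A_plus D p"
    unfolding m.p_plus_eq m.p_minus_eq A_plus_eq A_minus_eq by (auto simp: wt)
qed

text \<open>For \<open>i \<in> p\<close> row \<open>i\<close> of \<open>iota\<close> is the
  combination, with coefficients \<open>coef D p i j\<close>, of the rows outside \<open>p\<close>.
  The restricted roots obey the same relation (\<open>xres_eq\<close>), so membership in
  \<open>O_p\<close> need only be tested at \<open>j \<notin> p\<close>.\<close>

lemma xroot_eq:
  assumes i: "i \<in> p"
  shows "xroot D i P = P (Equiv i) - (\<Sum>j\<in>compl_set D p. of_int (coef D p i j) * P (Equiv j)) +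
    (\<Sum>j\<in>compl_set D p. of_int (coef D p i j) * xroot D j P)"
proof -
  have "(\<Sum>a<dimK D. of_int (iota D i a) * P (Gauge a)) =
      (\<Sum>a<dimK D. (\<Sum>j\<in>compl_set D p. of_int (coef D p i j) * of_int (iota D j a)) * P (Gauge a))"
    using dualD(4)[OF i] by simp
  also have "\<dots> = (\<Sum>j\<in>compl_set D p. of_int (coef D p i j) * (\<Sum>a<dimK D. of_int (iota D j a) * P (Gauge a)))"
    by (rule sum_sum_assoc[symmetric])
  finally have *: "(\<Sum>a<dimK D. of_int (iota D i a) * P (Gauge a)) =
      (\<Sum>j\<in>compl_set D p. of_int (coef D p i j) * (\<Sum>a<dimK D. of_int (iota D j a) * P (Gauge a)))" .
  show ?thesis unfolding xroot_def * distrib_left sum.distrib by simp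
qed

lemma xres_compl: "j \<in> A_plus D p \<Longrightarrow> xres D p j P = 0" "j \<in> A_minus D p \<Longrightarrow> xres D p j P = - P Hbar"
  using A_decomp by (auto simp: xres_def compl_set_def)

lemma xres_eq:
  assumes i: "i \<in> p"
  shows "xres D p i P = P (Equiv i) - (\<Sum>j\<in>compl_set D p. of_int (coef D p i j) * P (Equiv j)) +
    (\<Sum>j\<in>compl_set D p. of_int (coef D p i j) * xres D p j P)"
proof -
  have "(\<Sum>j\<in>compl_set D p. of_int (coef D p i j) * xres D p j P) =
      (\<Sum>j\<in>A_plus D p. of_int (coef D p i j) * xres D p j P) + (\<Sum>j\<in>A_minus D p. of_int (coef D p i j) * xres D p j P)"
    unfolding A_decomp(1) by (intro sum.union_disjoint) (auto simp: A_decomp(2))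
  also have "\<dots> = - (of_int (\<Sum>j\<in>A_minus D p. coef D p i j) * P Hbar)"
    by (simp add: xres_compl sum_negf sum_distrib_right)
  finally show ?thesis using i by (simp add: xres_def)
qed

lemma xroot_diff:
  assumes "i \<in> p"
  shows "xroot D i P - xres D p i P = (\<Sum>j\<in>compl_set D p. of_int (coef D p i j) * (xroot D j P - xres D p j P))"
  using xroot_eq[OF assms, of P] xres_eq[OF assms, of P]
  by (simp add: right_diff_distrib sum_subtractf)

lemma Ell_compI:
  assumes "P \<in> cspace (coords D)" "\<And>j. j \<in> compl_set D p \<Longrightarrow> xroot D j P - xres D p j P \<in> lat \<tau>"
  shows "P \<in> Ell_comp \<tau> D p"
  unfolding Ell_comp_def
proof (intro CollectI conjI allI impI assms(1))
  fix i assume "i < dimT D"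
  then show "xroot D i P - xres D p i P \<in> lat \<tau>"
    using assms(2) by (cases "i \<in> p") (auto simp: xroot_diff compl_set_def intro!: lat_sum lat_int_mult)
qed

text \<open>This is \<open>T iota = 1\<close>. Integrality of \<open>T\<close> makes Chern roots
  lattice elements as soon as their images under \<open>iota\<close> are.\<close>

lemma gauge_eq:
  fixes f :: "nat \<Rightarrow> complex"
  assumes "a < dimK D"
  shows "f a = (\<Sum>i<dimT D. of_int (T a i) * (\<Sum>a'<dimK D. of_int (iota D i a') * f a'))"
proof -
  have "(\<Sum>i<dimT D. of_int (T a i) * (\<Sum>a'<dimK D. of_int (iota D i a') * f a')) =
    (\<Sum>a'<dimK D. of_int (\<Sum>i<dimT D. T a i * iota D i a') * f a')"
    by (simp add: sum_sum_assoc)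
  also have "\<dots> = (\<Sum>a'<dimK D. (if a = a' then 1 else 0) * f a')"
    using split assms by (intro sum.cong) (auto simp: splitting_def)
  finally show ?thesis using assms by simp
qed

lemma gauge_lat:
  fixes f :: "nat \<Rightarrow> complex"
  assumes "\<And>i. i < dimT D \<Longrightarrow> (\<Sum>a<dimK D. of_int (iota D i a) * f a) \<in> lat \<tau>" "a < dimK D"
  shows "f a \<in> lat \<tau>"
  by (subst gauge_eq[OF assms(2)]) (auto intro!: lat_sum lat_int_mult assms)

text \<open>The dual basis \<open>e\<close> solves the equations at indices outside
  \<open>p\<close>; those at \<open>i \<in> p\<close> follow from \<open>xroot_eq\<close> and
  \<open>xres_eq\<close>. Uniqueness comes from \<open>gauge_eq\<close>.\<close>

lemma lift_point:
  "lift_point D p P \<in> cspace (coords D)" "lift_point D p P Hbar = P Hbar"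
  "i < dimT D \<Longrightarrow> lift_point D p P (Equiv i) = P (Equiv i)"
  "i < dimT D \<Longrightarrow> lift_point D p P (Kahler i) = P (Kahler i)"
  "i < dimT D \<Longrightarrow> xroot D i (lift_point D p P) = xres D p i P"
proof -
  let ?G = "\<lambda>a. \<Sum>j\<in>compl_set D p. (xres D p j P - P (Equiv j)) * of_int (e j a)"
  define Q where "Q = (\<lambda>c. case c of Gauge a \<Rightarrow> if a < dimK D then ?G a else 0 | Hbar \<Rightarrow> P Hbar
    | Equiv i \<Rightarrow> if i < dimT D then P (Equiv i) else 0 | Kahler i \<Rightarrow> if i < dimT D then P (Kahler i) else 0)"
  let ?R = "\<lambda>Q. Q \<in> cspace (coords D) \<and> Q Hbar = P Hbar \<and>
     (\<forall>i<dimT D. Q (Equiv i) = P (Equiv i) \<and> Q (Kahler i) = P (Kahler i) \<and> xroot D i Q = xres D p i P)"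
  have xr: "xroot D l Q = xres D p l P" if l: "l \<in> compl_set D p" for l
  proof -
    have "(\<Sum>a<dimK D. of_int (iota D l a) * Q (Gauge a)) =
        (\<Sum>a<dimK D. ?G a * of_int (iota D l a))"
      by (simp add: Q_def mult.commute)
    also have "\<dots> = (\<Sum>j\<in>compl_set D p. (xres D p j P - P (Equiv j)) * (\<Sum>a<dimK D. of_int (e j a) * of_int (iota D l a)))"
      by (rule sum_sum_assoc[symmetric])
    also have "\<dots> = (\<Sum>j\<in>compl_set D p. (xres D p j P - P (Equiv j)) * of_int (\<Sum>a<dimK D. e j a * iota D l a))"
      by simp
    also have "\<dots> = (\<Sum>j\<in>compl_set D p. (xres D p j P - P (Equiv j)) * (if l = j then 1 else 0))"
      using dualD(2) l by (intro sum.cong) (auto simp: compl_set_def)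
    finally show ?thesis using l by (simp add: xroot_def Q_def compl_set_def)
  qed
  have QE: "Q (Equiv i) = P (Equiv i)" if "i < dimT D" for i using that by (simp add: Q_def)
  have "xroot D l Q = xres D p l P" if "l < dimT D" for l
  proof (cases "l \<in> p")
    case True
    then show ?thesis
      unfolding xroot_eq[OF True] xres_eq[OF True] using that by (simp add: xr QE compl_set_def)
  qed (use that xr in \<open>auto simp: compl_set_def\<close>)
  then have RQ: "?R Q"
    by (auto simp: Q_def cspace_def coords_def split: coord.splits)
  moreover have "R = Q" if R: "?R R" for R
  proof (rule ext)
    fix c
    have cs: "R \<in> cspace (coords D)" "Q \<in> cspace (coords D)" using R RQ by blast+
    consider a where "c = Gauge a" "a < dimK D" | "c \<in> coords D - Gauge ` {..<dimK D}" | "c \<notin> coords D"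
      by (auto simp: coords_def)
    then show "R c = Q c"
    proof cases
      case (1 a)
      have "(\<Sum>a<dimK D. of_int (iota D i a) * R (Gauge a)) = (\<Sum>a<dimK D. of_int (iota D i a) * Q (Gauge a))"
        if "i < dimT D" for i
        using R RQ that by (metis (no_types, lifting) add_left_cancel xroot_def)
      then show ?thesis
        using gauge_eq[OF 1(2), of "\<lambda>a. R (Gauge a)"] gauge_eq[OF 1(2), of "\<lambda>a. Q (Gauge a)"] 1(1) by simp
    next
      case 2
      then have "c = Hbar \<or> (\<exists>i<dimT D. c = Equiv i \<or> c = Kahler i)" by (auto simp: coords_def)
      then show ?thesis using R RQ by metis
    next
      case 3
      then show ?thesis using cs cspace_outside by metis
    qed
  qed
  ultimately have eq: "lift_point D p P = Q"
    unfolding lift_point_def by (rule the_equality)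
  show "lift_point D p P \<in> cspace (coords D)" "lift_point D p P Hbar = P Hbar"
    "i < dimT D \<Longrightarrow> lift_point D p P (Equiv i) = P (Equiv i)"
    "i < dimT D \<Longrightarrow> lift_point D p P (Kahler i) = P (Kahler i)"
    "i < dimT D \<Longrightarrow> xroot D i (lift_point D p P) = xres D p i P"
    unfolding eq using RQ by blast+
qed

end

section \<open>Semistable points and stabilizers\<close>

lemma poly_fun_power: "poly_fun n f \<Longrightarrow> poly_fun n (\<lambda>v. f v ^ m)"
  by (induction m) (auto intro: poly_fun.intros)

lemma poly_fun_prod: "(\<And>i. i \<in> A \<Longrightarrow> poly_fun n (f i)) \<Longrightarrow> poly_fun n (\<lambda>v. \<Prod>i\<in>A. f i v)"
  by (induction A rule: infinite_finite_induct) (auto intro: poly_fun.intros)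

text \<open>A negative power of \<open>z_i\<close> is replaced by a positive power of
  \<open>w_i\<close>, which has the inverse weight under the gauge torus and under
  \<open>\<sigma>\<close>. Every integral exponent vector thus gives a polynomial.\<close>

definition weight_monom :: "hypertoric \<Rightarrow> (nat \<Rightarrow> int) \<Rightarrow> phase \<Rightarrow> complex" where
  "weight_monom D N v = (\<Prod>i<dimT D. if N i \<ge> 0 then fst v i ^ nat (N i) else snd v i ^ nat (- N i))"

lemma poly_fun_weight_monom: "poly_fun (dimT D) (weight_monom D N)"
proof -
  have "poly_fun (dimT D) (\<lambda>v. if N i \<ge> 0 then fst v i ^ nat (N i) else snd v i ^ nat (- N i))" if "i < dimT D" for i
    using that by (cases "N i \<ge> 0") (auto intro!: poly_fun_power poly_fun.intros)
  then have "poly_fun (dimT D) (\<lambda>v. weight_monom D N v)"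
    unfolding weight_monom_def by (intro poly_fun_prod) auto
  then show ?thesis .
qed

lemma weight_monom_nonzero_iff:
  "weight_monom D N v \<noteq> 0 \<longleftrightarrow> (\<forall>i<dimT D. (N i > 0 \<longrightarrow> fst v i \<noteq> 0) \<and> (N i < 0 \<longrightarrow> snd v i \<noteq> 0))"
proof -
  have "(if N i \<ge> 0 then fst v i ^ nat (N i) else snd v i ^ nat (- N i)) \<noteq> 0 \<longleftrightarrow>
      (N i > 0 \<longrightarrow> fst v i \<noteq> 0) \<and> (N i < 0 \<longrightarrow> snd v i \<noteq> 0)" for i
    by auto
  then show ?thesis unfolding weight_monom_def prod_zero_iff[OF finite_lessThan] by blast
qed

lemma weight_monom_scale:
  assumes c: "\<And>i. i < dimT D \<Longrightarrow> c i \<noteq> 0"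
  shows "weight_monom D N (\<lambda>i. c i * fst v i, \<lambda>i. inverse (c i) * snd v i) = (\<Prod>i<dimT D. c i powi N i) * weight_monom D N v"
  unfolding weight_monom_def prod.distrib[symmetric]
  by (intro prod.cong)
     (auto simp: power_mult_distrib power_int_def power_inverse)

lemma char_K_nonzero: "s \<in> torus (dimK D) \<Longrightarrow> char_K D i s \<noteq> 0"
  by (auto simp: char_K_def torus_def)

lemma prod_power_int:
  fixes f :: "'a \<Rightarrow> complex"
  shows "(\<Prod>a\<in>A. f a) powi m = (\<Prod>a\<in>A. f a powi m)"
  by (induction A rule: infinite_finite_induct) (auto simp: power_int_mult_distrib)

lemma prod_powi_sum:
  fixes s :: "'a \<Rightarrow> complex"
  assumes "\<And>a. a \<in> B \<Longrightarrow> s a \<noteq> 0"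
  shows "(\<Prod>i\<in>A. (\<Prod>a\<in>B. s a powi m i a) powi N i) = (\<Prod>a\<in>B. s a powi (\<Sum>i\<in>A. m i a * N i))"
proof (induction A rule: infinite_finite_induct)
  case (insert i A)
  have "(\<Prod>a\<in>B. s a powi m i a) powi N i = (\<Prod>a\<in>B. s a powi (m i a * N i))"
    by (simp add: prod_power_int power_int_mult)
  then show ?case
    using insert assms by (simp add: power_int_add flip: prod.distrib)
qed auto

lemma weight_monom_gauge:
  assumes "s \<in> torus (dimK D)"
  shows "weight_monom D N (gauge_act D s v) = (\<Prod>a<dimK D. s a powi (\<Sum>i<dimT D. iota D i a * N i)) * weight_monom D N v"
proof -
  have "weight_monom D N (gauge_act D s v) = (\<Prod>i<dimT D. char_K D i s powi N i) * weight_monom D N v"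
    unfolding gauge_act_def by (rule weight_monom_scale) (rule char_K_nonzero[OF assms])
  also have "(\<Prod>i<dimT D. char_K D i s powi N i) = (\<Prod>a<dimK D. s a powi (\<Sum>i<dimT D. iota D i a * N i))"
    unfolding char_K_def by (rule prod_powi_sum) (use assms in \<open>auto simp: torus_def\<close>)
  finally show ?thesis .
qed

lemma semistable_weight_monom:
  assumes v: "v \<in> moment_zero D" and m: "m \<ge> 1"
    and N: "\<And>a. a < dimK D \<Longrightarrow> (\<Sum>i<dimT D. iota D i a * N i) = int m * (\<Sum>i<dimT D. iota D i a * lift_theta D i)"
    and nz: "weight_monom D N v \<noteq> 0"
  shows "v \<in> semistable D"
proof -
  have "weight_monom D N (gauge_act D s u) = theta_char D s ^ m * weight_monom D N u" if "s \<in> torus (dimK D)" for s u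
    unfolding weight_monom_gauge[OF that] theta_char_def
    using N by (simp add: power_int_power' mult.commute prod_power_distrib)
  then show ?thesis
    unfolding semistable_def using v m nz poly_fun_weight_monom by blast
qed

definition ind_point :: "nat set \<Rightarrow> nat set \<Rightarrow> phase" where
  "ind_point A B = ((\<lambda>i. if i \<in> A then 1 else 0), (\<lambda>i. if i \<in> B then 1 else 0))"

lemma ind_point_sel [simp]:
  "fst (ind_point A B) i = (if i \<in> A then 1 else 0)" "snd (ind_point A B) i = (if i \<in> B then 1 else 0)"
  by (simp_all add: ind_point_def)

lemma ind_point_moment_zero:
  assumes "A \<subseteq> {..<dimT D}" "B \<subseteq> {..<dimT D}" "A \<inter> B = {}"
  shows "ind_point A B \<in> moment_zero D"
  using assms by (auto simp: moment_zero_def intro!: sum.neutral)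

text \<open>A \<open>\<rat>\<close>-linear retraction of the reals onto the rationals maps a real solution to a rational one.\<close>

lemma rational_retraction:
  "\<exists>\<phi> :: real \<Rightarrow> rat. \<phi> 1 = 1 \<and> (\<forall>x y. \<phi> (x + y) = \<phi> x + \<phi> y) \<and> (\<forall>a x. \<phi> (of_int a * x) = of_int a * \<phi> x)"
proof -
  interpret rr: vector_space_pair "\<lambda>q x. of_rat q * x :: real" "(*) :: rat \<Rightarrow> rat \<Rightarrow> rat"
    by unfold_locales (auto simp: algebra_simps of_rat_add of_rat_mult)
  have "rr.vs1.independent {1}"
    by (simp add: rr.vs1.independent_insert rr.vs1.independent_empty rr.vs1.span_empty)
  from rr.linear_independent_extend[OF this, of "\<lambda>_. 1"] obtain g
    where g: "Vector_Spaces.linear (\<lambda>q x. of_rat q * x :: real) ((*) :: rat \<Rightarrow> rat \<Rightarrow> rat) g" "g 1 = 1" by auto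
  interpret g: Vector_Spaces.linear "\<lambda>q x. of_rat q * x :: real" "(*) :: rat \<Rightarrow> rat \<Rightarrow> rat" g by (rule g)
  have "g (of_int a * x) = of_int a * g x" for a x using g.scale[of "of_int a" x] by simp
  then show ?thesis using g.add g(2) by blast
qed

text \<open>A vertex is only a real point, while semi-invariant monomials have integral exponents.
  The retraction makes the solution rational and \<open>M\<close> clears its denominators.\<close>

lemma int_system_scale:
  fixes x :: "nat \<Rightarrow> real" and B :: "nat \<Rightarrow> nat \<Rightarrow> int" and t :: "nat \<Rightarrow> int"
  assumes x: "\<And>i. i \<in> p \<Longrightarrow> (\<Sum>r<d. x r * of_int (B r i)) = of_int (t i)"
  shows "\<exists>m y. m \<ge> (1::nat) \<and> (\<forall>i\<in>p. (\<Sum>r<d. y r * B r i) = int m * t i)"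
proof -
  obtain \<phi> :: "real \<Rightarrow> rat" where \<phi>: "\<phi> 1 = 1" "\<And>x y. \<phi> (x + y) = \<phi> x + \<phi> y"
      "\<And>a x. \<phi> (of_int a * x) = of_int a * \<phi> x"
    using rational_retraction by blast
  have \<phi>0: "\<phi> 0 = 0" using \<phi>(2)[of 0 0] by simp
  have sum: "\<phi> (sum f A) = (\<Sum>a\<in>A. \<phi> (f a))" for f and A :: "nat set"
    by (induction A rule: infinite_finite_induct) (auto simp: \<phi> \<phi>0)
  have q: "(\<Sum>r<d. \<phi> (x r) * of_int (B r i)) = of_int (t i)" if "i \<in> p" for i
  proof -
    have "(\<Sum>r<d. \<phi> (x r) * of_int (B r i)) = \<phi> (\<Sum>r<d. x r * of_int (B r i))"
      unfolding sum by (intro sum.cong refl) (metis \<phi>(3) mult.commute)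
    also have "\<dots> = of_int (t i)" unfolding x[OF that] using \<phi>(3)[of "t i" 1] \<phi>(1) by simp
    finally show ?thesis .
  qed
  define den where "den r = snd (quotient_of (\<phi> (x r)))" for r
  define num where "num r = fst (quotient_of (\<phi> (x r)))" for r
  have den: "den r > 0" and frac: "\<phi> (x r) = of_int (num r) / of_int (den r)" for r
    using quotient_of_denom_pos'[of "\<phi> (x r)"] quotient_of_div[of "\<phi> (x r)" "num r" "den r"]
    by (auto simp: den_def num_def)
  define M where "M = (\<Prod>r<d. den r)"
  have M: "M > 0" unfolding M_def using den by (intro prod_pos) auto
  define y where "y r = num r * (\<Prod>r'\<in>{..<d} - {r}. den r')" for r
  have y: "of_int (y r) = of_int M * \<phi> (x r)" if "r < d" for r
  proof -
    have "M = den r * (\<Prod>r'\<in>{..<d} - {r}. den r')"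
      unfolding M_def using that by (intro prod.remove) auto
    then show ?thesis using den[of r] by (simp add: y_def frac)
  qed
  have "(\<Sum>r<d. y r * B r i) = M * t i" if "i \<in> p" for i
  proof -
    have "of_int (\<Sum>r<d. y r * B r i) = (\<Sum>r<d. of_int M * \<phi> (x r) * of_int (B r i))"
      by (simp add: y)
    also have "\<dots> = of_int M * (\<Sum>r<d. \<phi> (x r) * of_int (B r i))"
      by (simp add: sum_distrib_left mult.assoc)
    also have "\<dots> = of_int (M * t i)" by (simp add: q[OF that])
    finally show ?thesis by (simp only: of_int_eq_iff)
  qed
  then show ?thesis using M by (intro exI[of _ "nat M"] exI[of _ y]) auto
qed

text \<open>An injective square system is solvable, by Gaussian elimination: row \<open>j0\<close>
  is the pivot for column \<open>a0\<close>, and \<open>m'\<close> is the remaining system.\<close>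

lemma square_system_solvable:
  fixes m :: "nat \<Rightarrow> nat \<Rightarrow> complex"
  assumes "finite A" "finite J" "card J = card A"
    and "\<And>c. (\<And>j. j \<in> J \<Longrightarrow> (\<Sum>a\<in>A. m j a * c a) = 0) \<Longrightarrow> \<forall>a\<in>A. c a = 0"
  shows "\<exists>y. \<forall>j\<in>J. (\<Sum>a\<in>A. m j a * y a) = t j"
  using assms
proof (induction A arbitrary: J m t rule: finite_induct)
  case empty
  then show ?case by simp
next
  case (insert a0 A)
  have "\<exists>j0\<in>J. m j0 a0 \<noteq> 0"
  proof (rule ccontr)
    assume "\<not> ?thesis"
    then have "\<forall>a\<in>insert a0 A. (\<lambda>a. if a = a0 then 1 else 0 :: complex) a = 0"
      using insert.hyps by (intro insert.prems(3)) (auto intro!: sum.neutral)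
    then show False by auto
  qed
  then obtain j0 where j0: "j0 \<in> J" "m j0 a0 \<noteq> 0" by blast
  define m' where "m' j a = m j a - m j a0 * m j0 a / m j0 a0" for j a
  have expand: "(\<Sum>a\<in>A. m' j a * c a) = (\<Sum>a\<in>A. m j a * c a) - m j a0 / m j0 a0 * (\<Sum>a\<in>A. m j0 a * c a)" for j c
  proof -
    have "(\<Sum>a\<in>A. m' j a * c a) = (\<Sum>a\<in>A. m j a * c a - m j a0 / m j0 a0 * (m j0 a * c a))"
      by (intro sum.cong) (auto simp: m'_def left_diff_distrib)
    then show ?thesis by (simp add: sum_subtractf sum_distrib_left)
  qed
  have "\<exists>y. \<forall>j\<in>J - {j0}. (\<Sum>a\<in>A. m' j a * y a) = t j - m j a0 / m j0 a0 * t j0"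
  proof (rule insert.IH)
    show "finite (J - {j0})" "card (J - {j0}) = card A" using insert j0 by auto
    fix c :: "nat \<Rightarrow> complex" assume c: "\<And>j. j \<in> J - {j0} \<Longrightarrow> (\<Sum>a\<in>A. m' j a * c a) = 0"
    define c' where "c' = c(a0 := - (\<Sum>a\<in>A. m j0 a * c a) / m j0 a0)"
    have c': "(\<Sum>a\<in>A. f a * c' a) = (\<Sum>a\<in>A. f a * c a)" for f
      using insert.hyps by (intro sum.cong) (auto simp: c'_def)
    have "\<forall>a\<in>insert a0 A. c' a = 0"
    proof (rule insert.prems(3))
      fix j assume j: "j \<in> J"
      show "(\<Sum>a\<in>insert a0 A. m j a * c' a) = 0"
      proof (cases "j = j0")
        case True
        then show ?thesis using insert.hyps j0 by (simp add: c') (simp add: c'_def)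
      next
        case False
        then have "(\<Sum>a\<in>A. m j a * c a) = m j a0 / m j0 a0 * (\<Sum>a\<in>A. m j0 a * c a)"
          using c[of j] j by (simp add: expand)
        then show ?thesis using insert.hyps by (simp add: c') (simp add: c'_def)
      qed
    qed
    then show "\<forall>a\<in>A. c a = 0" using insert.hyps by (auto simp: c'_def split: if_splits)
  qed
  then obtain y where y: "\<And>j. j \<in> J - {j0} \<Longrightarrow> (\<Sum>a\<in>A. m' j a * y a) = t j - m j a0 / m j0 a0 * t j0" by blast
  define y' where "y' = y(a0 := (t j0 - (\<Sum>a\<in>A. m j0 a * y a)) / m j0 a0)"
  have y': "(\<Sum>a\<in>A. f a * y' a) = (\<Sum>a\<in>A. f a * y a)" for f
    using insert.hyps by (intro sum.cong) (auto simp: y'_def)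
  have "(\<Sum>a\<in>insert a0 A. m j a * y' a) = t j" if j: "j \<in> J" for j
  proof (cases "j = j0")
    case True
    then show ?thesis using insert.hyps j0 by (simp add: y') (simp add: y'_def)
  next
    case False
    then have "(\<Sum>a\<in>A. m j a * y a) = t j - m j a0 / m j0 a0 * t j0 + m j a0 / m j0 a0 * (\<Sum>a\<in>A. m j0 a * y a)"
      using y[of j] j unfolding expand by (simp add: algebra_simps)
    then show ?thesis using insert.hyps by (simp add: y') (simp add: y'_def right_diff_distrib diff_divide_distrib)
  qed
  then show ?case by blast
qed

section \<open>Vertices are integral bases\<close>

definition exp_torus :: "nat \<Rightarrow> (nat \<Rightarrow> complex) \<Rightarrow> nat \<Rightarrow> complex" where
  "exp_torus k y = (\<lambda>a. if a < k then exp (2 * of_real pi * \<i> * y a) else 1)"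

lemma exp_torus_in: "exp_torus k y \<in> torus k"
  by (simp add: exp_torus_def torus_def)

lemma char_K_exp_torus:
  "char_K D i (exp_torus (dimK D) y) = exp (2 * of_real pi * \<i> * (\<Sum>a<dimK D. of_int (iota D i a) * y a))"
  unfolding char_K_def exp_torus_def sum_distrib_left exp_sum[OF finite_lessThan]
  by (intro prod.cong refl) (simp add: exp_power_int mult_ac)

lemma exp_two_pi_i_eq_1: "exp (2 * of_real pi * \<i> * z) = 1 \<longleftrightarrow> z \<in> \<int>"
proof
  assume "exp (2 * of_real pi * \<i> * z) = 1"
  then obtain n where "Im z = 0" "Re z = of_int n" by (auto simp: exp_eq_1)
  then have "z = of_int n" by (simp add: complex_eq_iff)
  then show "z \<in> \<int>" by simp
next
  assume "z \<in> \<int>"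
  then obtain n where "z = of_int n" by (auto simp: Ints_def)
  then show "exp (2 * of_real pi * \<i> * z) = 1" using exp_integer_2pi[of "of_int n"] by (simp add: mult_ac)
qed

text \<open>If \<open>iota y\<close> is integral at every index where \<open>v\<close> is nonzero,
  then \<open>exp (2 \<pi> i y)\<close> stabilizes \<open>v\<close>, so \<open>y\<close> is integral
  (\<open>int\<close>). Hence the square matrix of rows of \<open>iota\<close> outside
  \<open>p\<close> is injective and its inverse \<open>e\<close> is integral. The coefficients
  \<open>C\<close> and the dual basis \<open>b\<close> on the other side of the sequence are then
  computed from \<open>e\<close>.\<close>

lemma dual_data_if_trivial_stabilizer:
  assumes split: "splitting D S T" and p: "p \<subseteq> {..<dimT D}" "card p = dimA D"
    and stab: "stabilizer D v = {\<lambda>_. 1}" and supp: "\<And>i. i \<in> p \<Longrightarrow> fst v i = 0 \<and> snd v i = 0"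
    and v: "v \<in> moment_zero D"
  shows "\<exists>b e. dual_data D p (coef D p) b e"
    and "j \<in> compl_set D p \<Longrightarrow> fst v j \<noteq> 0 \<or> snd v j \<noteq> 0"
proof -
  define J where "J = compl_set D p"
  have finJ: "finite J" and cardJ: "card J = card {..<dimK D}"
    using card_compl_set[OF split p] by (auto simp: J_def)
  have int: "y a \<in> \<int>" if y: "\<And>l. l \<in> J \<Longrightarrow> fst v l \<noteq> 0 \<or> snd v l \<noteq> 0 \<Longrightarrow> (\<Sum>a<dimK D. of_int (iota D l a) * y a) \<in> \<int>"
    and a: "a < dimK D" for y :: "nat \<Rightarrow> complex" and a
  proof -
    have "char_K D l (exp_torus (dimK D) y) = 1" if "l < dimT D" "fst v l \<noteq> 0 \<or> snd v l \<noteq> 0" for l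
    proof -
      have "l \<in> J" using that supp by (auto simp: J_def compl_set_def)
      then show ?thesis using y that by (simp add: char_K_exp_torus exp_two_pi_i_eq_1)
    qed
    moreover have "fst v l = 0" "snd v l = 0" if "\<not> l < dimT D" for l using v that by (auto simp: moment_zero_def)
    ultimately have "gauge_act D (exp_torus (dimK D) y) v = v"
      unfolding gauge_act_def by (auto simp: prod_eq_iff fun_eq_iff)
    then have "exp_torus (dimK D) y \<in> stabilizer D v" by (simp add: stabilizer_def exp_torus_in)
    then have "exp_torus (dimK D) y a = 1" using stab by simp
    then show ?thesis using a by (simp add: exp_torus_def exp_two_pi_i_eq_1)
  qed
  have half: "(1 / 2 :: complex) \<notin> \<int>"
  proof
    assume "(1 / 2 :: complex) \<in> \<int>"
    then obtain n where "(1 / 2 :: complex) = of_int n" by (auto simp: Ints_def)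
    then have "of_int (2 * n) = (of_int 1 :: complex)" by (simp add: field_simps)
    then have "2 * n = 1" unfolding of_int_eq_iff .
    then show False by presburger
  qed
  have ker: "\<forall>a\<in>{..<dimK D}. c a = 0"
    if c: "\<And>j. j \<in> J \<Longrightarrow> (\<Sum>a<dimK D. of_int (iota D j a) * c a) = 0" for c :: "nat \<Rightarrow> complex"
  proof (rule ccontr)
    assume "\<not> ?thesis"
    then obtain a where a: "a < dimK D" "c a \<noteq> 0" by auto
    \<comment> \<open>Rescaling the kernel vector so that its coordinate \<open>a\<close> becomes
      \<open>1/2\<close> keeps it in the kernel but makes it non-integral.\<close>
    have "(\<Sum>a'<dimK D. of_int (iota D l a') * (c a' * (1 / (2 * c a)))) \<in> \<int>" if "l \<in> J" for l
      unfolding mult.assoc[symmetric] sum_distrib_right[symmetric] c[OF that] by simp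
    then have "c a * (1 / (2 * c a)) \<in> \<int>" using int[of "\<lambda>a'. c a' * (1 / (2 * c a))" a] a by blast
    then show False using half a by simp
  qed
  have "\<exists>y. \<forall>l\<in>J. (\<Sum>a<dimK D. of_int (iota D l a) * y a) = (if l = j then 1 else 0 :: complex)" for j
    by (rule square_system_solvable) (use finJ cardJ ker in auto)
  then obtain y where y: "\<And>j l. l \<in> J \<Longrightarrow> (\<Sum>a<dimK D. of_int (iota D l a) * y j a) = (if l = j then 1 else 0 :: complex)"
    by metis
  have yint: "y j a \<in> \<int>" if "a < dimK D" for j a
    by (rule int) (use y that in auto)
  show "fst v j \<noteq> 0 \<or> snd v j \<noteq> 0" if j: "j \<in> compl_set D p" for j
  proof (rule ccontr)
    assume z: "\<not> ?thesis"
    \<comment> \<open>If \<open>v\<close> vanishes at \<open>j\<close>, nothing is demanded at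
      \<open>j\<close>, so half of \<open>y j\<close> satisfies the hypothesis of
      \<open>int\<close>, although row \<open>j\<close> of \<open>iota\<close> pairs with it to
      \<open>1/2\<close>.\<close>
    have "y j a / 2 \<in> \<int>" if "a < dimK D" for a
    proof (rule int[OF _ that])
      fix l assume "l \<in> J" "fst v l \<noteq> 0 \<or> snd v l \<noteq> 0"
      then show "(\<Sum>a<dimK D. of_int (iota D l a) * (y j a / 2)) \<in> \<int>"
        using y[of l j] z by (auto simp: sum_divide_distrib[symmetric])
    qed
    then have "(\<Sum>a<dimK D. of_int (iota D j a) * (y j a / 2)) \<in> \<int>" by (intro Ints_sum Ints_mult) auto
    then show False using y[of j j] j half by (simp add: J_def flip: sum_divide_distrib)
  qed
  have "\<forall>j a. \<exists>z. a < dimK D \<longrightarrow> y j a = of_int z" using yint by (auto simp: Ints_def)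
  then obtain e where e: "\<And>j a. a < dimK D \<Longrightarrow> y j a = of_int (e j a)" by metis
  have IE: "(\<Sum>a<dimK D. iota D l a * e j a) = (if l = j then 1 else 0)" if "l \<in> J" for l j
  proof -
    have "(of_int (\<Sum>a<dimK D. iota D l a * e j a) :: complex) = of_int (if l = j then 1 else 0)"
      using y[OF that, of j] by (simp add: e)
    then show ?thesis unfolding of_int_eq_iff .
  qed
  have EI: "(\<Sum>j\<in>J. e j a * iota D j a') = (if a = a' then 1 else 0)" if a: "a < dimK D" "a' < dimK D" for a a'
  proof -
    have "(\<Sum>a<dimK D. iota D l a * ((\<Sum>j\<in>J. e j a * iota D j a') - (if a = a' then 1 else 0))) = 0" if l: "l \<in> J" for l
    proof -
      have "(\<Sum>a<dimK D. iota D l a * (\<Sum>j\<in>J. e j a * iota D j a')) = (\<Sum>j\<in>J. (\<Sum>a<dimK D. iota D l a * e j a) * iota D j a')"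
        by (rule sum_sum_assoc)
      also have "\<dots> = iota D l a'" using l finJ by (simp add: IE)
      finally show ?thesis using a by (simp add: right_diff_distrib sum_subtractf)
    qed
    then have "(\<Sum>a<dimK D. of_int (iota D l a) * (of_int ((\<Sum>j\<in>J. e j a * iota D j a') - (if a = a' then 1 else 0)) :: complex)) = 0"
      if "l \<in> J" for l
      using that unfolding of_int_mult[symmetric] of_int_sum[symmetric] by simp
    from ker[OF this] a show ?thesis by (simp only: of_int_eq_0_iff lessThan_iff Ball_def right_minus_eq)
  qed
  define C where "C i j = (\<Sum>a<dimK D. iota D i a * e j a)" for i j
  have row: "iota D i a = (\<Sum>j\<in>J. C i j * iota D j a)" if a: "a < dimK D" for i a
  proof -
    have "(\<Sum>j\<in>J. C i j * iota D j a) = (\<Sum>a'<dimK D. iota D i a' * (\<Sum>j\<in>J. e j a' * iota D j a))"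
      unfolding C_def by (rule sum_sum_assoc[symmetric])
    also have "\<dots> = iota D i a" using a by (simp add: EI)
    finally show ?thesis ..
  qed
  have col: "beta D r j = - (\<Sum>i\<in>p. C i j * beta D r i)" if j: "j \<in> J" and r: "r < dimA D" for r j
  proof -
    have "(\<Sum>l<dimT D. beta D r l * C l j) = (\<Sum>a<dimK D. (\<Sum>l<dimT D. beta D r l * iota D l a) * e j a)"
      unfolding C_def by (rule sum_sum_assoc)
    also have "\<dots> = 0" using splittingD(4)[OF split r] by simp
    finally have "(\<Sum>l\<in>p. beta D r l * C l j) + (\<Sum>l\<in>J. beta D r l * C l j) = 0"
      by (simp add: sum_split_compl[OF p(1)] J_def)
    moreover have "(\<Sum>l\<in>J. beta D r l * C l j) = beta D r j"
      using IE j finJ by (simp add: C_def)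
    ultimately show ?thesis by (simp add: mult.commute)
  qed
  \<comment> \<open>The covector \<open>u i\<close> annihilates the image of \<open>iota\<close>,
    hence factors through \<open>beta\<close>, and the section \<open>S\<close> provides the factor
    \<open>b i\<close>.\<close>
  define u where "u i l = (if l \<in> p then if l = i then 1 else 0 else - C i l)" for i l
  define b where "b i r = (\<Sum>l<dimT D. u i l * S l r)" for i r
  have dual1: "(\<Sum>r<dimA D. b i r * beta D r l) = u i l" if i: "i \<in> p" and l: "l < dimT D" for i l
  proof -
    have 0: "(\<Sum>l'<dimT D. u i l' * iota D l' j) = 0" if "j < dimK D" for j
    proof -
      have "(\<Sum>l'\<in>p. u i l' * iota D l' j) = iota D i j"
        using i finite_subset[OF p(1)] by (simp add: u_def if_distrib if_distribR cong: if_cong)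
      moreover have "(\<Sum>l'\<in>J. u i l' * iota D l' j) = (\<Sum>l'\<in>J. - C i l' * iota D l' j)"
        by (intro sum.cong) (auto simp: u_def J_def compl_set_def)
      ultimately show ?thesis
        using row[OF that, of i] by (simp add: sum_split_compl[OF p(1)] J_def sum_negf)
    qed
    have "(\<Sum>r<dimA D. b i r * beta D r l) = (\<Sum>l'<dimT D. u i l' * (\<Sum>r<dimA D. S l' r * beta D r l))"
      unfolding b_def by (rule sum_sum_assoc[symmetric])
    also have "\<dots> = (\<Sum>l'<dimT D. u i l' * ((if l' = l then 1 else 0) - (\<Sum>j<dimK D. iota D l' j * T j l)))"
    proof (intro sum.cong refl)
      fix l' assume "l' \<in> {..<dimT D}"
      then have "(\<Sum>r<dimA D. S l' r * beta D r l) = (if l' = l then 1 else 0) - (\<Sum>j<dimK D. iota D l' j * T j l)"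
        using splittingD(1)[OF split _ l, of l'] by simp
      then show "u i l' * (\<Sum>r<dimA D. S l' r * beta D r l) =
          u i l' * ((if l' = l then 1 else 0) - (\<Sum>j<dimK D. iota D l' j * T j l))" by simp
    qed
    also have "\<dots> = u i l - (\<Sum>l'<dimT D. u i l' * (\<Sum>j<dimK D. iota D l' j * T j l))"
      using l by (simp add: right_diff_distrib sum_subtractf)
    also have "(\<Sum>l'<dimT D. u i l' * (\<Sum>j<dimK D. iota D l' j * T j l)) =
        (\<Sum>j<dimK D. (\<Sum>l'<dimT D. u i l' * iota D l' j) * T j l)" by (rule sum_sum_assoc)
    also have "\<dots> = 0" using 0 by simp
    finally show ?thesis by simp
  qed
  have "dual_data D p C b e"
    unfolding dual_data_def
  proof (intro conjI ballI allI impI)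
    fix i l assume "i \<in> p" "l < dimT D"
    then show "(\<Sum>r<dimA D. b i r * beta D r l) = (if l \<in> p then if l = i then 1 else 0 else - C i l)"
      using dual1 by (simp add: u_def)
  next
    fix j l assume "j \<in> compl_set D p" "l < dimT D"
    then show "(\<Sum>a<dimK D. e j a * iota D l a) = (if l \<in> p then C l j else if l = j then 1 else 0)"
      using IE[of l j] by (auto simp: C_def J_def compl_set_def mult.commute)
  qed (use row col in \<open>auto simp: J_def\<close>)
  then have "dual_data D p (coef D p) b e"
    using coef_eq[OF _ p(1)] by (auto intro: dual_data_cong)
  then show "\<exists>b e. dual_data D p (coef D p) b e" by blast
qed

text \<open>Genericity and smoothness are applied to one point: the semistable point supported where
  a monomial of weight a multiple of \<open>\<theta>\<close>, with exponents vanishing on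
  \<open>p\<close>, has nonzero exponents. Its stabilizer is trivial, so \<open>p\<close> is a basis
  and no exponent outside \<open>p\<close> vanishes; those exponents are multiples of
  \<open>theta_wt\<close>.\<close>

lemma fixed_set_basis:
  assumes split: "splitting D S T" and gen: "generic_theta D" and smooth: "smooth_hypertoric D"
    and p: "p \<in> fixed_sets D"
  shows "\<exists>b e. dual_data D p (coef D p) b e" and "\<forall>j\<in>compl_set D p. theta_wt D p j \<noteq> 0"
proof -
  note sub = fixed_setsD(1)[OF p]
  obtain x where x: "x \<in> flat D p" using fixed_setsD(4)[OF p] by blast
  have "\<exists>m y. m \<ge> (1::nat) \<and> (\<forall>i\<in>p. (\<Sum>r<dimA D. y r * beta D r i) = int m * - lift_theta D i)"
    by (rule int_system_scale[where x = x]) (use x in \<open>auto simp: flat_def hplane_def pair_beta_def\<close>)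
  then obtain m y where m: "m \<ge> (1::nat)"
    and y: "\<And>i. i \<in> p \<Longrightarrow> (\<Sum>r<dimA D. y r * beta D r i) = - (int m * lift_theta D i)" by auto
  \<comment> \<open>Adding \<open>y beta\<close> does not change the weight under the gauge torus,
    and \<open>y\<close> is chosen to cancel the exponents of \<open>m \<theta>\<close> on
    \<open>p\<close>.\<close>
  define N where "N i = (\<Sum>r<dimA D. y r * beta D r i) + int m * lift_theta D i" for i
  have Np: "N i = 0" if "i \<in> p" for i using y[OF that] by (simp add: N_def)
  define v where "v = ind_point {i. i < dimT D \<and> N i > 0} {i. i < dimT D \<and> N i < 0}"
  have vmz: "v \<in> moment_zero D" unfolding v_def by (rule ind_point_moment_zero) auto
  have "v \<in> semistable D"
  proof (rule semistable_weight_monom[OF vmz m, of N])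
    show "weight_monom D N v \<noteq> 0" unfolding weight_monom_nonzero_iff by (simp add: v_def)
    fix a assume a: "a < dimK D"
    have "(\<Sum>i<dimT D. iota D i a * (\<Sum>r<dimA D. beta D r i * y r)) = (\<Sum>r<dimA D. (\<Sum>i<dimT D. iota D i a * beta D r i) * y r)"
      by (rule sum_sum_assoc)
    also have "\<dots> = 0" using splittingD(4)[OF split _ a] by (simp add: mult.commute)
    finally show "(\<Sum>i<dimT D. iota D i a * N i) = int m * (\<Sum>i<dimT D. iota D i a * lift_theta D i)"
      by (simp add: N_def distrib_left sum.distrib sum_distrib_left mult_ac)
  qed
  then have "stabilizer D v = {\<lambda>_. 1}"
    using gen smooth by (simp add: generic_theta_def smooth_hypertoric_def)
  note triv = dual_data_if_trivial_stabilizer[OF split sub fixed_setsD(3)[OF p] this _ vmz]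
  have supp: "fst v i = 0 \<and> snd v i = 0" if "i \<in> p" for i using Np[OF that] by (simp add: v_def)
  show "\<exists>b e. dual_data D p (coef D p) b e" by (rule triv(1)[OF supp])
  then obtain b e where dual: "dual_data D p (coef D p) b e" by blast
  show "\<forall>j\<in>compl_set D p. theta_wt D p j \<noteq> 0"
  proof
    fix j assume j: "j \<in> compl_set D p"
    then have "N j \<noteq> 0" using triv(2)[OF supp j] by (auto simp: v_def split: if_splits)
    moreover have "N j = int m * theta_wt D p j"
    proof -
      have "(\<Sum>r<dimA D. y r * beta D r j) = - (\<Sum>r<dimA D. y r * (\<Sum>i\<in>p. beta D r i * coef D p i j))"
        using dual_dataD(3)[OF dual j] by (simp add: sum_negf mult.commute)
      also have "\<dots> = - (\<Sum>i\<in>p. (\<Sum>r<dimA D. y r * beta D r i) * coef D p i j)"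
        by (simp add: sum_sum_assoc)
      also have "\<dots> = int m * (\<Sum>i\<in>p. coef D p i j * lift_theta D i)"
        by (simp add: y sum_negf sum_distrib_left mult_ac)
      finally show ?thesis by (simp add: N_def theta_wt_def distrib_left)
    qed
    ultimately show "theta_wt D p j \<noteq> 0" by auto
  qed
qed

text \<open>Eliminating the rows of \<open>iota\<close> in \<open>p\<close> shows that the monomial
  with exponents \<open>theta_wt\<close> outside \<open>p\<close> has weight exactly
  \<open>\<theta>\<close>.\<close>

lemma semistable_chart:
  assumes dual: "dual_data D p (coef D p) b e" and p: "p \<subseteq> {..<dimT D}" and v: "v \<in> moment_zero D"
    and plus: "\<And>j. j \<in> compl_set D p \<Longrightarrow> theta_wt D p j > 0 \<Longrightarrow> fst v j \<noteq> 0"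
    and minus: "\<And>j. j \<in> compl_set D p \<Longrightarrow> theta_wt D p j < 0 \<Longrightarrow> snd v j \<noteq> 0"
  shows "v \<in> semistable D"
proof (rule semistable_weight_monom[OF v, of 1 "\<lambda>l. if l \<in> p then 0 else theta_wt D p l"])
  show "weight_monom D (\<lambda>l. if l \<in> p then 0 else theta_wt D p l) v \<noteq> 0"
    unfolding weight_monom_nonzero_iff using plus minus by (auto simp: compl_set_def)
  fix a assume a: "a < dimK D"
  have "(\<Sum>i<dimT D. iota D i a * (if i \<in> p then 0 else theta_wt D p i)) =
      (\<Sum>j\<in>compl_set D p. iota D j a * theta_wt D p j)"
    unfolding sum_split_compl[OF p] by (simp add: compl_set_def)
  also have "\<dots> = (\<Sum>j\<in>compl_set D p. iota D j a * lift_theta D j) +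
      (\<Sum>j\<in>compl_set D p. iota D j a * (\<Sum>i\<in>p. coef D p i j * lift_theta D i))"
    by (simp add: theta_wt_def distrib_left sum.distrib)
  also have "(\<Sum>j\<in>compl_set D p. iota D j a * (\<Sum>i\<in>p. coef D p i j * lift_theta D i)) =
      (\<Sum>i\<in>p. (\<Sum>j\<in>compl_set D p. iota D j a * coef D p i j) * lift_theta D i)"
    by (rule sum_sum_assoc)
  also have "\<dots> = (\<Sum>i\<in>p. iota D i a * lift_theta D i)"
    using dual_dataD(4)[OF dual _ a] by (simp add: mult.commute)
  finally show "(\<Sum>i<dimT D. iota D i a * (if i \<in> p then 0 else theta_wt D p i)) =
      int 1 * (\<Sum>i<dimT D. iota D i a * lift_theta D i)"
    by (simp add: sum_split_compl[OF p])
qed simp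

lemma char_K_chart:
  assumes dual: "dual_data D p C b e" and s: "s \<in> torus (dimK D)" and i: "i \<in> p"
  shows "char_K D i s = (\<Prod>j\<in>compl_set D p. char_K D j s powi C i j)"
proof -
  have "(\<Prod>j\<in>compl_set D p. char_K D j s powi C i j) =
      (\<Prod>a<dimK D. s a powi (\<Sum>j\<in>compl_set D p. iota D j a * C i j))"
    unfolding char_K_def by (rule prod_powi_sum) (use s in \<open>auto simp: torus_def\<close>)
  also have "\<dots> = char_K D i s"
    unfolding char_K_def using dual_dataD(4)[OF dual i] by (simp add: mult.commute)
  finally show ?thesis ..
qed

text \<open>Since \<open>e\<close> inverts the rows of \<open>iota\<close> outside \<open>p\<close>,
  the gauge torus can scale the coordinates outside \<open>p\<close> independently.\<close>

lemma gauge_solve: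
  fixes c :: "nat \<Rightarrow> complex"
  assumes dual: "dual_data D p C b e" and c: "\<And>j. j \<in> compl_set D p \<Longrightarrow> c j \<noteq> 0"
  shows "\<exists>s\<in>torus (dimK D). \<forall>j\<in>compl_set D p. char_K D j s = c j"
proof (intro bexI ballI)
  define s where "s = (\<lambda>a. if a < dimK D then \<Prod>j\<in>compl_set D p. c j powi e j a else 1)"
  show "s \<in> torus (dimK D)" using c by (auto simp: torus_def s_def)
  fix l assume l: "l \<in> compl_set D p"
  have "char_K D l s = (\<Prod>a<dimK D. (\<Prod>j\<in>compl_set D p. c j powi e j a) powi iota D l a)"
    by (simp add: char_K_def s_def)
  also have "\<dots> = (\<Prod>j\<in>compl_set D p. c j powi (\<Sum>a<dimK D. e j a * iota D l a))"
    by (rule prod_powi_sum) (rule c)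
  also have "\<dots> = (\<Prod>j\<in>compl_set D p. if l = j then c l else 1)"
    using dual_dataD(2)[OF dual] l by (intro prod.cong) (auto simp: compl_set_def)
  finally show "char_K D l s = c l" using l by (simp add: prod.delta)
qed

section \<open>Orbits and the genericity of \<open>\<sigma>\<close>\<close>

lemma gauge_act_mult:
  "gauge_act D s (gauge_act D s' v) = gauge_act D (\<lambda>a. s a * s' a) v"
  by (simp add: gauge_act_def char_K_def power_int_mult_distrib prod.distrib mult_ac)

lemma torus_mult: "s \<in> torus k \<Longrightarrow> s' \<in> torus k \<Longrightarrow> (\<lambda>a. s a * s' a) \<in> torus k"
  and torus_inverse: "s \<in> torus k \<Longrightarrow> (\<lambda>a. inverse (s a)) \<in> torus k"
  and torus_1: "(\<lambda>a. 1) \<in> torus k"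
  by (auto simp: torus_def)

lemma gauge_act_1: "gauge_act D (\<lambda>a. 1) v = v"
  by (simp add: gauge_act_def char_K_def)

lemma self_in_orbit: "v \<in> orbit D v"
  unfolding orbit_def using gauge_act_1 torus_1 by (metis image_eqI)

lemma gauge_inverse: "s \<in> torus (dimK D) \<Longrightarrow> gauge_act D (\<lambda>a. inverse (s a)) (gauge_act D s v) = v"
proof -
  assume s: "s \<in> torus (dimK D)"
  have "(\<lambda>a. inverse (s a) * s a) = (\<lambda>a. 1)"
    using s by (auto simp: torus_def fun_eq_iff) (metis left_inverse linorder_not_less mult_1 inverse_1)
  then show ?thesis by (simp add: gauge_act_mult gauge_act_1)
qed

lemma orbit_gauge: "s \<in> torus (dimK D) \<Longrightarrow> orbit D (gauge_act D s v) = orbit D v"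
proof -
  have *: "orbit D (gauge_act D s v) \<subseteq> orbit D v" if "s \<in> torus (dimK D)" for s v
    using that by (auto simp: orbit_def gauge_act_mult intro!: imageI torus_mult)
  assume s: "s \<in> torus (dimK D)"
  show ?thesis
    using *[OF s, of v] *[OF torus_inverse[OF s], of "gauge_act D s v"] gauge_inverse[OF s, of v] by auto
qed

lemma orbit_invariant:
  assumes "\<And>s u. f (gauge_act D s u) = gauge_act D s (f u)" "f v = gauge_act D s0 v" "s0 \<in> torus (dimK D)"
  shows "f ` orbit D v = orbit D v"
proof -
  have "f ` orbit D v = orbit D (f v)" by (auto simp: orbit_def image_image assms(1))
  then show ?thesis using orbit_gauge[OF assms(3)] assms(2) by simp
qed

lemma torus_act_gauge: "torus_act a h (gauge_act D s v) = gauge_act D s (torus_act a h v)"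
  by (simp add: torus_act_def gauge_act_def mult_ac)

text \<open>Turning on \<open>z_i\<close> at the vertex gives a point on a torus-invariant curve.
  Were the weight zero, a gauge transformation would undo \<open>\<sigma>\<close> on it; genericity
  would then make the orbit fixed by the whole torus, but scaling \<open>z_i\<close> alone moves
  it.\<close>

lemma sigma_wt_nonzero:
  assumes gen: "generic_sigma D" and p: "p \<subseteq> {..<dimT D}"
    and dual: "dual_data D p (coef D p) b e" and theta: "\<And>j. j \<in> compl_set D p \<Longrightarrow> theta_wt D p j \<noteq> 0"
    and i: "i \<in> p"
  shows "sigma_wt D p i \<noteq> 0"
proof
  assume 0: "sigma_wt D p i = 0"
  define A where "A = insert i {j \<in> compl_set D p. theta_wt D p j > 0}"
  define B where "B = {j \<in> compl_set D p. theta_wt D p j < 0}"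
  define v where "v = ind_point A B"
  have AB: "A \<union> B = insert i (compl_set D p)" using theta by (force simp: A_def B_def)
  have v: "v \<in> semistable D"
  proof (rule semistable_chart[OF dual p])
    show "v \<in> moment_zero D"
      unfolding v_def by (rule ind_point_moment_zero) (use i p in \<open>auto simp: A_def B_def compl_set_def\<close>)
  qed (auto simp: v_def A_def B_def)
  have "sigma_act D t ` orbit D v = orbit D v" if t: "t \<noteq> 0" for t
  proof -
    obtain s where s: "s \<in> torus (dimK D)" "\<And>j. j \<in> compl_set D p \<Longrightarrow> char_K D j s = t powi lift_sigma D j"
      using gauge_solve[OF dual, of "\<lambda>j. t powi lift_sigma D j"] t by auto
    have "char_K D i s = (\<Prod>j\<in>compl_set D p. t powi (coef D p i j * lift_sigma D j))"
      unfolding char_K_chart[OF dual s(1) i] using s(2) by (simp add: power_int_mult mult.commute[of "coef D p i _"])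
    also have "\<dots> = t powi (\<Sum>j\<in>compl_set D p. coef D p i j * lift_sigma D j)"
      using prod_powi_sum[of "{()}" "\<lambda>_. t" "\<lambda>j _. coef D p i j" "lift_sigma D" "compl_set D p"] t
      by (simp add: power_int_mult)
    also have "\<dots> = t powi lift_sigma D i" using 0 by (simp add: sigma_wt_def)
    finally have "char_K D l s = t powi lift_sigma D l" if "l \<in> A \<union> B" for l
      using that s(2) AB by auto
    then have "sigma_act D t v = gauge_act D s v"
      by (auto simp: sigma_act_def torus_act_def gauge_act_def v_def)
    then show ?thesis
      unfolding sigma_act_def by (rule orbit_invariant[OF torus_act_gauge _ s(1)])
  qed
  then have "orbit D v \<in> fixed_points D"
    using gen v unfolding generic_sigma_def points_def by blast
  \<comment> \<open>Any scalar other than \<open>0\<close> and \<open>1\<close> would do for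
    \<open>2\<close>.\<close>
  moreover have "(\<lambda>l. if l = i then 2 else 1) \<in> torus (dimT D)" using i p by (auto simp: torus_def)
  ultimately have "torus_act (\<lambda>l. if l = i then 2 else 1) 1 ` orbit D v = orbit D v"
    unfolding fixed_points_def by auto
  then obtain s where s: "s \<in> torus (dimK D)" "gauge_act D s v = torus_act (\<lambda>l. if l = i then 2 else 1) 1 v"
    using self_in_orbit[of v D] unfolding orbit_def by (metis (no_types, lifting) imageE imageI)
  have iA: "i \<in> A" "i \<notin> B" using i by (auto simp: A_def B_def compl_set_def)
  have fs: "char_K D l s * fst v l = (if l = i then 2 else 1) * fst v l"
       "inverse (char_K D l s) * snd v l = inverse (if l = i then 2 else 1) * snd v l" for l
    using s(2) by (simp_all add: gauge_act_def torus_act_def prod_eq_iff fun_eq_iff split: if_splits)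
  have "char_K D j s = 1" if j: "j \<in> compl_set D p" for j
  proof -
    have "j \<noteq> i" using i j by (auto simp: compl_set_def)
    moreover have "j \<in> A \<or> j \<in> B" using AB j by blast
    ultimately show ?thesis using fs[of j] by (auto simp: v_def)
  qed
  then have "char_K D i s = 1" unfolding char_K_chart[OF dual s(1) i] by simp
  then show False using fs(1)[of i] iA by (simp add: v_def)
qed

text \<open>Moving in direction \<open>b i\<close> stays on all hyperplanes of \<open>p\<close>
  except that of \<open>i\<close>, while the pairing with \<open>j\<close> changes at rate
  \<open>- coef D p i j\<close>. The parameter \<open>s\<close> is where the hyperplane of
  \<open>j\<close> is reached.\<close>

lemma exchange:
  assumes dual: "dual_data D p (coef D p) b e" and p: "p \<in> fixed_sets D"
    and i: "i \<in> p" and j: "j \<in> compl_set D p" and c: "coef D p i j \<noteq> 0"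
    and x: "x \<in> flat D p"
  defines "s \<equiv> of_int (theta_wt D p j) / of_int (coef D p i j) :: real"
  obtains x' where "insert j (p - {i}) \<in> fixed_sets D" "x' \<in> flat D (insert j (p - {i}))"
    "\<And>l. pair_beta D x' l = pair_beta D x l + s * of_int (\<Sum>r<dimA D. b i r * beta D r l)"
proof
  note sub = fixed_setsD(1)[OF p]
  define x' where "x' = (\<lambda>r. if r < dimA D then x r + s * of_int (b i r) else 0)"
  show pb: "pair_beta D x' l = pair_beta D x l + s * of_int (\<Sum>r<dimA D. b i r * beta D r l)" for l
    by (simp add: pair_beta_def x'_def distrib_right sum.distrib sum_distrib_left mult.assoc)
  show x': "x' \<in> flat D (insert j (p - {i}))"
    unfolding flat_def
  proof (intro CollectI conjI ballI)
    show "x' \<in> dual_space D" by (simp add: dual_space_def x'_def)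
    fix l assume l: "l \<in> insert j (p - {i})"
    then have "l < dimT D" using sub j by (auto simp: compl_set_def)
    note pb' = pb[of l, unfolded dual_dataD(1)[OF dual i this]]
    have "pair_beta D x' l = - of_int (lift_theta D l)"
    proof (cases "l = j")
      case True
      then have "l \<notin> p" using j by (auto simp: compl_set_def)
      then show ?thesis
        using pb' pair_beta_flat[OF dual sub x j] c True by (simp add: s_def theta_wt_def)
    next
      case False
      then show ?thesis using pb' l x by (auto simp: flat_def hplane_def)
    qed
    then show "x' \<in> hplane D l" by (simp add: hplane_def dual_space_def x'_def)
  qed
  have "card (insert j (p - {i})) = Suc (card (p - {i}))"
    using j fixed_setsD(2)[OF p] by (intro card_insert_disjoint) (auto simp: compl_set_def)
  also have "\<dots> = dimA D" using card_Suc_Diff1[OF fixed_setsD(2)[OF p] i] fixed_setsD(3)[OF p] by simp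
  finally show "insert j (p - {i}) \<in> fixed_sets D"
    using x' sub j by (auto simp: fixed_sets_def compl_set_def)
qed

text \<open>
  Among the vertices choose one meeting \<open>r\<close> as little as possible. If it met \<open>r\<close> in \<open>i\<close>, then by the exchange
  property \<open>\<iota>\<^sub>i\<close> would depend on the \<open>\<iota>\<^sub>j\<close> with \<open>j \<in> r\<close>, and the weight of \<open>\<sigma>\<close> in direction \<open>i\<close> would vanish.
\<close>

lemma mirror_fixed_sets:
  assumes split: "splitting D S T" and ne: "fixed_sets D \<noteq> {}"
    and dual: "\<And>p. p \<in> fixed_sets D \<Longrightarrow> \<exists>b e. dual_data D p (coef D p) b e"
    and sigma: "\<And>p i. p \<in> fixed_sets D \<Longrightarrow> i \<in> p \<Longrightarrow> sigma_wt D p i \<noteq> 0"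
    and r: "r \<in> fixed_sets (mirror D)"
  shows "compl_set D r \<in> fixed_sets D"
proof -
  have rsub: "r \<subseteq> {..<dimT D}" and rcard: "card r = dimK D" and rfin: "finite r"
    using fixed_setsD[OF r] by auto
  obtain y where y: "y \<in> flat (mirror D) r" using fixed_setsD(4)[OF r] by blast
  then have yr: "(\<Sum>a<dimK D. y a * of_int (iota D j a)) = of_int (lift_sigma D j)" if "j \<in> r" for j
    using that by (simp add: flat_def hplane_def pair_beta_def)
  obtain p where p: "p \<in> fixed_sets D" and min: "\<And>p'. p' \<in> fixed_sets D \<Longrightarrow> card (p \<inter> r) \<le> card (p' \<inter> r)"
    using ne ex_has_least_nat[of "\<lambda>p. p \<in> fixed_sets D" _ "\<lambda>p. card (p \<inter> r)"] by blast
  obtain b e where dd: "dual_data D p (coef D p) b e" using dual[OF p] by blast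
  note sub = fixed_setsD(1)[OF p]
  have "p \<inter> r = {}"
  proof (rule ccontr)
    assume "\<not> ?thesis"
    then obtain i where i: "i \<in> p" "i \<in> r" by blast
    have C0: "coef D p i j = 0" if j: "j \<in> compl_set D p" "j \<notin> r" for j
    proof (rule ccontr)
      assume nz: "coef D p i j \<noteq> 0"
      obtain x where "x \<in> flat D p" using fixed_setsD(4)[OF p] by blast
      from exchange[OF dd p i(1) j(1) nz this] have "insert j (p - {i}) \<in> fixed_sets D" by blast
      moreover have "insert j (p - {i}) \<inter> r = p \<inter> r - {i}" using j(2) by blast
      ultimately have "card (p \<inter> r) \<le> card (p \<inter> r - {i})" using min by metis
      moreover have "card (p \<inter> r - {i}) < card (p \<inter> r)" using i rfin by (intro psubset_card_mono) auto
      ultimately show False by simp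
    qed
    have "of_int (lift_sigma D i) = (\<Sum>a<dimK D. y a * (\<Sum>j\<in>compl_set D p. of_int (iota D j a) * of_int (coef D p i j)))"
      unfolding yr[OF i(2), symmetric]
      using dual_dataD(4)[OF dd i(1)] by (simp add: mult.commute)
    also have "\<dots> = (\<Sum>j\<in>compl_set D p. (\<Sum>a<dimK D. y a * of_int (iota D j a)) * of_int (coef D p i j))"
      by (rule sum_sum_assoc)
    also have "\<dots> = (\<Sum>j\<in>compl_set D p. of_int (lift_sigma D j) * of_int (coef D p i j))"
      using yr C0 by (intro sum.cong refl) (metis mult_zero_right of_int_0)
    finally have "(of_int (lift_sigma D i) :: real) = of_int (\<Sum>j\<in>compl_set D p. coef D p i j * lift_sigma D j)"
      by (simp add: mult.commute)
    then have "sigma_wt D p i = 0" unfolding of_int_eq_iff by (simp add: sigma_wt_def)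
    then show False using sigma[OF p i(1)] by simp
  qed
  then have "r \<subseteq> compl_set D p" using rsub by (auto simp: compl_set_def)
  then have "r = compl_set D p"
    using card_compl_set[OF split sub fixed_setsD(3)[OF p]] rcard by (intro card_subset_eq) auto
  then show ?thesis using p by (simp add: compl_compl_set[OF sub])
qed

text \<open>The assumed vertex starts the minimal choice in
  \<open>mirror_fixed_sets\<close>.\<close>

lemma regular_if_generic:
  assumes ex: "exact_seq (dimK D) (dimT D) (dimA D) (iota D) (beta D)"
    and gen: "generic_theta D" and smooth: "smooth_hypertoric D" and gens: "generic_sigma D"
    and ne: "fixed_sets D \<noteq> {}"
  shows "regular D"
proof -
  obtain S T where split: "splitting D S T" using exact_splitting[OF ex] by blast
  note basis = fixed_set_basis[OF split gen smooth]
  have sigma: "sigma_wt D p i \<noteq> 0" if p: "p \<in> fixed_sets D" and i: "i \<in> p" for p i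
  proof -
    obtain b e where "dual_data D p (coef D p) b e" using basis(1)[OF p] by blast
    then show ?thesis
      using sigma_wt_nonzero[OF gens fixed_setsD(1)[OF p] _ _ i] basis(2)[OF p] by blast
  qed
  have "\<forall>r\<in>fixed_sets (mirror D). compl_set D r \<in> fixed_sets D"
    using mirror_fixed_sets[OF split ne basis(1) sigma] by blast
  then show ?thesis unfolding regular_def using split basis sigma by blast
qed

section \<open>Edges and attracting sets\<close>

lemma continuous_on_phase_coord:
  "continuous_on S (\<lambda>v :: phase. fst v i)" "continuous_on S (\<lambda>v :: phase. snd v i)"
  by (rule continuous_on_compose2[OF continuous_on_fun_coord continuous_on_fst[OF continuous_on_id] subset_UNIV])
     (rule continuous_on_compose2[OF continuous_on_fun_coord continuous_on_snd[OF continuous_on_id] subset_UNIV])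

lemma continuous_on_weight_monom: "continuous_on S (weight_monom D N)"
proof -
  have "continuous_on S (\<lambda>v. if N i \<ge> 0 then fst v i ^ nat (N i) else snd v i ^ nat (- N i))" for i
    by (cases "N i \<ge> 0") (auto intro!: continuous_intros continuous_on_phase_coord)
  then have "continuous_on S (\<lambda>v. weight_monom D N v)"
    unfolding weight_monom_def by (intro continuous_on_prod)
  then show ?thesis .
qed

lemma topspace_hyper_top: "topspace (hyper_top D) = points D"
proof -
  have "openin (hyper_top D) (points D)"
  proof -
    have "{v \<in> semistable D. orbit D v \<in> points D} = semistable D" by (auto simp: points_def)
    then show ?thesis by (simp add: openin_hyper_top)
  qed
  then show ?thesis
    using openin_hyper_top openin_subset by (metis openin_topspace subset_antisym)
qed

lemma weight_monom_orbit:
  assumes inv: "\<And>a. a < dimK D \<Longrightarrow> (\<Sum>l<dimT D. iota D l a * M l) = 0" and u: "u \<in> orbit D v"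
  shows "weight_monom D M u = weight_monom D M v"
proof -
  obtain s where s: "s \<in> torus (dimK D)" "u = gauge_act D s v" using u by (auto simp: orbit_def)
  then show ?thesis using weight_monom_gauge[OF s(1)] inv by simp
qed

lemma weight_monom_sigma:
  assumes t: "t \<noteq> 0"
  shows "weight_monom D M (sigma_act D t v) = t powi (\<Sum>l<dimT D. lift_sigma D l * M l) * weight_monom D M v"
proof -
  have "sigma_act D t v = (\<lambda>i. t powi lift_sigma D i * fst v i, \<lambda>i. inverse (t powi lift_sigma D i) * snd v i)"
    by (simp add: sigma_act_def torus_act_def)
  moreover have "(\<Prod>l<dimT D. (t powi lift_sigma D l) powi M l) = t powi (\<Sum>l<dimT D. lift_sigma D l * M l)"
    using prod_powi_sum[of "{()}" "\<lambda>_. t" "\<lambda>l _. lift_sigma D l" M "{..<dimT D}"] t by simp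
  ultimately show ?thesis using weight_monom_scale[of D "\<lambda>i. t powi lift_sigma D i" M v] t by simp
qed

text \<open>
  The zero locus of an invariant monomial of negative weight is closed, and an orbit on which the
  monomial does not vanish has no limit as \<open>t \<rightarrow> 0\<close>.
\<close>

lemma not_in_full_Attr:
  assumes inv: "\<And>a. a < dimK D \<Longrightarrow> (\<Sum>l<dimT D. iota D l a * M l) = 0"
    and neg: "(\<Sum>l<dimT D. lift_sigma D l * M l) < 0"
    and x: "x \<in> points D" "\<And>u. u \<in> x \<Longrightarrow> weight_monom D M u = 0"
    and v: "weight_monom D M v \<noteq> 0"
  shows "orbit D v \<notin> full_Attr D x"
proof
  assume mem: "orbit D v \<in> full_Attr D x"
  define \<phi> where "\<phi> = weight_monom D M"
  define Y where "Y = {y \<in> points D. \<forall>u\<in>y. \<phi> u = 0}"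
  have \<phi>orb: "(\<forall>u\<in>orbit D w. Q (\<phi> u)) \<longleftrightarrow> Q (\<phi> w)" for w Q
    using weight_monom_orbit[OF inv, of _ w] self_in_orbit[of w D] unfolding \<phi>_def by metis
  have cont: "continuous_on (semistable D) \<phi>" unfolding \<phi>_def by (rule continuous_on_weight_monom)
  have open_pre: "openin (hyper_top D) {y \<in> points D. \<forall>u\<in>y. \<phi> u \<in> V}" if "open V" for V
  proof -
    have "{w \<in> semistable D. orbit D w \<in> {y \<in> points D. \<forall>u\<in>y. \<phi> u \<in> V}} = semistable D \<inter> \<phi> -` V"
      using \<phi>orb[of _ "\<lambda>z. z \<in> V"] by (auto simp: points_def)
    moreover have "openin (top_of_set (semistable D)) (semistable D \<inter> \<phi> -` V)"
      using cont that by (auto intro: continuous_openin_preimage_gen)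
    ultimately show ?thesis by (simp add: openin_hyper_top)
  qed
  have "closedin (hyper_top D) Y"
  proof -
    have "(\<forall>u\<in>y. \<phi> u \<in> - {0}) \<longleftrightarrow> \<not> (\<forall>u\<in>y. \<phi> u = 0)" if y: "y \<in> points D" for y
    proof -
      obtain w where "y = orbit D w" using y by (auto simp: points_def)
      then show ?thesis using \<phi>orb[of w "\<lambda>z. z = 0"] \<phi>orb[of w "\<lambda>z. z \<in> - {0}"] by simp
    qed
    then have "points D - Y = {y \<in> points D. \<forall>u\<in>y. \<phi> u \<in> - {0}}" unfolding Y_def by blast
    then show ?thesis
      using open_pre[of "- {0}"] unfolding closedin_def topspace_hyper_top by (auto simp: Y_def)
  qed
  moreover have "x \<in> Y" using x by (auto simp: Y_def \<phi>_def)
  moreover have "z \<in> Y" if y: "y \<in> Y" and z: "z \<in> Attr D y" for y z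
  proof -
    have zp: "z \<in> points D" and lim: "limitin (hyper_top D) (\<lambda>t. sigma_act D t ` z) y (at 0)"
      using z by (auto simp: Attr_def)
    have "y \<in> {y \<in> points D. \<forall>u\<in>y. \<phi> u \<in> ball 0 1}" using y by (auto simp: Y_def)
    then have "eventually (\<lambda>t. sigma_act D t ` z \<in> {y \<in> points D. \<forall>u\<in>y. \<phi> u \<in> ball 0 1}) (at 0)"
      using lim open_pre[of "ball 0 1"] unfolding limitin_def by blast
    then obtain d where d: "d > 0" "\<And>t u. t \<noteq> 0 \<Longrightarrow> norm t < d \<Longrightarrow> u \<in> z \<Longrightarrow> norm (\<phi> (sigma_act D t u)) < 1"
      unfolding eventually_at by (auto simp: dist_norm)
    have "\<phi> u = 0" if u: "u \<in> z" for u
    proof (rule ccontr)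
      assume nz: "\<phi> u \<noteq> 0"
      define c where "c = - (\<Sum>l<dimT D. lift_sigma D l * M l)"
      \<comment> \<open>With weight \<open>- c\<close> and \<open>c \<ge> 1\<close>, the monomial at
        \<open>sigma_act D t u\<close> has norm \<open>x powi (- c)\<close> times that at
        \<open>u\<close>, which is at least \<open>1\<close> once \<open>x \<le> 1\<close> and
        \<open>x \<le> norm (\<phi> u)\<close>. This leaves the unit ball however small
        \<open>t\<close> is.\<close>
      define x where "x = min (d / 2) (min 1 (norm (\<phi> u)))"
      have x: "0 < x" "x < d" "x \<le> 1" "x \<le> norm (\<phi> u)" using d(1) nz by (auto simp: x_def)
      define t where "t = complex_of_real x"
      have t: "t \<noteq> 0" "norm t = x" using x(1) by (auto simp: t_def)
      have "norm (\<phi> (sigma_act D t u)) = x powi (- c) * norm (\<phi> u)"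
        unfolding \<phi>_def weight_monom_sigma[OF t(1)] by (simp add: norm_mult norm_power_int t c_def)
      also have "x powi (- c) = inverse x ^ nat c"
        using neg by (simp add: c_def power_int_def power_inverse)
      finally have eq: "norm (\<phi> (sigma_act D t u)) = inverse x ^ nat c * norm (\<phi> u)" .
      have "inverse x * x \<le> inverse x ^ nat c * norm (\<phi> u)"
        using x neg by (intro mult_mono self_le_power) (auto simp: c_def one_le_inverse)
      then have "1 \<le> norm (\<phi> (sigma_act D t u))" using x unfolding eq by simp
      then show False using d(2)[OF t(1) _ u] t x by simp
    qed
    then show ?thesis using zp by (auto simp: Y_def)
  qed
  ultimately have "full_Attr D x \<subseteq> Y" unfolding full_Attr_def by blast
  from subsetD[OF this mem] have "\<phi> v = 0" using self_in_orbit[of v D] unfolding Y_def by blast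
  then show False using v by (simp add: \<phi>_def)
qed

text \<open>The value of \<open>\<sigma>\<close> at the vertex, up to a constant independent of the vertex.\<close>

definition height :: "hypertoric \<Rightarrow> nat set \<Rightarrow> int" where
  "height D p = (\<Sum>j\<in>compl_set D p. lift_sigma D j * theta_wt D p j)"

context regular_vertex
begin

abbreviation "C \<equiv> coef D p"

text \<open>By \<open>gauge_solve\<close> the nonzero coordinates can all be scaled to
  \<open>1\<close>, so the support condition in \<open>vertex_point\<close> describes a single
  orbit.\<close>

lemma vertex_point_orbit:
  "ind_point (A_plus D p) (A_minus D p) \<in> semistable D"
  "vertex_point D p = orbit D (ind_point (A_plus D p) (A_minus D p))"
proof -
  define v0 where "v0 = ind_point (A_plus D p) (A_minus D p)"
  have disj: "A_plus D p \<inter> A_minus D p = {}" and dec: "compl_set D p = A_plus D p \<union> A_minus D p"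
    using A_decomp by auto
  have sub': "A_plus D p \<subseteq> {..<dimT D}" "A_minus D p \<subseteq> {..<dimT D}"
    using dec by (auto simp: compl_set_def)
  have "v0 \<in> moment_zero D" unfolding v0_def by (rule ind_point_moment_zero) (use disj sub' in auto)
  then show v0: "ind_point (A_plus D p) (A_minus D p) \<in> semistable D"
    unfolding v0_def by (rule semistable_chart[OF dual sub]) (auto simp: A_plus_eq A_minus_eq)
  have "u \<in> orbit D v0" if u: "u \<in> vertex_point D p" for u
  proof -
    have fst: "\<And>i. i < dimT D \<Longrightarrow> fst u i \<noteq> 0 \<longleftrightarrow> i \<in> A_plus D p"
      and snd: "\<And>i. i < dimT D \<Longrightarrow> snd u i \<noteq> 0 \<longleftrightarrow> i \<in> A_minus D p"
      and out: "\<And>i. \<not> i < dimT D \<Longrightarrow> fst u i = 0 \<and> snd u i = 0"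
      using u by (auto simp: vertex_point_def semistable_def moment_zero_def)
    obtain s where s: "s \<in> torus (dimK D)"
        "\<And>j. j \<in> compl_set D p \<Longrightarrow> char_K D j s = (if j \<in> A_plus D p then fst u j else inverse (snd u j))"
      using gauge_solve[OF dual, of "\<lambda>j. if j \<in> A_plus D p then fst u j else inverse (snd u j)"]
        fst snd dec sub' by (metis UnE inverse_nonzero_iff_nonzero lessThan_iff subsetD)
    have f: "char_K D i s * fst v0 i = fst u i" for i
    proof (cases "i < dimT D")
      case True
      then show ?thesis using fst[OF True] s(2)[of i] dec by (auto simp: v0_def)
    next
      case False
      then show ?thesis using out[OF False] sub' by (auto simp: v0_def)
    qed
    have g: "inverse (char_K D i s) * snd v0 i = snd u i" for i
    proof (cases "i < dimT D")
      case True
      then show ?thesis using snd[OF True] s(2)[of i] dec disj by (auto simp: v0_def)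
    next
      case False
      then show ?thesis using out[OF False] sub' by (auto simp: v0_def)
    qed
    have "u = gauge_act D s v0" unfolding gauge_act_def f g by simp
    then show ?thesis using s(1) by (auto simp: orbit_def)
  qed
  moreover have "u \<in> vertex_point D p" if u: "u \<in> orbit D v0" for u
  proof -
    obtain s where s: "s \<in> torus (dimK D)" "u = gauge_act D s v0" using u by (auto simp: orbit_def)
    have nz: "char_K D i s \<noteq> 0" for i by (rule char_K_nonzero[OF s(1)])
    have iff: "fst u i \<noteq> 0 \<longleftrightarrow> i \<in> A_plus D p" "snd u i \<noteq> 0 \<longleftrightarrow> i \<in> A_minus D p" for i
      unfolding s(2) using nz by (auto simp: gauge_act_def v0_def)
    have "fst u i * snd u i = 0" for i using iff[of i] disj by auto
    moreover have "fst u i = 0 \<and> snd u i = 0" if "i \<ge> dimT D" for i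
      using iff[of i] that sub' by force
    ultimately have "u \<in> moment_zero D" by (auto simp: moment_zero_def intro!: sum.neutral)
    then have "u \<in> semistable D"
      by (rule semistable_chart[OF dual sub]) (auto simp: iff A_plus_eq A_minus_eq)
    then show ?thesis using iff by (simp add: vertex_point_def)
  qed
  ultimately show "vertex_point D p = orbit D (ind_point (A_plus D p) (A_minus D p))"
    unfolding v0_def by blast
qed

lemma row_space_compl:
  assumes M: "\<And>l. l < dimT D \<Longrightarrow> M l = (\<Sum>r<dimA D. y r * beta D r l)" and j: "j \<in> compl_set D p"
  shows "M j = - (\<Sum>l\<in>p. C l j * M l)"
proof -
  have "M j = - (\<Sum>r<dimA D. y r * (\<Sum>l\<in>p. beta D r l * C l j))"
    using dualD(3)[OF j] M j by (simp add: sum_negf mult.commute compl_set_def)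
  also have "\<dots> = - (\<Sum>l\<in>p. (\<Sum>r<dimA D. y r * beta D r l) * C l j)"
    by (simp add: sum_sum_assoc)
  also have "\<dots> = - (\<Sum>l\<in>p. C l j * M l)"
    using M sub by (intro arg_cong[of _ _ uminus] sum.cong) (auto simp: mult.commute)
  finally show ?thesis .
qed

text \<open>Exponents in the row space of \<open>beta\<close> give gauge-invariant monomials and are
  determined by their entries in \<open>p\<close> (\<open>row_space_compl\<close>). The
  \<open>\<sigma>\<close>-weight of such a monomial can therefore be read off at any vertex.\<close>

lemma row_space_sigma:
  assumes M: "\<And>l. l < dimT D \<Longrightarrow> M l = (\<Sum>r<dimA D. y r * beta D r l)"
  shows "(\<Sum>l<dimT D. lift_sigma D l * M l) = (\<Sum>l\<in>p. M l * sigma_wt D p l)"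
proof -
  have "(\<Sum>j\<in>compl_set D p. lift_sigma D j * M j) = - (\<Sum>j\<in>compl_set D p. lift_sigma D j * (\<Sum>l\<in>p. C l j * M l))"
    using row_space_compl[OF M] by (simp add: sum_negf)
  also have "\<dots> = - (\<Sum>l\<in>p. (\<Sum>j\<in>compl_set D p. lift_sigma D j * C l j) * M l)"
    by (simp add: sum_sum_assoc)
  finally show ?thesis
    by (simp add: sum_split_compl[OF sub] sigma_wt_def right_diff_distrib sum_subtractf mult.commute)
qed

lemma row_space_vanishes:
  assumes M: "\<And>l. l < dimT D \<Longrightarrow> M l = (\<Sum>r<dimA D. y r * beta D r l)"
    and "weight_monom D M (ind_point (A_plus D p) (A_minus D p)) \<noteq> 0" and l: "l < dimT D"
  shows "M l = 0"
proof -
  have z: "M i = 0" if "i \<in> p" for i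
    using assms(2) that sub A_decomp(1) unfolding weight_monom_nonzero_iff compl_set_def
    by (metis DiffE UnCI ind_point_sel less_linear lessThan_iff subsetD)
  show ?thesis
  proof (cases "l \<in> p")
    case False
    then have "l \<in> compl_set D p" using l by (simp add: compl_set_def)
    then show ?thesis using row_space_compl[OF M] z by simp
  qed (rule z)
qed

lemma flat_wt:
  assumes "x \<in> flat D p"
  shows "j \<in> compl_set D p \<Longrightarrow> of_int (theta_wt D p j) = pair_beta D x j + of_int (lift_theta D j)"
    and "of_int (height D p) = (\<Sum>l<dimT D. of_int (lift_sigma D l) * (pair_beta D x l + of_int (lift_theta D l)))"
proof -
  show *: "of_int (theta_wt D p j) = pair_beta D x j + of_int (lift_theta D j)" if "j \<in> compl_set D p" for j
    using pair_beta_flat[OF dual sub assms that] by (simp add: theta_wt_def)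
  have "(\<Sum>l\<in>p. of_int (lift_sigma D l) * (pair_beta D x l + of_int (lift_theta D l))) = 0"
    using assms by (intro sum.neutral) (auto simp: flat_def hplane_def)
  then show "of_int (height D p) = (\<Sum>l<dimT D. of_int (lift_sigma D l) * (pair_beta D x l + of_int (lift_theta D l)))"
    by (simp add: sum_split_compl[OF sub] height_def *)
qed

text \<open>
  \<open>edge_sign\<close> is the direction of the edge at \<open>p\<close> leaving \<open>H\<^sub>i\<close> along which \<open>\<sigma>\<close> decreases. On the open edge
  \<open>z\<^sub>i \<noteq> 0\<close> if it is positive and \<open>w\<^sub>i \<noteq> 0\<close> if it is negative.
\<close>

definition edge_sign :: "nat \<Rightarrow> int" where
  "edge_sign i = (if sigma_wt D p i > 0 then -1 else 1)"

text \<open>On \<open>O_p\<close> this form lies in the lattice exactly on the elliptic cohomology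
  of the edge: \<open>x_i = 1\<close> where \<open>z_i \<noteq> 0\<close>, and
  \<open>\<hbar> x_i = 1\<close> where \<open>w_i \<noteq> 0\<close>.\<close>

definition edge_root :: "nat \<Rightarrow> (coord \<Rightarrow> complex) \<Rightarrow> complex" where
  "edge_root i P = xroot D i P + (if sigma_wt D p i > 0 then P Hbar else 0)"

lemma edge_sign_wt: "i \<in> p \<Longrightarrow> edge_sign i * sigma_wt D p i < 0"
  using sigma_wt_nz[of i] by (auto simp: edge_sign_def)

lemma Ell_compD:
  assumes "P \<in> Ell_comp \<tau> D p" "j \<in> compl_set D p"
  shows "theta_wt D p j > 0 \<Longrightarrow> xroot D j P \<in> lat \<tau>"
    and "theta_wt D p j < 0 \<Longrightarrow> P Hbar + xroot D j P \<in> lat \<tau>"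
proof -
  have "xroot D j P - xres D p j P \<in> lat \<tau>" using assms by (auto simp: Ell_comp_def compl_set_def)
  then show "theta_wt D p j > 0 \<Longrightarrow> xroot D j P \<in> lat \<tau>"
    and "theta_wt D p j < 0 \<Longrightarrow> P Hbar + xroot D j P \<in> lat \<tau>"
    using xres_compl[of j P] assms(2) by (auto simp: A_plus_eq A_minus_eq add.commute)
qed

lemma Ell_compI':
  assumes "P \<in> cspace (coords D)"
    and "\<And>j. j \<in> compl_set D p \<Longrightarrow> theta_wt D p j > 0 \<Longrightarrow> xroot D j P \<in> lat \<tau>"
    and "\<And>j. j \<in> compl_set D p \<Longrightarrow> theta_wt D p j < 0 \<Longrightarrow> P Hbar + xroot D j P \<in> lat \<tau>"
  shows "P \<in> Ell_comp \<tau> D p"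
proof (rule Ell_compI[OF assms(1)])
  fix j assume j: "j \<in> compl_set D p"
  then show "xroot D j P - xres D p j P \<in> lat \<tau>"
    using assms(2,3)[OF j] xres_compl[of j P] theta_wt_nz[OF j]
    by (cases "theta_wt D p j > 0") (auto simp: A_plus_eq A_minus_eq add.commute)
qed

text \<open>The edge ends at the first hyperplane it meets, that of \<open>m\<close>. No other
  hyperplane is crossed on the way, so the remaining signs are the same at both ends, while the sign
  at \<open>i\<close> becomes \<open>edge_sign i\<close>. The conditions for \<open>O_p\<close>
  together with the edge condition thus contain those for \<open>O_s\<close>.\<close>

lemma bounded_edge:
  assumes i: "i \<in> p" and j: "j \<in> compl_set D p" "edge_sign i * C i j * theta_wt D p j > 0"
  shows "\<exists>s\<in>fixed_sets D. height D s < height D p \<and>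
    (\<forall>P\<in>Ell_comp \<tau> D p. edge_root i P \<in> lat \<tau> \<longrightarrow> P \<in> Ell_comp \<tau> D s)"
proof -
  define \<delta> where "\<delta> = edge_sign i"
  \<comment> \<open>\<open>t l\<close> is the parameter along the edge at which the hyperplane of
    \<open>l\<close> is met, and \<open>H\<close> collects the hyperplanes met at positive
    parameters.\<close>
  define t where "t l = (of_int (theta_wt D p l) / of_int (\<delta> * C i l) :: real)" for l
  define H where "H = {l \<in> compl_set D p. \<delta> * C i l * theta_wt D p l > 0}"
  have "finite H" "H \<noteq> {}" using j by (auto simp: H_def \<delta>_def)
  then obtain m where m: "m \<in> H" "\<And>l. l \<in> H \<Longrightarrow> t m \<le> t l"
    using ex_min_if_finite[of "t ` H"] by (metis (no_types, lifting) finite_imageI image_iff image_is_empty not_le)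
  have mc: "m \<in> compl_set D p" "C i m \<noteq> 0" using m(1) by (auto simp: H_def)
  have tm: "t m > 0"
    using m(1) unfolding t_def H_def by (auto simp: zero_less_divide_iff zero_less_mult_iff of_int_mult[symmetric] simp del: of_int_mult)
  define s where "s = insert m (p - {i})"
  obtain x where x: "x \<in> flat D p" using fixed_setsD(4)[OF fixed] by blast
  have tm_eq: "of_int (theta_wt D p m) / of_int (C i m) = of_int \<delta> * t m"
    using mc(2) by (auto simp: t_def \<delta>_def edge_sign_def)
  obtain x' where s: "s \<in> fixed_sets D" and x': "x' \<in> flat D s"
    and pb: "\<And>l. pair_beta D x' l = pair_beta D x l + of_int \<delta> * t m * of_int (\<Sum>r<dimA D. b i r * beta D r l)"
    using exchange[OF dual fixed i mc x] unfolding s_def tm_eq by blast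
  obtain S' T' b' e' where "regular_vertex D s S' T' b' e'" using regular_vertexE[OF reg s] .
  then interpret s: regular_vertex D s S' T' b' e' .
  have pb_i: "pair_beta D x' i = - of_int (lift_theta D i) + of_int \<delta> * t m"
    unfolding pb using dualD(1)[OF i, of i] i sub x
    by (auto simp: flat_def hplane_def simp del: of_int_sum of_int_mult)
  have pb_c: "pair_beta D x' l = pair_beta D x l - of_int \<delta> * t m * of_int (C i l)" if "l \<in> compl_set D p" for l
    unfolding pb using dualD(1)[OF i, of l] that by (auto simp: compl_set_def simp del: of_int_sum of_int_mult)
  have wt_i: "of_int (theta_wt D s i) = of_int \<delta> * t m"
  proof -
    have "i \<in> compl_set D s" using i sub mc by (auto simp: s_def compl_set_def)
    then show ?thesis using s.flat_wt(1)[OF x'] pb_i by simp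
  qed
  have wt_c: "of_int (theta_wt D s l) = of_int (theta_wt D p l) - of_int \<delta> * t m * of_int (C i l)"
    if "l \<in> compl_set D p" "l \<noteq> m" for l
  proof -
    have "l \<in> compl_set D s" using that by (auto simp: s_def compl_set_def)
    then show ?thesis using s.flat_wt(1)[OF x'] pb_c[OF that(1)] flat_wt(1)[OF x that(1)] by simp
  qed
  have "height D s < height D p"
  proof -
    have "of_int (height D s) = of_int (height D p) + of_int \<delta> * t m *
        of_int (\<Sum>l<dimT D. lift_sigma D l * (\<Sum>r<dimA D. b i r * beta D r l))"
      unfolding flat_wt(2)[OF x] s.flat_wt(2)[OF x'] pb
      by (simp add: distrib_left sum.distrib sum_distrib_left mult_ac)
    also have "(\<Sum>l<dimT D. lift_sigma D l * (\<Sum>r<dimA D. b i r * beta D r l)) =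
        (\<Sum>l\<in>p. (\<Sum>r<dimA D. b i r * beta D r l) * sigma_wt D p l)"
      by (rule row_space_sigma) simp
    also have "\<dots> = (\<Sum>l\<in>p. (if l = i then 1 else 0) * sigma_wt D p l)"
      using dualD(1)[OF i] sub by (intro sum.cong) auto
    also have "\<dots> = sigma_wt D p i" using i by simp
    finally have eq: "of_int (height D s) = of_int (height D p) + t m * of_int (\<delta> * sigma_wt D p i)" by simp
    have "of_int (\<delta> * sigma_wt D p i) < (0 :: real)" using edge_sign_wt[OF i] by (simp add: \<delta>_def del: of_int_mult)
    then have "t m * of_int (\<delta> * sigma_wt D p i) < 0" using tm by (rule mult_pos_neg[rotated])
    then show ?thesis using eq by linarith
  qed
  moreover have "P \<in> Ell_comp \<tau> D s" if P: "P \<in> Ell_comp \<tau> D p" and e: "edge_root i P \<in> lat \<tau>" for P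
  proof -
    \<comment> \<open>Minimality of \<open>t m\<close> gives only weak inequalities, allowing the
      weight at \<open>s\<close> to be zero; regularity at \<open>s\<close> rules that out.\<close>
    have sgn: "(theta_wt D s l > 0 \<longleftrightarrow> theta_wt D p l > 0) \<and> (theta_wt D s l < 0 \<longleftrightarrow> theta_wt D p l < 0)"
      if l: "l \<in> compl_set D p" "l \<noteq> m" for l
    proof -
      have "l \<in> compl_set D s" using l by (auto simp: s_def compl_set_def)
      then have nz: "theta_wt D s l \<noteq> 0" "theta_wt D p l \<noteq> 0" using s.theta_wt_nz theta_wt_nz l by auto
      define w where "w = real_of_int (theta_wt D p l)"
      define c where "c = real_of_int (\<delta> * C i l)"
      have ws: "of_int (theta_wt D s l) = w - t m * c" using wt_c[OF l] by (simp add: w_def c_def)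
      have small: "t m \<le> w / c" if "c * w > 0"
      proof -
        have "real_of_int (\<delta> * C i l * theta_wt D p l) > 0" using that by (simp add: w_def c_def)
        then have "l \<in> H" using l(1) unfolding H_def of_int_0_less_iff by simp
        then show ?thesis using m(2) by (simp add: t_def w_def c_def)
      qed
      have "(w > 0 \<longrightarrow> w - t m * c \<ge> 0) \<and> (w < 0 \<longrightarrow> w - t m * c \<le> 0)"
      proof (cases "c * w > 0")
        case True
        then show ?thesis using small[OF True] by (auto simp: zero_less_mult_iff field_simps)
      next
        case False
        then show ?thesis using tm
          by (smt (verit) mult_nonneg_nonneg mult_nonneg_nonpos mult_pos_pos mult_neg_neg)
      qed
      then have "(w > 0 \<longrightarrow> real_of_int (theta_wt D s l) \<ge> 0) \<and> (w < 0 \<longrightarrow> real_of_int (theta_wt D s l) \<le> 0)"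
        unfolding ws .
      then have "(theta_wt D p l > 0 \<longrightarrow> theta_wt D s l \<ge> 0) \<and> (theta_wt D p l < 0 \<longrightarrow> theta_wt D s l \<le> 0)"
        by (simp add: w_def)
      then show ?thesis using nz by linarith
    qed
    have i_sgn: "(theta_wt D s i > 0 \<longrightarrow> \<not> sigma_wt D p i > 0) \<and> (theta_wt D s i < 0 \<longrightarrow> sigma_wt D p i > 0)"
    proof -
      have "(real_of_int (theta_wt D s i) > 0 \<longrightarrow> \<delta> = 1) \<and> (real_of_int (theta_wt D s i) < 0 \<longrightarrow> \<delta> = - 1)"
        unfolding wt_i using tm by (auto simp: \<delta>_def edge_sign_def)
      then show ?thesis by (auto simp: \<delta>_def edge_sign_def split: if_splits)
    qed
    have cases: "l = i \<or> l \<in> compl_set D p \<and> l \<noteq> m" if "l \<in> compl_set D s" for l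
      using that by (auto simp: s_def compl_set_def)
    show ?thesis
    proof (rule s.Ell_compI')
      show "P \<in> cspace (coords D)" using P by (simp add: Ell_comp_def)
    next
      fix l assume l: "l \<in> compl_set D s" and pos: "theta_wt D s l > 0"
      from cases[OF l] show "xroot D l P \<in> lat \<tau>"
      proof
        assume "l = i"
        then show ?thesis using e i_sgn pos by (simp add: edge_root_def)
      qed (use Ell_compD(1)[OF P] sgn pos in blast)
    next
      fix l assume l: "l \<in> compl_set D s" and neg: "theta_wt D s l < 0"
      from cases[OF l] show "P Hbar + xroot D l P \<in> lat \<tau>"
      proof
        assume "l = i"
        then show ?thesis using e i_sgn neg by (simp add: edge_root_def add.commute)
      qed (use Ell_compD(2)[OF P] sgn neg in blast)
    qed
  qed
  ultimately show ?thesis using s by blast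
qed

text \<open>The invariant monomial with exponents \<open>M\<close>, the edge direction paired with
  the columns of \<open>beta\<close>, has negative \<open>\<sigma>\<close>-weight and is nonzero at
  the edge point \<open>v\<close>: unboundedness says precisely that the signs of \<open>M\<close>
  are compatible with those of \<open>theta_wt\<close>. It vanishes at every fixed point. The final
  disjunction is the counterpart for the explicit product, one of whose theta factors it makes
  vanish along the edge.\<close>

lemma unbounded_edge:
  assumes i: "i \<in> p" and ub: "\<And>j. j \<in> compl_set D p \<Longrightarrow> edge_sign i * C i j * theta_wt D p j \<le> 0"
  shows "\<exists>v\<in>semistable D. (\<forall>P\<in>Ell_comp \<tau> D p. edge_root i P \<in> lat \<tau> \<longrightarrow> P \<in> Ell_orbit \<tau> D v) \<and>
    (\<forall>s\<in>fixed_sets D. orbit D v \<notin> full_Attr D (vertex_point D s) \<and>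
      ((\<exists>l\<in>p_plus D s. snd v l \<noteq> 0) \<or> (\<exists>l\<in>p_minus D s. fst v l \<noteq> 0)))"
proof -
  define \<delta> where "\<delta> = edge_sign i"
  have \<delta>: "\<delta> = 1 \<or> \<delta> = -1" by (simp add: \<delta>_def edge_sign_def)
  define y where "y r = \<delta> * b i r" for r
  define M where "M l = (\<Sum>r<dimA D. y r * beta D r l)" for l
  have M\<delta>: "M l = \<delta> * (\<Sum>r<dimA D. b i r * beta D r l)" for l
    by (simp add: M_def y_def sum_distrib_left mult.assoc)
  have Mi: "M i = \<delta>" and Mp: "\<And>l. l \<in> p \<Longrightarrow> l \<noteq> i \<Longrightarrow> M l = 0"
    and Mc: "\<And>l. l \<in> compl_set D p \<Longrightarrow> M l = - (\<delta> * C i l)"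
    using dualD(1)[OF i] i sub by (auto simp: M\<delta> compl_set_def)
  define A where "A = {l \<in> compl_set D p. theta_wt D p l > 0} \<union> (if \<delta> = 1 then {i} else {})"
  define B where "B = {l \<in> compl_set D p. theta_wt D p l < 0} \<union> (if \<delta> = 1 then {} else {i})"
  define v where "v = ind_point A B"
  have ic: "i \<notin> compl_set D p" "i < dimT D" using i sub by (auto simp: compl_set_def)
  have "v \<in> moment_zero D"
    unfolding v_def by (rule ind_point_moment_zero) (use ic in \<open>auto simp: A_def B_def compl_set_def\<close>)
  then have v: "v \<in> semistable D"
    by (rule semistable_chart[OF dual sub]) (auto simp: v_def A_def B_def)
  have Mv: "weight_monom D M v \<noteq> 0"
    unfolding weight_monom_nonzero_iff
  proof (intro allI impI)
    fix l assume l: "l < dimT D"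
    consider "l = i" | "l \<in> p" "l \<noteq> i" | "l \<in> compl_set D p" using l by (auto simp: compl_set_def)
    then show "(M l > 0 \<longrightarrow> fst v l \<noteq> 0) \<and> (M l < 0 \<longrightarrow> snd v l \<noteq> 0)"
    proof cases
      case 1
      then show ?thesis using \<delta> by (auto simp: Mi v_def A_def B_def)
    next
      case 2
      then show ?thesis by (simp add: Mp)
    next
      case 3
      have "\<delta> * C i l * theta_wt D p l \<le> 0" using ub[OF 3] by (simp add: \<delta>_def)
      then have "(\<delta> * C i l < 0 \<longrightarrow> theta_wt D p l > 0) \<and> (\<delta> * C i l > 0 \<longrightarrow> theta_wt D p l < 0)"
        using theta_wt_nz[OF 3] unfolding mult_le_0_iff[of "\<delta> * C i l"] by (smt (verit))
      then show ?thesis using 3 by (auto simp: Mc v_def A_def B_def)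
    qed
  qed
  have Minv: "(\<Sum>l<dimT D. iota D l a * M l) = 0" if a: "a < dimK D" for a
  proof -
    have "(\<Sum>l<dimT D. iota D l a * M l) = (\<Sum>l<dimT D. iota D l a * (\<Sum>r<dimA D. beta D r l * y r))"
      by (simp add: M_def mult.commute)
    also have "\<dots> = (\<Sum>r<dimA D. (\<Sum>l<dimT D. iota D l a * beta D r l) * y r)"
      by (rule sum_sum_assoc)
    also have "\<dots> = 0" using splittingD(4)[OF split _ a] by (simp add: mult.commute)
    finally show ?thesis .
  qed
  have Mneg: "(\<Sum>l<dimT D. lift_sigma D l * M l) < 0"
  proof -
    have "(\<Sum>l<dimT D. lift_sigma D l * M l) = (\<Sum>l\<in>p. M l * sigma_wt D p l)"
      by (rule row_space_sigma) (simp add: M_def)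
    also have "\<dots> = (\<Sum>l\<in>p. (if l = i then 1 else 0) * (\<delta> * sigma_wt D p l))"
      using Mi Mp by (intro sum.cong) auto
    also have "\<dots> = \<delta> * sigma_wt D p i" using i by simp
    finally show ?thesis using edge_sign_wt[OF i] by (simp add: \<delta>_def)
  qed
  have "P \<in> Ell_orbit \<tau> D v" if P: "P \<in> Ell_comp \<tau> D p" and e: "edge_root i P \<in> lat \<tau>" for P
  proof -
    have "(l \<in> A \<longrightarrow> xroot D l P \<in> lat \<tau>) \<and> (l \<in> B \<longrightarrow> P Hbar + xroot D l P \<in> lat \<tau>)" for l
      using Ell_compD[OF P] e
      by (auto simp: A_def B_def \<delta>_def edge_sign_def edge_root_def add.commute split: if_splits)
    then show ?thesis using P by (simp add: Ell_orbit_def Ell_comp_def v_def)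
  qed
  moreover have "orbit D v \<notin> full_Attr D (vertex_point D s) \<and>
      ((\<exists>l\<in>p_plus D s. snd v l \<noteq> 0) \<or> (\<exists>l\<in>p_minus D s. fst v l \<noteq> 0))" if s: "s \<in> fixed_sets D" for s
  proof
    obtain S' T' b' e' where "regular_vertex D s S' T' b' e'" using regular_vertexE[OF reg s] .
    then interpret s: regular_vertex D s S' T' b' e' .
    show "orbit D v \<notin> full_Attr D (vertex_point D s)"
    proof (rule not_in_full_Attr[OF Minv Mneg _ _ Mv])
      show "vertex_point D s \<in> points D"
        using s.vertex_point_orbit by (auto simp: points_def)
      fix u assume "u \<in> vertex_point D s"
      then have "weight_monom D M u = weight_monom D M (ind_point (A_plus D s) (A_minus D s))"
        unfolding s.vertex_point_orbit(2) by (rule weight_monom_orbit[rotated]) (rule Minv)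
      moreover have "weight_monom D M (ind_point (A_plus D s) (A_minus D s)) = 0"
      proof (rule ccontr)
        assume "weight_monom D M (ind_point (A_plus D s) (A_minus D s)) \<noteq> 0"
        then have "M i = 0" by (rule s.row_space_vanishes[rotated]) (use ic in \<open>auto simp: M_def\<close>)
        then show False using Mi \<delta> by auto
      qed
      ultimately show "weight_monom D M u = 0" by simp
    qed
    show "(\<exists>l\<in>p_plus D s. snd v l \<noteq> 0) \<or> (\<exists>l\<in>p_minus D s. fst v l \<noteq> 0)"
    proof (rule ccontr)
      \<comment> \<open>Then \<open>M l\<close> and \<open>sigma_wt D s l\<close> never have
        opposite signs on \<open>s\<close>, and the weight computed at \<open>s\<close> would be
        nonnegative.\<close>
      assume not: "\<not> ?thesis"
      have "M l * sigma_wt D s l \<ge> 0" if l: "l \<in> s" for l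
      proof -
        have ln: "l < dimT D" using l s.sub by blast
        have "l \<in> p_plus D s \<or> l \<in> p_minus D s" using l s.p_decomp(1) by blast
        then show ?thesis
        proof
          assume lp: "l \<in> p_plus D s"
          then have "\<not> M l < 0" using not Mv ln unfolding weight_monom_nonzero_iff by blast
          then show ?thesis using lp by (simp add: s.p_plus_eq)
        next
          assume lm: "l \<in> p_minus D s"
          then have "\<not> M l > 0" using not Mv ln unfolding weight_monom_nonzero_iff by blast
          then show ?thesis using lm by (simp add: s.p_minus_eq mult_nonpos_nonpos)
        qed
      qed
      then have "(\<Sum>l\<in>s. M l * sigma_wt D s l) \<ge> 0" by (rule sum_nonneg)
      moreover have "(\<Sum>l<dimT D. lift_sigma D l * M l) = (\<Sum>l\<in>s. M l * sigma_wt D s l)"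
        by (rule s.row_space_sigma) (simp add: M_def)
      ultimately show False using Mneg by simp
    qed
  qed
  ultimately show ?thesis using v by blast
qed

end

section \<open>Uniqueness of stable envelopes\<close>

lemma finite_coord_sets [simp]:
  "finite (coords D)" "finite (kahler_coords D)" "finite (param_coords D)"
  by (simp_all add: coords_def kahler_coords_def param_coords_def)

lemma kahler_subset: "kahler_coords D \<subseteq> coords D" "kahler_coords D \<subseteq> param_coords D"
  by (auto simp: coords_def kahler_coords_def param_coords_def)

lemma xroot_form: "i < dimT D \<Longrightarrow> int_form (coords D) (xroot D i)"
  unfolding xroot_def[abs_def]
  by (intro int_form_add int_form_sum int_form_scale int_form_coord) (auto simp: coords_def)

lemma Hbar_form: "int_form (kahler_coords D) (\<lambda>P. P Hbar)"
  by (intro int_form_coord) (auto simp: kahler_coords_def)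

lemma Hbar_form': "int_form (coords D) (\<lambda>P. P Hbar)"
  by (rule int_form_mono[OF Hbar_form kahler_subset(1)]) simp

lemma zeta_shift_form:
  assumes "p \<subseteq> {..<dimT D}" "j < dimT D"
  shows "int_form (kahler_coords D) (zeta_shift D p j)"
proof -
  have "int_form (kahler_coords D) (\<lambda>P. P (Kahler j) + (\<Sum>i\<in>p. of_int (coef D p i j) * P (Kahler i)) -
      of_int (\<Sum>i\<in>p_plus D p. coef D p i j) * P Hbar)"
    by (intro int_form_diff int_form_add int_form_sum int_form_scale int_form_coord Hbar_form)
       (use assms in \<open>auto simp: kahler_coords_def\<close>)
  then show ?thesis unfolding zeta_shift_def[abs_def] zeta_def .
qed

lemma zeta_shift_form':
  assumes "p \<subseteq> {..<dimT D}" "j < dimT D"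
  shows "int_form (coords D) (zeta_shift D p j)"
  by (rule int_form_mono[OF zeta_shift_form[OF assms] kahler_subset(1)]) simp

section \<open>The explicit product as a section, and its slices\<close>

definition stab_formula :: "complex \<Rightarrow> hypertoric \<Rightarrow> nat set \<Rightarrow> (coord \<Rightarrow> complex) \<Rightarrow> complex" where
  "stab_formula \<tau> D p P = T_prod D p (\<lambda>l. theta \<tau> (l P))"

lemma T_prod_mult: "T_prod D p (\<lambda>l. G l * H l) = T_prod D p G * T_prod D p H"
  unfolding T_prod_def times_divide_times_eq[symmetric] prod.distrib by (simp only: mult_ac)

lemma vadd_single: "P(c := u + v) = vadd (P(c := u)) ((\<lambda>_. 0)(c := v))"
  by (auto simp: vadd_def)

lemma xroot_upd: "i < dimT D \<Longrightarrow> xroot D l (P(Equiv i := u)) = xroot D l P + (if l = i then u - P (Equiv i) else 0)"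
  by (simp add: xroot_def)

lemma zeta_shift_upd [simp]: "zeta_shift D p l (P(Equiv i := u)) = zeta_shift D p l P"
  by (simp add: zeta_shift_def zeta_def)

lemma restrict_kahler_upd [simp]:
  "restrict_coords (kahler_coords D) (P(Equiv i := u)) = restrict_coords (kahler_coords D) P"
  by (auto simp: restrict_coords_def kahler_coords_def)

text \<open>A line contained in \<open>Y\<close> meets the domain of each local extension in an open
  set, on which \<open>F\<close> agrees with a function holomorphic in the coordinate
  \<open>c\<close>.\<close>

lemma holo_sub_slice:
  assumes F: "holo_sub I Y F" and Y: "\<And>u. P(c := u) \<in> Y" and c: "c \<in> I" and sub: "Y \<subseteq> cspace I"
  shows "(\<lambda>u. F (P(c := u))) holomorphic_on UNIV"
proof -
  have "(\<lambda>u. F (P(c := u))) field_differentiable at u0" for u0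
  proof -
    obtain W G where W: "P(c := u0) \<in> W" "holo_open I W G" and G: "\<And>Q. Q \<in> W \<inter> Y \<Longrightarrow> F Q = G Q"
      using F Y unfolding holo_sub_def by metis
    then have "(\<lambda>u. G ((P(c := u0))(c := u))) field_differentiable at ((P(c := u0)) c)"
      using c unfolding holo_open_def by blast
    then have dG: "(\<lambda>u. G (P(c := u))) field_differentiable at u0" by simp
    obtain V where V: "open V" "W = cspace I \<inter> V"
      using W(2) unfolding holo_open_def openin_open by blast
    have "continuous_on UNIV (\<lambda>u. P(c := u))"
    proof (rule continuous_on_coordinatewise_then_product)
      fix d show "continuous_on UNIV (\<lambda>u. (P(c := u)) d)" by (cases "d = c") (auto intro!: continuous_intros)
    qed
    then have "open ((\<lambda>u. P(c := u)) -` V)" using V(1) by (rule open_vimage[rotated])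
    moreover have "u0 \<in> (\<lambda>u. P(c := u)) -` V" using W V by auto
    ultimately have "eventually (\<lambda>u. u \<in> (\<lambda>u. P(c := u)) -` V) (nhds u0)" by (rule eventually_nhds_in_open)
    then have "eventually (\<lambda>u. F (P(c := u)) = G (P(c := u))) (nhds u0)"
    proof eventually_elim
      case (elim u)
      then show ?case using Y[of u] sub V by (intro G) auto
    qed
    from DERIV_cong_ev[OF refl this refl] show ?thesis
      using dG unfolding field_differentiable_def by simp
  qed
  then show ?thesis by (simp add: holomorphic_on_def)
qed

context regular_vertex
begin

lemma parts_lt:
  "l \<in> p_plus D p \<Longrightarrow> l < dimT D" "l \<in> p_minus D p \<Longrightarrow> l < dimT D"
  "l \<in> A_plus D p \<Longrightarrow> l < dimT D" "l \<in> A_minus D p \<Longrightarrow> l < dimT D"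
  using sub by (auto simp: p_plus_def p_minus_def A_plus_def A_minus_def compl_set_def)

lemma T_prod_cong:
  assumes "\<And>l. int_form (coords D) l \<Longrightarrow> G l = H l"
  shows "T_prod D p G = T_prod D p H"
proof -
  have 1: "G (\<lambda>P. P Hbar + xroot D i P) = H (\<lambda>P. P Hbar + xroot D i P)" "G (\<lambda>P. xroot D i P) = H (\<lambda>P. xroot D i P)"
    "G (\<lambda>P. xroot D i P + zeta_shift D p i P) = H (\<lambda>P. xroot D i P + zeta_shift D p i P)"
    "G (\<lambda>P. zeta_shift D p i P) = H (\<lambda>P. zeta_shift D p i P)"
    "G (\<lambda>P. - P Hbar + zeta_shift D p i P) = H (\<lambda>P. - P Hbar + zeta_shift D p i P)" if "i < dimT D" for i
    using that sub
    by (intro assms int_form_add int_form_minus xroot_form zeta_shift_form' Hbar_form'; simp)+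
  show ?thesis unfolding T_prod_def
    by (intro arg_cong2[of _ _ _ _ "(*)"] prod.cong refl) (simp_all add: 1 parts_lt del: uminus_add_conv_diff)
qed

lemma stab_formula_quasi:
  assumes \<tau>: "Im \<tau> > 0" and L: "L \<in> lat_vec \<tau> (coords D)"
  shows "stab_formula \<tau> D p (vadd P L) = T_bundle \<tau> D p L P * stab_formula \<tau> D p P"
  unfolding stab_formula_def T_bundle_def T_prod_mult[symmetric]
  by (rule T_prod_cong) (simp add: int_form_vadd theta_add_lat[OF \<tau>] int_form_lat[OF _ L])

text \<open>For \<open>i \<notin> p\<close> the parameter \<open>a_i\<close> occurs only in
  \<open>x_i\<close>, and \<open>x_i\<close> only in one numerator factor. This is the source of
  degree one.\<close>

lemma T_bundle_shift:
  assumes i: "i \<in> compl_set D p"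
  shows "T_bundle \<tau> D p ((\<lambda>_. 0)(Equiv i := v)) P = theta_mult \<tau> v (xroot D i P + zeta_shift D p i P)"
proof -
  have in': "i < dimT D" "i \<notin> p" using i by (auto simp: compl_set_def)
  let ?L = "(\<lambda>_. 0)(Equiv i := v) :: coord \<Rightarrow> complex"
  have z: "zeta_shift D p j ?L = 0" for j by (simp add: zeta_shift_def zeta_def)
  have x: "xroot D l ?L = (if l = i then v else 0)" for l using in' by (simp add: xroot_def)
  have np: "l \<noteq> i" if "l \<in> p_plus D p \<or> l \<in> p_minus D p" for l
    using that in' by (auto simp: p_plus_def p_minus_def)
  let ?X = "theta_mult \<tau> v (xroot D i P + zeta_shift D p i P)"
  have 1: "(\<Prod>l\<in>p_plus D p. theta_mult \<tau> (?L Hbar + xroot D l ?L) (P Hbar + xroot D l P)) = 1"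
    "(\<Prod>l\<in>p_minus D p. theta_mult \<tau> (xroot D l ?L) (xroot D l P)) = 1"
    using np by (auto simp: x intro!: prod.neutral)
  have 2: "theta_mult \<tau> (xroot D j ?L + 0) (xroot D j P + zeta_shift D p j P) =
      (if j = i then ?X else 1)" for j
    unfolding x by simp
  have "T_bundle \<tau> D p ?L P = (\<Prod>j\<in>A_plus D p. if j = i then ?X else 1) * (\<Prod>j\<in>A_minus D p. if j = i then ?X else 1)"
    unfolding T_bundle_def T_prod_def z 1 2 by simp
  also have "\<dots> = ?X" using i A_decomp by auto
  finally show ?thesis .
qed

text \<open>The conditions at \<open>j \<notin> p\<close> cut out the component and do not involve
  \<open>a_i\<close> for \<open>i \<in> p\<close>, so the whole line lies in it.\<close>

lemma Ell_comp_upd: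
  assumes P: "P \<in> Ell_comp \<tau> D p" and i: "i \<in> p"
  shows "P(Equiv i := u) \<in> Ell_comp \<tau> D p"
proof (rule Ell_compI')
  have il: "i < dimT D" using i sub by auto
  show "P(Equiv i := u) \<in> cspace (coords D)"
    using P il by (intro cspace_upd) (auto simp: Ell_comp_def coords_def)
  fix j assume j: "j \<in> compl_set D p"
  then have "j \<noteq> i" using i by (auto simp: compl_set_def)
  then show "theta_wt D p j > 0 \<Longrightarrow> xroot D j (P(Equiv i := u)) \<in> lat \<tau>"
    "theta_wt D p j < 0 \<Longrightarrow> (P(Equiv i := u)) Hbar + xroot D j (P(Equiv i := u)) \<in> lat \<tau>"
    using Ell_compD[OF P j] il by (simp_all add: xroot_upd)
qed

lemma xres_lift: "xres D p l (lift_point D p P) = xres D p l P"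
  using lift_point(2)[of P] lift_point(3,4)[of _ P] sub by (auto simp: xres_def compl_set_def intro!: sum.cong)

lemma zeta_shift_lift:
  assumes "j < dimT D"
  shows "zeta_shift D p j (lift_point D p P) = zeta_shift D p j P"
  using lift_point(2)[of P] lift_point(3,4)[of _ P] sub assms by (auto simp: zeta_shift_def zeta_def intro!: sum.cong)

lemma restrict_lift:
  "restrict_coords (kahler_coords D) (lift_point D p P) = restrict_coords (kahler_coords D) P"
  using lift_point(2)[of P] lift_point(3,4)[of _ P] by (auto simp: restrict_coords_def kahler_coords_def fun_eq_iff)

lemma lift_in_Ell_comp: "lift_point D p P \<in> Ell_comp \<tau> D p"
  unfolding Ell_comp_def by (auto simp: lift_point xres_lift)

text \<open>A point of \<open>O_p\<close> and the lift of its parameters differ only in Chern roots,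
  and there by lattice elements. Quasi-periodicity thus extends the normalization at
  \<open>p\<close> from lifts to the whole component.\<close>

lemma Ell_comp_lift_diff:
  assumes P: "P \<in> Ell_comp \<tau> D p"
  defines "L \<equiv> (\<lambda>c. P c - lift_point D p P c)"
  shows "L \<in> lat_vec \<tau> (coords D)" "P = vadd (lift_point D p P) L"
proof -
  let ?Q = "lift_point D p P"
  have Lg: "L (Gauge a) \<in> lat \<tau>" if "a < dimK D" for a
  proof (rule gauge_lat[OF _ that, of "\<lambda>a. L (Gauge a)"])
    fix i assume i: "i < dimT D"
    have "(\<Sum>a<dimK D. of_int (iota D i a) * L (Gauge a)) = xroot D i P - xroot D i ?Q"
      using lift_point(3)[OF i, of P] by (simp add: L_def xroot_def right_diff_distrib sum_subtractf)
    also have "\<dots> \<in> lat \<tau>" using P i by (simp add: lift_point Ell_comp_def)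
    finally show "(\<Sum>a<dimK D. of_int (iota D i a) * L (Gauge a)) \<in> lat \<tau>" .
  qed
  have L0: "L c = 0" if "c \<notin> Gauge ` {..<dimK D}" for c
  proof (cases "c \<in> coords D")
    case True
    then show ?thesis using that lift_point(2)[of P] lift_point(3,4)[of _ P] by (auto simp: coords_def L_def)
  next
    case False
    have "P \<in> cspace (coords D)" using P by (simp add: Ell_comp_def)
    then have "P c = 0" using False by (rule cspace_outside)
    moreover have "lift_point D p P c = 0" using lift_point(1) False by (rule cspace_outside)
    ultimately show ?thesis by (simp add: L_def)
  qed
  show "L \<in> lat_vec \<tau> (coords D)"
    unfolding lat_vec_def cspace_def
  proof (intro CollectI conjI allI impI ballI)
    show "L c = 0" if "c \<notin> coords D" for c using that L0 by (auto simp: coords_def)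
    show "L c \<in> lat \<tau>" for c using L0[of c] Lg by (cases "c \<in> Gauge ` {..<dimK D}") auto
  qed
  show "P = vadd ?Q L" by (auto simp: vadd_def L_def)
qed

text \<open>
  The two-argument \<open>\<gamma>\<close> covers both the multiplier of a product of theta functions, where it is \<open>theta_mult \<tau>\<close>,
  and the product itself, where it ignores its first argument.
\<close>

lemma T_prod_lift:
  fixes \<gamma> :: "complex \<Rightarrow> complex \<Rightarrow> complex"
  assumes "\<And>j. j \<in> compl_set D p \<Longrightarrow> \<gamma> (zeta_shift D p j L) (zeta_shift D p j P) \<noteq> 0 \<and>
    \<gamma> (- L Hbar + zeta_shift D p j L) (- P Hbar + zeta_shift D p j P) \<noteq> 0"
  shows "T_prod D p (\<lambda>l. \<gamma> (l (lift_point D p L)) (l (lift_point D p P))) =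
    (\<Prod>i\<in>p_plus D p. \<gamma> (L Hbar + xres D p i L) (P Hbar + xres D p i P)) *
    (\<Prod>i\<in>p_minus D p. \<gamma> (xres D p i L) (xres D p i P))"
proof -
  have c: "j \<in> A_plus D p \<or> j \<in> A_minus D p \<Longrightarrow> j \<in> compl_set D p" for j by (auto simp: A_plus_def A_minus_def)
  let ?l = "lift_point D p L" and ?q = "lift_point D p P"
  have "(\<Prod>j\<in>A_plus D p. \<gamma> (xroot D j ?l + zeta_shift D p j ?l) (xroot D j ?q + zeta_shift D p j ?q) /
        \<gamma> (zeta_shift D p j ?l) (zeta_shift D p j ?q)) = 1"
    using assms c by (intro prod.neutral) (auto simp: lift_point parts_lt zeta_shift_lift xres_compl)
  moreover have "(\<Prod>j\<in>A_minus D p. \<gamma> (xroot D j ?l + zeta_shift D p j ?l) (xroot D j ?q + zeta_shift D p j ?q) /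
        \<gamma> (- ?l Hbar + zeta_shift D p j ?l) (- ?q Hbar + zeta_shift D p j ?q)) = 1"
    using assms c by (intro prod.neutral) (auto simp: lift_point parts_lt zeta_shift_lift xres_compl)
  moreover have "(\<Prod>i\<in>p_plus D p. \<gamma> (?l Hbar + xroot D i ?l) (?q Hbar + xroot D i ?q)) =
      (\<Prod>i\<in>p_plus D p. \<gamma> (L Hbar + xres D p i L) (P Hbar + xres D p i P))"
    by (intro prod.cong) (auto simp: lift_point parts_lt)
  moreover have "(\<Prod>i\<in>p_minus D p. \<gamma> (xroot D i ?l) (xroot D i ?q)) = (\<Prod>i\<in>p_minus D p. \<gamma> (xres D p i L) (xres D p i P))"
    by (intro prod.cong) (auto simp: lift_point parts_lt)
  ultimately show ?thesis unfolding T_prod_def by simp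
qed

lemma stab_formula_lift:
  assumes "\<And>j. j \<in> compl_set D p \<Longrightarrow> theta \<tau> (zeta_shift D p j P) \<noteq> 0 \<and> theta \<tau> (- P Hbar + zeta_shift D p j P) \<noteq> 0"
  shows "stab_formula \<tau> D p (lift_point D p P) =
    (\<Prod>i\<in>p_plus D p. theta \<tau> (P Hbar + xres D p i P)) * (\<Prod>i\<in>p_minus D p. theta \<tau> (xres D p i P))"
  unfolding stab_formula_def by (rule T_prod_lift[of "\<lambda>_. theta \<tau>", OF assms])

lemma theta_prod_form_slice:
  assumes \<tau>: "Im \<tau> > 0" and "\<And>j. j \<in> B \<Longrightarrow> int_form (coords D) (l j)" "P \<in> cspace (coords D)" "i < dimT D"
  shows "(\<lambda>u. \<Prod>j\<in>B. theta \<tau> (l j (P(Equiv i := u)))) holomorphic_on UNIV"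
  by (rule holo_open_slice[OF holo_open_prod[OF entire_theta_form[OF \<tau> assms(2)]] assms(3)])
     (use assms(4) in \<open>auto simp: coords_def\<close>)

lemma stab_formula_slice:
  assumes \<tau>: "Im \<tau> > 0" and P: "P \<in> cspace (coords D)" and i: "i < dimT D"
  shows "(\<lambda>u. stab_formula \<tau> D p (P(Equiv i := u))) holomorphic_on UNIV"
proof -
  \<comment> \<open>The denominators do not involve \<open>a_i\<close>, so along the slice they
    contribute the constant factor \<open>inverse c\<close>.\<close>
  define c where "c = (\<Prod>j\<in>A_plus D p. theta \<tau> (zeta_shift D p j P)) * (\<Prod>j\<in>A_minus D p. theta \<tau> (- P Hbar + zeta_shift D p j P))"
  have "(\<lambda>u. (\<Prod>j\<in>p_plus D p. theta \<tau> ((P(Equiv i := u)) Hbar + xroot D j (P(Equiv i := u)))) *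
      (\<Prod>j\<in>p_minus D p. theta \<tau> (xroot D j (P(Equiv i := u)))) *
      (\<Prod>j\<in>A_plus D p. theta \<tau> (xroot D j (P(Equiv i := u)) + zeta_shift D p j (P(Equiv i := u)))) *
      (\<Prod>j\<in>A_minus D p. theta \<tau> (xroot D j (P(Equiv i := u)) + zeta_shift D p j (P(Equiv i := u)))) * inverse c) holomorphic_on UNIV"
    using sub
    by (intro holomorphic_on_mult holomorphic_on_const
          theta_prod_form_slice[OF \<tau> _ P i, of _ "\<lambda>j P. P Hbar + xroot D j P"]
          theta_prod_form_slice[OF \<tau> _ P i, of _ "\<lambda>j P. xroot D j P"]
          theta_prod_form_slice[OF \<tau> _ P i, of _ "\<lambda>j P. xroot D j P + zeta_shift D p j P"]
          int_form_add Hbar_form' xroot_form zeta_shift_form' parts_lt)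
  moreover have "stab_formula \<tau> D p (P(Equiv i := u)) =
      (\<Prod>j\<in>p_plus D p. theta \<tau> ((P(Equiv i := u)) Hbar + xroot D j (P(Equiv i := u)))) *
      (\<Prod>j\<in>p_minus D p. theta \<tau> (xroot D j (P(Equiv i := u)))) *
      (\<Prod>j\<in>A_plus D p. theta \<tau> (xroot D j (P(Equiv i := u)) + zeta_shift D p j (P(Equiv i := u)))) *
      (\<Prod>j\<in>A_minus D p. theta \<tau> (xroot D j (P(Equiv i := u)) + zeta_shift D p j (P(Equiv i := u)))) * inverse c" for u
    unfolding stab_formula_def T_prod_def c_def prod_dividef by (simp add: divide_inverse mult_ac)
  ultimately show ?thesis by simp
qed

text \<open>Fixing the Kaehler coordinates and \<open>Hbar\<close> at a good value
  \<open>\<kappa>\<close> removes all poles. The induction never leaves this slice, since it varies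
  only Chern roots and the \<open>a_i\<close>; it is organized by the number of lower
  vertices.\<close>

lemma stable_envelope_unique_slice:
  assumes \<tau>: "Im \<tau> > 0"
    and quasi: "\<And>P L. P \<in> Ell \<tau> D \<Longrightarrow> restrict_coords (kahler_coords D) P = \<kappa> \<Longrightarrow> L \<in> lat_vec \<tau> (coords D) \<Longrightarrow>
      restrict_coords (kahler_coords D) (vadd P L) = \<kappa> \<Longrightarrow> f (vadd P L) = T_bundle \<tau> D p L P * f P"
    and holo: "\<And>P i. restrict_coords (kahler_coords D) P = \<kappa> \<Longrightarrow> i < dimT D \<Longrightarrow>
      (\<And>u. P(Equiv i := u) \<in> Ell \<tau> D) \<Longrightarrow> (\<lambda>u. f (P(Equiv i := u))) holomorphic_on UNIV"
    and supp: "\<And>P v. restrict_coords (kahler_coords D) P = \<kappa> \<Longrightarrow> v \<in> semistable D \<Longrightarrow>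
      orbit D v \<notin> full_Attr D (vertex_point D p) \<Longrightarrow> P \<in> Ell_orbit \<tau> D v \<Longrightarrow> f P = 0"
    and diag: "\<And>P. restrict_coords (kahler_coords D) P = \<kappa> \<Longrightarrow>
      f (lift_point D p P) = (\<Prod>i\<in>p_plus D p. theta \<tau> (P Hbar + xres D p i P)) * (\<Prod>i\<in>p_minus D p. theta \<tau> (xres D p i P))"
    and gen: "\<And>P j. restrict_coords (kahler_coords D) P = \<kappa> \<Longrightarrow> j \<in> compl_set D p \<Longrightarrow>
      zeta_shift D p j P \<notin> lat \<tau> \<and> zeta_shift D p j P - P Hbar \<notin> lat \<tau>"
  shows "r \<in> fixed_sets D \<Longrightarrow> P \<in> Ell_comp \<tau> D r \<Longrightarrow> restrict_coords (kahler_coords D) P = \<kappa> \<Longrightarrow>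
    f P = stab_formula \<tau> D p P"
proof (induction "card {s \<in> fixed_sets D. height D s < height D r}" arbitrary: r P rule: less_induct)
  case less
  have fin_fixed: "finite (fixed_sets D)"
    by (rule finite_subset[of _ "Pow {..<dimT D}"]) (auto simp: fixed_sets_def)
  show ?case
  proof (cases "r = p")
    case True
    define L where "L = (\<lambda>c. P c - lift_point D p P c)"
    have P: "P \<in> Ell_comp \<tau> D p" using less.prems True by simp
    note L = Ell_comp_lift_diff[OF P, folded L_def]
    let ?Q = "lift_point D p P"
    have Q: "?Q \<in> Ell \<tau> D" using lift_in_Ell_comp fixed by (auto simp: Ell_def)
    have "f P = T_bundle \<tau> D p L ?Q * f ?Q"
      using quasi[OF Q _ L(1)] L(2) restrict_lift[of P] less.prems(3) by metis
    also have "f ?Q = stab_formula \<tau> D p ?Q"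
      using diag[OF less.prems(3)] gen[OF less.prems(3)]
      by (subst stab_formula_lift) (auto simp: theta_eq_0_iff[OF \<tau>] add.commute)
    also have "T_bundle \<tau> D p L ?Q * stab_formula \<tau> D p ?Q = stab_formula \<tau> D p P"
      using stab_formula_quasi[OF \<tau> L(1), of ?Q] L(2) by simp
    finally show ?thesis .
  next
    case False
    obtain S' T' b' e' where "regular_vertex D r S' T' b' e'" using regular_vertexE[OF reg less.prems(1)] .
    then interpret r: regular_vertex D r S' T' b' e' .
    \<comment> \<open>Both sets have \<open>dimA D\<close> elements, so an inclusion would be an
      equality.\<close>
    have "\<not> r \<subseteq> p"
      using False fixed_setsD(3)[OF fixed] fixed_setsD(3)[OF less.prems(1)] card_subset_eq[OF fin, of r] by auto
    then obtain i where i: "i \<in> r" "i \<notin> p" by blast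
    have il: "i < dimT D" using i(1) r.sub by auto
    have ic: "i \<in> compl_set D p" using il i by (simp add: compl_set_def)
    have on_edge: "f Q = stab_formula \<tau> D p Q"
      if Q: "Q \<in> Ell_comp \<tau> D r" "restrict_coords (kahler_coords D) Q = \<kappa>" "r.edge_root i Q \<in> lat \<tau>" for Q
    proof (cases "\<exists>j\<in>compl_set D r. r.edge_sign i * coef D r i j * theta_wt D r j > 0")
      case True
      then obtain s where s: "s \<in> fixed_sets D" "height D s < height D r" "Q \<in> Ell_comp \<tau> D s"
        using r.bounded_edge[OF i(1), of _ \<tau>] Q by blast
      have "card {s' \<in> fixed_sets D. height D s' < height D s} < card {s' \<in> fixed_sets D. height D s' < height D r}"
        using s fin_fixed by (intro psubset_card_mono) auto
      then show ?thesis using less.hyps s Q by blast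
    next
      case False
      then obtain v where v: "v \<in> semistable D" "Q \<in> Ell_orbit \<tau> D v" "orbit D v \<notin> full_Attr D (vertex_point D p)"
          "(\<exists>l\<in>p_plus D p. snd v l \<noteq> 0) \<or> (\<exists>l\<in>p_minus D p. fst v l \<noteq> 0)"
        using r.unbounded_edge[OF i(1), of \<tau>] Q fixed by (auto simp: not_less)
      have "f Q = 0" by (rule supp[OF Q(2) v(1,3,2)])
      moreover have "stab_formula \<tau> D p Q = 0"
      proof -
        have "l \<in> p_plus D p \<Longrightarrow> snd v l \<noteq> 0 \<Longrightarrow> theta \<tau> (Q Hbar + xroot D l Q) = 0"
          "l \<in> p_minus D p \<Longrightarrow> fst v l \<noteq> 0 \<Longrightarrow> theta \<tau> (xroot D l Q) = 0" for l
          using v(2) parts_lt[of l] by (simp_all add: Ell_orbit_def theta_eq_0_iff[OF \<tau>])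
        then have "(\<exists>l\<in>p_plus D p. theta \<tau> (Q Hbar + xroot D l Q) = 0) \<or> (\<exists>l\<in>p_minus D p. theta \<tau> (xroot D l Q) = 0)"
          using v(4) by blast
        then have "(\<Prod>l\<in>p_plus D p. theta \<tau> (Q Hbar + xroot D l Q)) = 0 \<or> (\<Prod>l\<in>p_minus D p. theta \<tau> (xroot D l Q)) = 0"
          by (auto simp: prod_zero_iff)
        then show ?thesis by (auto simp: stab_formula_def T_prod_def)
      qed
      ultimately show ?thesis by simp
    qed
    have PE: "P(Equiv i := u) \<in> Ell_comp \<tau> D r" for u by (rule r.Ell_comp_upd[OF less.prems(2) i(1)])
    then have PEll: "P(Equiv i := u) \<in> Ell \<tau> D" for u using less.prems(1) by (auto simp: Ell_def)
    have PR: "restrict_coords (kahler_coords D) (P(Equiv i := u)) = \<kappa>" for u using less.prems(3) by simp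
    have Pc: "P \<in> cspace (coords D)" using less.prems(2) by (simp add: Ell_comp_def)
    define h where "h = (\<lambda>u. f (P(Equiv i := u)) - stab_formula \<tau> D p (P(Equiv i := u)))"
    define x0 where "x0 = xroot D i P - P (Equiv i)"
    have x0: "xroot D i (P(Equiv i := u)) = u + x0" for u using il by (simp add: xroot_upd x0_def)
    \<comment> \<open>With \<open>u = a_i\<close> the edge condition reads
      \<open>u + x0 + \<epsilon> \<in> lat \<tau>\<close>. Compared with the quasi-periods, centred
      at \<open>x0 + zeta_shift D p i P\<close>, the difference is \<open>zeta_shift\<close> or
      \<open>zeta_shift - Hbar\<close>, the two forms that \<open>gen\<close> keeps off the
      lattice.\<close>
    define \<epsilon> where "\<epsilon> = (if sigma_wt D r i > 0 then P Hbar else 0)"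
    have shift: "h (u + v) = theta_mult \<tau> v (u + (x0 + zeta_shift D p i P)) * h u" if v: "v \<in> lat \<tau>" for u v
    proof -
      define L :: "coord \<Rightarrow> complex" where "L = (\<lambda>_. 0)(Equiv i := v)"
      have L: "L \<in> lat_vec \<tau> (coords D)" using v il by (auto simp: L_def lat_vec_def cspace_def coords_def)
      have e: "P(Equiv i := u + v) = vadd (P(Equiv i := u)) L" unfolding L_def by (rule vadd_single)
      have T: "T_bundle \<tau> D p L (P(Equiv i := u)) = theta_mult \<tau> v (u + (x0 + zeta_shift D p i P))"
        unfolding L_def T_bundle_shift[OF ic] x0 by (simp add: add_ac)
      have "f (P(Equiv i := u + v)) = T_bundle \<tau> D p L (P(Equiv i := u)) * f (P(Equiv i := u))"
        unfolding e by (rule quasi[OF PEll PR L]) (use PR[of "u + v"] in \<open>simp add: e[symmetric]\<close>)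
      moreover have "stab_formula \<tau> D p (P(Equiv i := u + v)) = T_bundle \<tau> D p L (P(Equiv i := u)) * stab_formula \<tau> D p (P(Equiv i := u))"
        unfolding e by (rule stab_formula_quasi[OF \<tau> L])
      ultimately show ?thesis unfolding h_def T by (simp add: right_diff_distrib)
    qed
    have "h (P (Equiv i)) = 0"
    proof (rule theta_degree_one_eq_0[OF \<tau>, where h = h and u = "P (Equiv i)" and c = "x0 + zeta_shift D p i P" and e = "x0 + \<epsilon>"])
      show "h holomorphic_on UNIV"
        unfolding h_def by (intro holomorphic_on_diff holo[OF less.prems(3) il PEll] stab_formula_slice[OF \<tau> Pc il])
      show "h (u + 1) = - h u" for u
        using shift[OF lat_1, of u] theta_mult_lattice[OF \<tau>, of 1 0] by simp
      show "h (u + \<tau>) = theta_mult \<tau> \<tau> (u + (x0 + zeta_shift D p i P)) * h u" for u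
        by (rule shift) simp
      show "h u = 0" if "u + (x0 + \<epsilon>) \<in> lat \<tau>" for u
      proof -
        have "r.edge_root i (P(Equiv i := u)) \<in> lat \<tau>"
          using that unfolding r.edge_root_def x0 by (simp add: \<epsilon>_def add_ac split: if_splits)
        then show ?thesis unfolding h_def using on_edge[OF PE PR] by simp
      qed
      show "x0 + zeta_shift D p i P - (x0 + \<epsilon>) \<notin> lat \<tau>"
        using gen[OF less.prems(3) ic] by (simp add: \<epsilon>_def)
    qed
    then show ?thesis by (simp add: h_def)
  qed
qed

text \<open>It vanishes exactly where a denominator of the product could vanish or the degree-one
  argument could fail.\<close>

definition generic_den :: "complex \<Rightarrow> (coord \<Rightarrow> complex) \<Rightarrow> complex" where
  "generic_den \<tau> P = (\<Prod>j\<in>compl_set D p. theta \<tau> (zeta_shift D p j P) * theta \<tau> (zeta_shift D p j P - P Hbar))"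

lemma generic_den_denominator:
  assumes \<tau>: "Im \<tau> > 0"
  shows "denominator (kahler_coords D) (generic_den \<tau>)"
  unfolding generic_den_def[abs_def]
proof (intro denominator_prod denominator_mult)
  fix j assume j: "j \<in> compl_set D p"
  then have jl: "j < dimT D" "j \<notin> p" by (auto simp: compl_set_def)
  \<comment> \<open>Only \<open>zeta_shift D p j\<close> needs to be moved off the lattice, and
    \<open>z_j\<close> has coefficient \<open>1\<close> in it; \<open>1/2\<close> is never a lattice
    point.\<close>
  define P :: "coord \<Rightarrow> complex" where "P = (\<lambda>_. 0)(Kahler j := 1 / 2)"
  have P: "P \<in> cspace (kahler_coords D)" using jl by (auto simp: P_def cspace_def kahler_coords_def)
  have z: "zeta_shift D p j P = 1 / 2" using jl by (auto simp: P_def zeta_shift_def zeta_def intro!: sum.neutral)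
  have PH: "P Hbar = 0" by (simp add: P_def)
  have half: "(1 / 2 :: complex) \<notin> lat \<tau>"
  proof
    assume "(1 / 2 :: complex) \<in> lat \<tau>"
    then obtain a b where ab: "(1 / 2 :: complex) = of_int a + of_int b * \<tau>" by (auto simp: lat_def)
    have "of_int b * Im \<tau> = Im (of_int a + of_int b * \<tau>)" by simp
    also have "\<dots> = 0" unfolding ab[symmetric] by simp
    finally have "b = 0" using \<tau> by simp
    then have "of_int (2 * a) = (of_int 1 :: complex)" using ab by (simp add: field_simps)
    then have "2 * a = 1" unfolding of_int_eq_iff .
    then show False by presburger
  qed
  show "denominator (kahler_coords D) (\<lambda>P. theta \<tau> (zeta_shift D p j P))"
    by (rule denominator_theta[OF \<tau> zeta_shift_form[OF sub jl(1)] P]) (unfold z, rule half)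
  show "denominator (kahler_coords D) (\<lambda>P. theta \<tau> (zeta_shift D p j P - P Hbar))"
    by (rule denominator_theta[OF \<tau> int_form_diff[OF zeta_shift_form[OF sub jl(1)] Hbar_form] P])
       (use half in \<open>simp add: z PH del: divide_eq_eq\<close>)
qed auto

lemma generic_denD:
  assumes "Im \<tau> > 0" "generic_den \<tau> (restrict_coords (kahler_coords D) P) \<noteq> 0" "j \<in> compl_set D p"
  shows "zeta_shift D p j P \<notin> lat \<tau>" "zeta_shift D p j P - P Hbar \<notin> lat \<tau>"
proof -
  let ?R = "restrict_coords (kahler_coords D) P"
  have "theta \<tau> (zeta_shift D p j ?R) \<noteq> 0 \<and> theta \<tau> (zeta_shift D p j ?R - ?R Hbar) \<noteq> 0"
    using assms(2,3) by (auto simp: generic_den_def prod_zero_iff)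
  moreover have "zeta_shift D p j ?R = zeta_shift D p j P" "?R Hbar = P Hbar"
    using int_form_restrict[OF zeta_shift_form[OF sub]] assms(3) by (auto simp: compl_set_def restrict_coords_def kahler_coords_def)
  ultimately show "zeta_shift D p j P \<notin> lat \<tau>" "zeta_shift D p j P - P Hbar \<notin> lat \<tau>"
    using assms(1) by (auto simp: theta_eq_0_iff)
qed

theorem stable_envelope_unique:
  assumes \<tau>: "Im \<tau> > 0" and f: "stable_envelope \<tau> D p f"
  shows "generically (kahler_coords D) (\<lambda>P. P \<in> Ell \<tau> D \<longrightarrow> f P = stab_formula \<tau> D p P)"
proof -
  let ?K = "kahler_coords D"
  have mero: "mero_section \<tau> (coords D) (Ell \<tau> D) ?K (T_bundle \<tau> D p) f"
    and "generically ?K (\<lambda>P. \<forall>v\<in>semistable D.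
       orbit D v \<notin> full_Attr D (vertex_point D p) \<longrightarrow> P \<in> Ell_orbit \<tau> D v \<longrightarrow> f P = 0)"
    and "generically ?K (\<lambda>P. f (lift_point D p P) =
       (\<Prod>i\<in>p_plus D p. theta \<tau> (P Hbar + xres D p i P)) * (\<Prod>i\<in>p_minus D p. theta \<tau> (xres D p i P)))"
    using f by (auto simp: stable_envelope_def)
  then obtain g2 g3 where g2: "denominator ?K g2" and supp: "\<And>P v. g2 (restrict_coords ?K P) \<noteq> 0 \<Longrightarrow> v \<in> semistable D \<Longrightarrow>
       orbit D v \<notin> full_Attr D (vertex_point D p) \<Longrightarrow> P \<in> Ell_orbit \<tau> D v \<Longrightarrow> f P = 0"
    and g3: "denominator ?K g3" and diag: "\<And>P. g3 (restrict_coords ?K P) \<noteq> 0 \<Longrightarrow> f (lift_point D p P) =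
       (\<Prod>i\<in>p_plus D p. theta \<tau> (P Hbar + xres D p i P)) * (\<Prod>i\<in>p_minus D p. theta \<tau> (xres D p i P))"
    unfolding generically_def by blast
  obtain g F where g: "denominator ?K g" and F: "holo_sub (coords D) (Ell \<tau> D) F"
    and Ff: "\<And>P. P \<in> Ell \<tau> D \<Longrightarrow> g (restrict_coords ?K P) \<noteq> 0 \<Longrightarrow> F P = g (restrict_coords ?K P) * f P"
    and quasi: "\<And>L P. L \<in> lat_vec \<tau> (coords D) \<Longrightarrow> P \<in> Ell \<tau> D \<Longrightarrow> g (restrict_coords ?K P) \<noteq> 0 \<Longrightarrow>
        g (restrict_coords ?K (vadd P L)) \<noteq> 0 \<Longrightarrow> f (vadd P L) = T_bundle \<tau> D p L P * f P"
    using mero unfolding mero_section_def by blast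
  \<comment> \<open>The four factors avoid the poles, the exceptions to the support condition, the
    exceptions to the normalization, and the bad Kaehler values.\<close>
  define G where "G P = g P * (g2 P * (g3 P * generic_den \<tau> P))" for P
  have "denominator ?K G"
    unfolding G_def by (intro denominator_mult g g2 g3 generic_den_denominator[OF \<tau>]) auto
  moreover have "f P0 = stab_formula \<tau> D p P0" if G: "G (restrict_coords ?K P0) \<noteq> 0" and P0: "P0 \<in> Ell \<tau> D" for P0
  proof -
    define \<kappa> where "\<kappa> = restrict_coords ?K P0"
    have nz: "g \<kappa> \<noteq> 0" "g2 \<kappa> \<noteq> 0" "g3 \<kappa> \<noteq> 0" "generic_den \<tau> \<kappa> \<noteq> 0" using G by (auto simp: G_def \<kappa>_def)
    obtain r where r: "r \<in> fixed_sets D" "P0 \<in> Ell_comp \<tau> D r" using P0 by (auto simp: Ell_def)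
    show ?thesis
    proof (rule stable_envelope_unique_slice[OF \<tau>, where \<kappa> = \<kappa> and r = r])
      fix P L assume "P \<in> Ell \<tau> D" "restrict_coords ?K P = \<kappa>" "L \<in> lat_vec \<tau> (coords D)"
        "restrict_coords ?K (vadd P L) = \<kappa>"
      then show "f (vadd P L) = T_bundle \<tau> D p L P * f P" using quasi nz by metis
    next
      fix P i assume P: "restrict_coords ?K P = \<kappa>" "i < dimT D" and E: "\<And>u. P(Equiv i := u) \<in> Ell \<tau> D"
      have "Ell \<tau> D \<subseteq> cspace (coords D)" by (auto simp: Ell_def Ell_comp_def)
      then have "(\<lambda>u. F (P(Equiv i := u))) holomorphic_on UNIV"
        using P by (intro holo_sub_slice[OF F E]) (auto simp: coords_def)
      moreover have "f (P(Equiv i := u)) = F (P(Equiv i := u)) * inverse (g \<kappa>)" for u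
        using Ff[OF E[of u]] P nz by (simp add: field_simps)
      ultimately show "(\<lambda>u. f (P(Equiv i := u))) holomorphic_on UNIV"
        by (simp add: holomorphic_on_mult)
    next
      fix P v assume "restrict_coords ?K P = \<kappa>" "v \<in> semistable D"
        "orbit D v \<notin> full_Attr D (vertex_point D p)" "P \<in> Ell_orbit \<tau> D v"
      then show "f P = 0" using supp nz by metis
    next
      fix P assume "restrict_coords ?K P = \<kappa>"
      then show "f (lift_point D p P) =
        (\<Prod>i\<in>p_plus D p. theta \<tau> (P Hbar + xres D p i P)) * (\<Prod>i\<in>p_minus D p. theta \<tau> (xres D p i P))"
        using diag nz by metis
    next
      fix P j assume "restrict_coords ?K P = \<kappa>" "j \<in> compl_set D p"
      then show "zeta_shift D p j P \<notin> lat \<tau> \<and> zeta_shift D p j P - P Hbar \<notin> lat \<tau>"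
        using generic_denD[OF \<tau>] nz by metis
    qed (use r in \<open>simp_all add: \<kappa>_def\<close>)
  qed
  ultimately show ?thesis unfolding generically_def by blast
qed

end

section \<open>The duality interface\<close>

lemma param_coords_mirror [simp]: "param_coords (mirror D) = param_coords D"
  by (simp add: param_coords_def)

lemma finite_pcoords [simp]: "finite (pcoords D)"
  by (simp add: pcoords_def)

lemma finite_qcoords [simp]: "finite (qcoords n)"
  by (simp add: qcoords_def)

context regular_vertex
begin

text \<open>At the mirror vertex \<open>p_minus\<close> and \<open>p_plus\<close> take the roles of
  \<open>A_plus\<close> and \<open>A_minus\<close>, and \<open>\<hbar>'\<close> is the inverse of
  \<open>\<hbar>\<close>, which turns the restriction on \<open>p_plus\<close> into
  \<open>Hbar\<close>. The coefficients become minus their transpose, which turns the restriction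
  formula outside \<open>p\<close> into \<open>zeta_shift\<close>.\<close>

lemma mirror_xres:
  assumes "i < dimT D"
  shows "xres (mirror D) (compl_set D p) i (kappa P) =
    (if i \<in> p_plus D p then P Hbar else if i \<in> p_minus D p then 0 else zeta_shift D p i P)"
proof -
  note wt = mirror_wt[OF dual sub]
  have "zeta_shift D p i P = P (Kahler i) - (\<Sum>j\<in>p. of_int (coef (mirror D) (compl_set D p) i j) * P (Kahler j)) +
      of_int (\<Sum>j\<in>p_plus D p. coef (mirror D) (compl_set D p) i j) * P Hbar" if "i \<notin> p"
  proof -
    have ic: "i \<in> compl_set D p" using that assms by (simp add: compl_set_def)
    have "j \<in> p" if "j \<in> p_plus D p" for j using that by (simp add: p_plus_def)
    then show ?thesis using ic by (simp add: wt zeta_shift_def zeta_def sum_negf)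
  qed
  moreover have "i \<in> p \<longleftrightarrow> i \<in> p_plus D p \<or> i \<in> p_minus D p" using p_decomp by blast
  moreover have "i \<in> p_plus D p \<Longrightarrow> i \<notin> p_minus D p" using p_decomp by blast
  moreover have "i \<in> compl_set D p \<longleftrightarrow> i \<notin> p" using assms by (simp add: compl_set_def)
  ultimately show ?thesis
    by (auto simp: xres_def mirror_parts compl_compl_set[OF sub])
qed

text \<open>For \<open>i \<in> p\<close> the factors match those of \<open>T_prod\<close> directly.
  Outside \<open>p\<close> the second product cancels the denominators, the shift by
  \<open>- Hbar\<close> on \<open>A_minus\<close> being \<open>\<hbar>'\<close>.\<close>

lemma T_prod_mirror:
  fixes \<gamma> :: "complex \<Rightarrow> complex \<Rightarrow> complex"
  defines "x \<equiv> \<lambda>i P. xres (mirror D) (compl_set D p) i (kappa P)"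
  assumes nz: "\<And>j. j \<in> compl_set D p \<Longrightarrow> \<gamma> (zeta_shift D p j L) (zeta_shift D p j P) \<noteq> 0 \<and>
    \<gamma> (- L Hbar + zeta_shift D p j L) (- P Hbar + zeta_shift D p j P) \<noteq> 0"
  shows "T_prod D p (\<lambda>l. \<gamma> (l L) (l P)) *
      ((\<Prod>j\<in>A_minus D p. \<gamma> (- L Hbar + x j L) (- P Hbar + x j P)) * (\<Prod>j\<in>A_plus D p. \<gamma> (x j L) (x j P))) =
    (\<Prod>i<dimT D. \<gamma> (xroot D i L + x i L) (xroot D i P + x i P))"
proof -
  let ?g = "\<lambda>i. \<gamma> (xroot D i L + x i L) (xroot D i P + x i P)"
  have x: "i \<in> p_plus D p \<Longrightarrow> x i Q = Q Hbar" "i \<in> p_minus D p \<Longrightarrow> x i Q = 0"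
    "i \<in> compl_set D p \<Longrightarrow> x i Q = zeta_shift D p i Q" for i Q
    unfolding x_def using mirror_xres[of i Q] p_decomp parts_lt[of i]
    by (auto simp: compl_set_def)
  have c: "j \<in> A_plus D p \<or> j \<in> A_minus D p \<Longrightarrow> j \<in> compl_set D p" for j by (auto simp: A_plus_def A_minus_def)
  have "(\<Prod>i<dimT D. ?g i) = (\<Prod>i\<in>p. ?g i) * (\<Prod>i\<in>compl_set D p. ?g i)"
    using sub prod.subset_diff[of p "{..<dimT D}" ?g] by (simp add: compl_set_def mult.commute)
  also have "(\<Prod>i\<in>p. ?g i) = (\<Prod>i\<in>p_plus D p. ?g i) * (\<Prod>i\<in>p_minus D p. ?g i)"
    by (subst p_decomp(1), rule prod.union_disjoint) (use p_decomp in auto)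
  also have "(\<Prod>i\<in>compl_set D p. ?g i) = (\<Prod>i\<in>A_plus D p. ?g i) * (\<Prod>i\<in>A_minus D p. ?g i)"
    by (subst A_decomp(1), rule prod.union_disjoint) (use A_decomp in auto)
  also have "(\<Prod>i\<in>p_plus D p. ?g i) = (\<Prod>i\<in>p_plus D p. \<gamma> (L Hbar + xroot D i L) (P Hbar + xroot D i P))"
    by (intro prod.cong) (auto simp: x add.commute)
  also have "(\<Prod>i\<in>p_minus D p. ?g i) = (\<Prod>i\<in>p_minus D p. \<gamma> (xroot D i L) (xroot D i P))"
    by (intro prod.cong) (auto simp: x)
  also have "(\<Prod>i\<in>A_plus D p. ?g i) =
      (\<Prod>j\<in>A_plus D p. \<gamma> (xroot D j L + zeta_shift D p j L) (xroot D j P + zeta_shift D p j P) /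
         \<gamma> (zeta_shift D p j L) (zeta_shift D p j P)) * (\<Prod>j\<in>A_plus D p. \<gamma> (x j L) (x j P))"
    unfolding prod.distrib[symmetric] using nz c by (intro prod.cong) (auto simp: x)
  also have "(\<Prod>i\<in>A_minus D p. ?g i) =
      (\<Prod>j\<in>A_minus D p. \<gamma> (xroot D j L + zeta_shift D p j L) (xroot D j P + zeta_shift D p j P) /
         \<gamma> (- L Hbar + zeta_shift D p j L) (- P Hbar + zeta_shift D p j P)) *
      (\<Prod>j\<in>A_minus D p. \<gamma> (- L Hbar + x j L) (- P Hbar + x j P))"
    unfolding prod.distrib[symmetric] using nz c by (intro prod.cong) (auto simp: x)
  finally show ?thesis unfolding T_prod_def by (simp only: mult_ac)
qed

lemma M_bundle_eq:
  "M_bundle \<tau> D p L P = (\<Prod>i<dimT D. theta_mult \<tau>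
      (xroot D i L + xres (mirror D) (compl_set D p) i (kappa L))
      (xroot D i P + xres (mirror D) (compl_set D p) i (kappa P)))"
proof -
  interpret m: regular_vertex "mirror D" "compl_set D p" "\<lambda>i j. T j i" "\<lambda>r i. S i r" e b
    by (rule mirror_vertex)
  have "T_bundle \<tau> (mirror D) (compl_set D p) (mirror_lift D p L) (mirror_lift D p P) =
     (\<Prod>j\<in>A_minus D p. theta_mult \<tau> (- L Hbar + xres (mirror D) (compl_set D p) j (kappa L))
        (- P Hbar + xres (mirror D) (compl_set D p) j (kappa P))) *
     (\<Prod>j\<in>A_plus D p. theta_mult \<tau> (xres (mirror D) (compl_set D p) j (kappa L))
        (xres (mirror D) (compl_set D p) j (kappa P)))"
    unfolding T_bundle_def mirror_lift_def
    by (subst m.T_prod_lift) (simp_all add: theta_mult_nonzero mirror_parts)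
  then show ?thesis
    unfolding M_bundle_def T_bundle_def
    using T_prod_mirror[of "theta_mult \<tau>" L P] by (simp add: theta_mult_nonzero)
qed

text \<open>\<open>f'\<close> enters through its diagonal restriction, which the normalization
  prescribes. Its exceptional locus lies in the \<open>a_i\<close> and \<open>Hbar\<close>, that of
  \<open>f\<close> in the \<open>z_i\<close> and \<open>Hbar\<close>, so both conditions are pulled
  back to all parameters before they are combined.\<close>

lemma bold_stab_eq:
  assumes \<tau>: "Im \<tau> > 0" and f: "stable_envelope \<tau> D p f"
    and f': "stable_envelope \<tau> (mirror D) (compl_set D p) f'"
  shows "generically (param_coords D) (\<lambda>P. P \<in> Ell \<tau> D \<longrightarrow>
    (\<Prod>i<dimT D. theta \<tau> (xroot D i P + xres (mirror D) (compl_set D p) i (kappa P))) = bold_stab D p f f' P)"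
proof -
  let ?x = "\<lambda>j P. xres (mirror D) (compl_set D p) j (kappa P)"
  have diag': "generically (kahler_coords (mirror D)) (\<lambda>P. f' (lift_point (mirror D) (compl_set D p) P) =
      (\<Prod>j\<in>A_minus D p. theta \<tau> (P Hbar + xres (mirror D) (compl_set D p) j P)) *
      (\<Prod>j\<in>A_plus D p. theta \<tau> (xres (mirror D) (compl_set D p) j P)))"
    using f' by (simp add: stable_envelope_def mirror_parts)
  have "generically (param_coords D) (\<lambda>P. f' (mirror_lift D p P) =
      (\<Prod>j\<in>A_minus D p. theta \<tau> (- P Hbar + ?x j P)) * (\<Prod>j\<in>A_plus D p. theta \<tau> (?x j P)))"
    by (rule generically_pullback[OF diag', where \<phi> = kappa and s = "\<lambda>c. if c = Hbar then -1 else 1"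
          and \<pi> = "\<lambda>c. case c of Kahler i \<Rightarrow> Equiv i | c \<Rightarrow> c"])
       (auto simp: mirror_lift_def kahler_coords_def param_coords_def inj_on_def split: coord.splits)
  moreover have "generically (kahler_coords D) (\<lambda>P. (P \<in> Ell \<tau> D \<longrightarrow> f P = stab_formula \<tau> D p P) \<and>
      generic_den \<tau> (restrict_coords (kahler_coords D) P) \<noteq> 0)"
    by (intro generically_conj stable_envelope_unique[OF \<tau> f] generically_denominator generic_den_denominator[OF \<tau>]) simp
  then have "generically (param_coords D) (\<lambda>P. (P \<in> Ell \<tau> D \<longrightarrow> f P = stab_formula \<tau> D p P) \<and>
      generic_den \<tau> (restrict_coords (kahler_coords D) P) \<noteq> 0)"
    by (rule generically_pullback[where \<phi> = "\<lambda>P. P" and s = "\<lambda>_. 1" and \<pi> = "\<lambda>c. c"])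
       (use kahler_subset(2) in auto)
  ultimately have "generically (param_coords D) (\<lambda>P. f' (mirror_lift D p P) =
      (\<Prod>j\<in>A_minus D p. theta \<tau> (- P Hbar + ?x j P)) * (\<Prod>j\<in>A_plus D p. theta \<tau> (?x j P)) \<and>
      (P \<in> Ell \<tau> D \<longrightarrow> f P = stab_formula \<tau> D p P) \<and>
      generic_den \<tau> (restrict_coords (kahler_coords D) P) \<noteq> 0)"
    by (rule generically_conj[OF finite_coord_sets(3)])
  then show ?thesis
  proof (rule generically_mono, intro impI, elim conjE)
    fix P assume f'P: "f' (mirror_lift D p P) =
        (\<Prod>j\<in>A_minus D p. theta \<tau> (- P Hbar + ?x j P)) * (\<Prod>j\<in>A_plus D p. theta \<tau> (?x j P))"
      and fP: "P \<in> Ell \<tau> D \<longrightarrow> f P = stab_formula \<tau> D p P" and P: "P \<in> Ell \<tau> D"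
      and den: "generic_den \<tau> (restrict_coords (kahler_coords D) P) \<noteq> 0"
    have "theta \<tau> (zeta_shift D p j P) \<noteq> 0 \<and> theta \<tau> (- P Hbar + zeta_shift D p j P) \<noteq> 0"
      if "j \<in> compl_set D p" for j
      using generic_denD[OF \<tau> den that] by (simp add: theta_eq_0_iff[OF \<tau>])
    from T_prod_mirror[of "\<lambda>_. theta \<tau>", OF this]
    show "(\<Prod>i<dimT D. theta \<tau> (xroot D i P + ?x i P)) = bold_stab D p f f' P"
      unfolding bold_stab_def f'P mp[OF fP P] stab_formula_def by simp
  qed
qed

end

section \<open>Restriction along the two embeddings\<close>

lemma xres_kappa_cong:
  assumes "\<And>i. P (Equiv i) = Q (Equiv i)" "P Hbar = Q Hbar"
  shows "xres D p i P = xres D p i Q"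
  using assms by (simp add: xres_def)

lemma proj_embed [simp]: "proj_X (embed_X D p P) = P" "proj_X' (embed_X' D p P) = P"
proof -
  show "proj_X (embed_X D p P) = P"
  proof
    fix c show "proj_X (embed_X D p P) c = P c" by (cases c) auto
  qed
  show "proj_X' (embed_X' D p P) = P"
  proof
    fix c show "proj_X' (embed_X' D p P) c = P c" by (cases c) auto
  qed
qed

context regular_vertex
begin

lemma xroot_embed_X:
  assumes "i < dimT D"
  shows "xroot (mirror D) i (proj_X' (embed_X D p P)) = xres (mirror D) (compl_set D p) i (kappa P)"
proof -
  interpret m: regular_vertex "mirror D" "compl_set D p" "\<lambda>i j. T j i" "\<lambda>r i. S i r" e b
    by (rule mirror_vertex)
  have "xroot (mirror D) i (proj_X' (embed_X D p P)) = xroot (mirror D) i (mirror_lift D p P)"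
    using m.lift_point(3)[of i "kappa P"] assms by (simp add: xroot_def mirror_lift_def)
  then show ?thesis using m.lift_point(5)[of i "kappa P"] assms by (simp add: mirror_lift_def)
qed

lemma xroot_embed_X':
  assumes "i < dimT D"
  shows "xroot D i (proj_X (embed_X' D p P)) = xres D p i (kappa P)"
proof -
  have "xroot D i (proj_X (embed_X' D p P)) = xroot D i (lift_point D p (kappa P))"
    using lift_point(3)[of i "kappa P"] assms by (simp add: xroot_def)
  then show ?thesis using lift_point(5)[of i "kappa P"] assms by simp
qed

lemma embed_X_in_Ell_prod:
  assumes P: "P \<in> Ell \<tau> D"
  shows "embed_X D p P \<in> Ell_prod \<tau> D"
proof -
  interpret m: regular_vertex "mirror D" "compl_set D p" "\<lambda>i j. T j i" "\<lambda>r i. S i r" e b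
    by (rule mirror_vertex)
  obtain r where r: "r \<in> fixed_sets D" and Pr: "P \<in> Ell_comp \<tau> D r" using P by (auto simp: Ell_def)
  have Pc: "P \<in> cspace (coords D)" using Pr by (simp add: Ell_comp_def)
  have Pc': "mirror_lift D p P \<in> cspace (coords (mirror D))" unfolding mirror_lift_def by (rule m.lift_point(1))
  have "embed_X D p P c = 0" if "c \<notin> pcoords D" for c
    using that by (cases c) (auto simp: pcoords_def coords_def intro!: cspace_outside[OF Pc] cspace_outside[OF Pc'])
  then have "embed_X D p P \<in> cspace (pcoords D)" by (simp add: cspace_def)
  moreover have "xres (mirror D) (compl_set D p) i (proj_X' (embed_X D p P)) = xres (mirror D) (compl_set D p) i (kappa P)" for i
    by (rule xres_kappa_cong) auto
  ultimately show ?thesis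
    unfolding Ell_prod_def
    by (intro UN_I[OF r] UN_I[OF mirror_fixed]) (use Pr in \<open>simp add: xroot_embed_X Ell_comp_def\<close>)
qed

lemma embed_X'_in_Ell_prod:
  assumes P: "P \<in> Ell \<tau> (mirror D)"
  shows "embed_X' D p P \<in> Ell_prod \<tau> D"
proof -
  obtain r where r: "r \<in> fixed_sets (mirror D)" and Pr: "P \<in> Ell_comp \<tau> (mirror D) r" using P by (auto simp: Ell_def)
  have Pc: "P \<in> cspace (coords (mirror D))" using Pr by (simp add: Ell_comp_def)
  have Pc': "lift_point D p (kappa P) \<in> cspace (coords D)" by (rule lift_point(1))
  have "embed_X' D p P c = 0" if "c \<notin> pcoords D" for c
    using that by (cases c) (auto simp: pcoords_def coords_def intro!: cspace_outside[OF Pc] cspace_outside[OF Pc'])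
  then have "embed_X' D p P \<in> cspace (pcoords D)" by (simp add: cspace_def)
  moreover have "xres D p i (proj_X (embed_X' D p P)) = xres D p i (kappa P)" for i
    by (rule xres_kappa_cong) auto
  ultimately show ?thesis
    unfolding Ell_prod_def
    by (intro UN_I[OF fixed] UN_I[OF r]) (use Pr in \<open>simp add: xroot_embed_X' Ell_comp_def\<close>)
qed

end

section \<open>The interface and its origin on the prequotient\<close>

definition interface_form :: "hypertoric \<Rightarrow> nat \<Rightarrow> (pcoord \<Rightarrow> complex) \<Rightarrow> complex" where
  "interface_form D i P = xroot D i (proj_X P) + xroot (mirror D) i (proj_X' P)"

text \<open>The logarithm of \<open>x_i x_i'\<close> before the Chern roots are expressed through
  \<open>iota\<close> and \<open>beta\<close>: \<open>QT'dual i\<close> stands for the contribution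
  of the Chern roots of \<open>X\<close> to \<open>x_i\<close>, and \<open>QTdual i\<close> for that
  of \<open>X'\<close> to \<open>x_i'\<close>.\<close>

definition preq_form :: "nat \<Rightarrow> (qcoord \<Rightarrow> complex) \<Rightarrow> complex" where
  "preq_form i Q = (Q (QT i) + Q (QT'dual i)) + (Q (QT' i) + Q (QTdual i))"

lemma preq_form_int: "i < n \<Longrightarrow> int_form (qcoords n) (preq_form i)"
  unfolding preq_form_def[abs_def]
  by (intro int_form_add int_form_coord) (auto simp: qcoords_def)

lemma interface_form_int:
  assumes "i < dimT D"
  shows "int_form (pcoords D) (interface_form D i)"
proof -
  have "int_form (pcoords D) (\<lambda>P. (P (PEquiv i) + (\<Sum>j<dimK D. of_int (iota D i j) * P (PGauge j))) +
      (P (PEquiv' i) + (\<Sum>r<dimA D. of_int (beta D r i) * P (PGauge' r))))"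
    by (intro int_form_add int_form_sum int_form_scale int_form_coord) (use assms in \<open>auto simp: pcoords_def\<close>)
  then show ?thesis unfolding interface_form_def[abs_def] xroot_def by simp
qed

lemma preq_interface: "i < dimT D \<Longrightarrow> preq_form i (to_preq D P) = interface_form D i P"
  by (simp add: preq_form_def interface_form_def xroot_def)

lemma Ell_prod_cspace: "Ell_prod \<tau> D \<subseteq> cspace (pcoords D)"
  by (auto simp: Ell_prod_def)

theorem theorem1p3:
  fixes \<tau> :: complex and k n d :: nat and \<iota> \<beta> :: "nat \<Rightarrow> nat \<Rightarrow> int"
  assumes "Im \<tau> > 0" and "exact_seq k n d \<iota> \<beta>"
  shows "\<exists>U u. line_bundle \<tau> (qcoords n) (cspace (qcoords n)) U \<and>
    holo_section \<tau> (qcoords n) (cspace (qcoords n)) U u \<and>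
    (\<forall>\<theta> \<sigma> :: nat \<Rightarrow> int. \<forall>D.
       D = \<lparr>dimK = k, dimT = n, dimA = d, iota = \<iota>, beta = \<beta>, lift_theta = \<theta>, lift_sigma = \<sigma>\<rparr> \<longrightarrow>
       generic_theta D \<longrightarrow> smooth_hypertoric D \<longrightarrow> generic_sigma D \<longrightarrow>
       (\<exists>M m.
          \<comment> \<open>the line bundle\<close>
          line_bundle \<tau> (pcoords D) (Ell_prod \<tau> D) M \<and>
          (\<forall>p\<in>fixed_sets D. compl_set D p \<in> fixed_sets (mirror D) \<and>
             embed_X D p ` Ell \<tau> D \<subseteq> Ell_prod \<tau> D \<and>
             embed_X' D p ` Ell \<tau> (mirror D) \<subseteq> Ell_prod \<tau> D \<and>
             (\<forall>L\<in>lat_vec \<tau> (coords D). \<forall>P\<in>Ell \<tau> D.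
                M (embed_X D p L) (embed_X D p P) = M_bundle \<tau> D p L P) \<and>
             (\<forall>L\<in>lat_vec \<tau> (coords (mirror D)). \<forall>P\<in>Ell \<tau> (mirror D).
                M (embed_X' D p L) (embed_X' D p P) =
                M_bundle \<tau> (mirror D) (compl_set D p) L P)) \<and>
          \<comment> \<open>the duality interface\<close>
          holo_section \<tau> (pcoords D) (Ell_prod \<tau> D) M m \<and>
          (\<forall>p\<in>fixed_sets D. \<forall>S S'.
             stable_envelope \<tau> D p S \<longrightarrow>
             stable_envelope \<tau> (mirror D) (compl_set D p) S' \<longrightarrow>
             generically (param_coords D) (\<lambda>P. P \<in> Ell \<tau> D \<longrightarrow>
               m (embed_X D p P) = bold_stab D p S S' P) \<and>
             generically (param_coords (mirror D)) (\<lambda>P. P \<in> Ell \<tau> (mirror D) \<longrightarrow>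
               m (embed_X' D p P) = bold_stab (mirror D) (compl_set D p) S' S P)) \<and>
          \<comment> \<open>its explicit form, and its origin on the prequotient\<close>
          (\<forall>P\<in>Ell_prod \<tau> D.
             m P = (\<Prod>i<n. theta \<tau> (xroot D i (proj_X P) + xroot (mirror D) i (proj_X' P)))) \<and>
          (\<forall>L\<in>lat_vec \<tau> (pcoords D). \<forall>P\<in>Ell_prod \<tau> D. M L P = U (to_preq D L) (to_preq D P)) \<and>
          (\<forall>P\<in>Ell_prod \<tau> D. m P = u (to_preq D P))))"
proof -
  note \<tau> = assms(1)
  \<comment> \<open>Chosen before \<open>\<theta>\<close> and \<open>\<sigma>\<close>; even
    \<open>iota\<close> and \<open>beta\<close> enter only through \<open>to_preq\<close>.\<close>
  define U where "U = (\<lambda>L P. \<Prod>i<n. theta_mult \<tau> (preq_form i L) (preq_form i P))"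
  define u where "u = (\<lambda>P. \<Prod>i<n. theta \<tau> (preq_form i P))"
  show ?thesis
  proof (intro exI[of _ U] exI[of _ u] conjI allI impI, goal_cases)
    case 1
    show ?case unfolding U_def by (rule theta_prod_line_bundle[OF \<tau> preq_form_int]) auto
  next
    case 2
    show ?case unfolding U_def u_def by (rule theta_prod_holo_section[OF \<tau> preq_form_int]) auto
  next
    case (3 \<theta> \<sigma> D)
    note D = 3(1)
    have n: "dimT D = n" by (simp add: D)
    \<comment> \<open>Regularity is derived only in the presence of a vertex, as the exchange
      argument starts from one; all claims about restrictions come with such a
      \<open>p\<close>.\<close>
    have reg: "regular D" if "p \<in> fixed_sets D" for p
      by (rule regular_if_generic) (use assms(2) 3(2-4) that in \<open>auto simp: D\<close>)
    define M where "M = (\<lambda>L P. \<Prod>i<n. theta_mult \<tau> (interface_form D i L) (interface_form D i P))"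
    define m where "m = (\<lambda>P. \<Prod>i<n. theta \<tau> (interface_form D i P))"
    have int: "\<And>i. i \<in> {..<n} \<Longrightarrow> int_form (pcoords D) (interface_form D i)"
      using interface_form_int by (simp add: n)
    have pre: "M L P = U (to_preq D L) (to_preq D P)" "m P = u (to_preq D P)" for L P
      by (simp_all add: M_def m_def U_def u_def preq_interface n)
    have lbundle: "line_bundle \<tau> (pcoords D) (Ell_prod \<tau> D) M"
      unfolding M_def by (rule theta_prod_line_bundle[OF \<tau> int Ell_prod_cspace])
    have sect: "holo_section \<tau> (pcoords D) (Ell_prod \<tau> D) M m"
      unfolding M_def m_def by (rule theta_prod_holo_section[OF \<tau> int Ell_prod_cspace])
    have at_vertex: "compl_set D p \<in> fixed_sets (mirror D)"
        "embed_X D p ` Ell \<tau> D \<subseteq> Ell_prod \<tau> D" "embed_X' D p ` Ell \<tau> (mirror D) \<subseteq> Ell_prod \<tau> D"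
        "M (embed_X D p L) (embed_X D p P) = M_bundle \<tau> D p L P"
        "M (embed_X' D p L) (embed_X' D p P) = M_bundle \<tau> (mirror D) (compl_set D p) L P"
        "stable_envelope \<tau> D p S \<Longrightarrow> stable_envelope \<tau> (mirror D) (compl_set D p) S' \<Longrightarrow>
           generically (param_coords D) (\<lambda>P. P \<in> Ell \<tau> D \<longrightarrow> m (embed_X D p P) = bold_stab D p S S' P)"
        "stable_envelope \<tau> D p S \<Longrightarrow> stable_envelope \<tau> (mirror D) (compl_set D p) S' \<Longrightarrow>
           generically (param_coords (mirror D)) (\<lambda>P. P \<in> Ell \<tau> (mirror D) \<longrightarrow>
               m (embed_X' D p P) = bold_stab (mirror D) (compl_set D p) S' S P)"
      if p: "p \<in> fixed_sets D" for p L P S S'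
    proof -
      obtain A T b e where "regular_vertex D p A T b e" using regular_vertexE[OF reg[OF p] p] .
      then interpret v: regular_vertex D p A T b e .
      \<comment> \<open>Since \<open>mirror\<close> is an involution and \<open>p\<close> is the
        complement of its complement, the claims on \<open>X'\<close> are those on \<open>X\<close>
        for the mirror data.\<close>
      interpret v': regular_vertex "mirror D" "compl_set D p" "\<lambda>i j. T j i" "\<lambda>r i. A i r" e b
        by (rule v.mirror_vertex)
      have form: "interface_form D i (embed_X D p P) = xroot D i P + xres (mirror D) (compl_set D p) i (kappa P)"
        "interface_form D i (embed_X' D p P) = xroot (mirror D) i P + xres D p i (kappa P)"
        if "i < n" for i P
        using that by (simp_all add: interface_form_def v.xroot_embed_X v.xroot_embed_X' n)
      show "compl_set D p \<in> fixed_sets (mirror D)" by (rule v.mirror_fixed)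
      show "embed_X D p ` Ell \<tau> D \<subseteq> Ell_prod \<tau> D" "embed_X' D p ` Ell \<tau> (mirror D) \<subseteq> Ell_prod \<tau> D"
        using v.embed_X_in_Ell_prod v.embed_X'_in_Ell_prod by auto
      show "M (embed_X D p L) (embed_X D p P) = M_bundle \<tau> D p L P"
        by (simp add: M_def form v.M_bundle_eq n)
      show "M (embed_X' D p L) (embed_X' D p P) = M_bundle \<tau> (mirror D) (compl_set D p) L P"
        by (simp add: M_def form v'.M_bundle_eq n compl_compl_set[OF v.sub])
      assume S: "stable_envelope \<tau> D p S" "stable_envelope \<tau> (mirror D) (compl_set D p) S'"
      show "generically (param_coords D) (\<lambda>P. P \<in> Ell \<tau> D \<longrightarrow> m (embed_X D p P) = bold_stab D p S S' P)"
        using v.bold_stab_eq[OF \<tau> S] by (simp add: m_def form n)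
      show "generically (param_coords (mirror D)) (\<lambda>P. P \<in> Ell \<tau> (mirror D) \<longrightarrow>
               m (embed_X' D p P) = bold_stab (mirror D) (compl_set D p) S' S P)"
        using v'.bold_stab_eq[OF \<tau> S(2), of S] S(1) by (simp add: m_def form n compl_compl_set[OF v.sub])
    qed
    show ?case
      by (rule exI[of _ M], rule exI[of _ m], intro conjI ballI allI impI lbundle sect pre)
         (use at_vertex in \<open>simp_all add: m_def interface_form_def\<close>)
  qed
qed

end
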